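(* Let $n\geqslant1$, $T>0$ and $q\in L_2([0,T];\mathbb M^n_{\mathbb C})$. Let $w$ be the kernel associated with $q$ (defined in the context), and let $W^T_{\mathrm v}$ be the operator $$(W^T_{\mathrm v}f)(x)=f(T-x)+\int_x^T w(x,s)f(T-s)\,ds,\qquad x\in[0,T].$$ Then the restriction of $W^T_{\mathrm v}$ to the Sobolev space $H^2([0,T];\mathbb C^n)$ is an isomorphism in this space, i.e. it maps $H^2([0,T];\mathbb C^n)$ bijectively onto $H^2([0,T];\mathbb C^n)$ and both it and its inverse are bounded in the norm of $H^2([0,T];\mathbb C^n)$.
   Context: $\mathbb M^n_{\mathbb C}$ is the space of complex $n\times n$ matrices. $H^2([0,T];\mathbb C^n)$ is the Sobolev space of functions $y$ with $y,y'$ absolutely continuous on $[0,T]$ and $y''\in L_2([0,T];\mathbb C^n)$, with its usual norm. The kernel $w$: let $v(\xi,\eta)$ be the unique continuous $\mathbb M^n_{\mathbb C}$-valued solution of the integral equation $$v(\xi,\eta)=-\frac12\int_{\xi/2}^{\eta/2}q(s)\,ds-\frac14\int_0^{\xi}d\xi_1\int_{\xi}^{\eta}d\eta_1\,q\Big(\frac{\eta_1-\xi_1}{2}\Big)v(\xi_1,\eta_1),$$ for $0\leqslant\xi\leqslant\eta$, and put $w(x,t):=v(t-x,t+x)$ for $0\leqslant x\leqslant t\leqslant T$ (the values of $w$ for $0\leqslant x\leqslant t\leqslant T$ depend only on the values of $q$ on $[0,T]$). $W^T_{\mathrm v}$ is a bounded operator in $L_2([0,T];\mathbb C^n)$. 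*)

theory Defs
  imports "HOL-Analysis.Analysis"
begin

definition L2_on :: "real set \<Rightarrow> (real \<Rightarrow> 'a::euclidean_space) \<Rightarrow> bool" where
  "L2_on S f \<longleftrightarrow> f \<in> borel_measurable (lebesgue_on S) \<and>
     integrable (lebesgue_on S) (\<lambda>x. (norm (f x))\<^sup>2)"

text \<open>The usual \<open>\<epsilon>\<close>-\<open>\<delta>\<close> definition. A finite family of non-overlapping compact intervals is a
  division \<open>D\<close> of its own union, and \<open>Inf K\<close>, \<open>Sup K\<close> are the end points of \<open>K \<in> D\<close>.\<close>

definition abs_continuous_on :: "real set \<Rightarrow> (real \<Rightarrow> 'a::real_normed_vector) \<Rightarrow> bool" where
  "abs_continuous_on S f \<longleftrightarrow>
     (\<forall>\<epsilon>>0. \<exists>\<delta>>0. \<forall>D. D division_of \<Union>D \<and> \<Union>D \<subseteq> S \<and> (\<Sum>K\<in>D. Sup K - Inf K) < \<delta> \<longrightarrow>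
        (\<Sum>K\<in>D. norm (f (Sup K) - f (Inf K))) < \<epsilon>)"

text \<open>Derivative on \<open>[0,T]\<close>, one-sided at the end points; meaningful only at those points where the
  function is differentiable within \<open>[0,T]\<close>.\<close>

definition deriv_on :: "real \<Rightarrow> (real \<Rightarrow> 'a::real_normed_vector) \<Rightarrow> real \<Rightarrow> 'a" where
  "deriv_on T y = (\<lambda>x. vector_derivative y (at x within {0..T}))"

text \<open>Functions on \<open>[0,T]\<close> are represented by their extension by zero to the real line, so that equality
  of functions on \<open>[0,T]\<close> is equality in HOL. An element of \<open>H\<^sup>2\<close> is its continuous representative;
  its second derivative need only exist almost everywhere.\<close>

definition H2 :: "real \<Rightarrow> (real \<Rightarrow> complex^'n) set" where
  "H2 T = {y. (\<forall>x. x \<notin> {0..T} \<longrightarrow> y x = 0) \<and>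
     abs_continuous_on {0..T} y \<and>
     (\<forall>x\<in>{0..T}. y differentiable (at x within {0..T})) \<and>
     abs_continuous_on {0..T} (deriv_on T y) \<and>
     (AE x in lebesgue_on {0..T}. deriv_on T y differentiable (at x within {0..T})) \<and>
     L2_on {0..T} (deriv_on T (deriv_on T y))}"

definition H2_norm :: "real \<Rightarrow> (real \<Rightarrow> complex^'n) \<Rightarrow> real" where
  "H2_norm T y = sqrt (LINT x|lebesgue_on {0..T}.
     (norm (y x))\<^sup>2 + (norm (deriv_on T y x))\<^sup>2 + (norm (deriv_on T (deriv_on T y) x))\<^sup>2)"

text \<open>The integral equation for \<open>v\<close> on the part \<open>0 \<le> \<xi> \<le> \<eta> \<le> 2T\<close> of the domain, where it involves the
  values of \<open>q\<close> on \<open>[0,T]\<close> only. For \<open>q\<close> in \<open>L\<^sub>2\<close> and continuous \<open>v\<close> all integrands are absolutely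
  integrable, so these gauge integrals are Lebesgue integrals.\<close>

definition kernel_domain :: "real \<Rightarrow> (real \<times> real) set" where
  "kernel_domain T = {(\<xi>, \<eta>). 0 \<le> \<xi> \<and> \<xi> \<le> \<eta> \<and> \<eta> \<le> 2 * T}"

definition kernel_solution ::
    "real \<Rightarrow> (real \<Rightarrow> complex^'n^'n) \<Rightarrow> (real \<Rightarrow> real \<Rightarrow> complex^'n^'n) \<Rightarrow> bool" where
  "kernel_solution T q v \<longleftrightarrow>
     continuous_on (kernel_domain T) (\<lambda>(\<xi>, \<eta>). v \<xi> \<eta>) \<and>
     (\<forall>(\<xi>, \<eta>) \<in> kernel_domain T.
        v \<xi> \<eta> = - ((1/2) *\<^sub>R integral {\<xi>/2..\<eta>/2} q)
               - (1/4) *\<^sub>R integral {0..\<xi>} (\<lambda>\<xi>\<^sub>1. integral {\<xi>..\<eta>} (\<lambda>\<eta>\<^sub>1.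
                   q ((\<eta>\<^sub>1 - \<xi>\<^sub>1) / 2) ** v \<xi>\<^sub>1 \<eta>\<^sub>1)))"

definition W_op :: "real \<Rightarrow> (real \<Rightarrow> real \<Rightarrow> complex^'n^'n) \<Rightarrow> (real \<Rightarrow> complex^'n) \<Rightarrow> real \<Rightarrow> complex^'n" where
  "W_op T w f = (\<lambda>x. if x \<in> {0..T}
     then f (T - x) + integral {x..T} (\<lambda>s. w x s *v f (T - s)) else 0)"

definition H2_isomorphism :: "real \<Rightarrow> ((real \<Rightarrow> complex^'n) \<Rightarrow> real \<Rightarrow> complex^'n) \<Rightarrow> bool" where
  "H2_isomorphism T A \<longleftrightarrow>
     (\<forall>f\<in>H2 T. \<forall>g\<in>H2 T. \<forall>a b. A (\<lambda>x. a *s f x + b *s g x) = (\<lambda>x. a *s A f x + b *s A g x)) \<and>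
     bij_betw A (H2 T) (H2 T) \<and>
     (\<exists>C. \<forall>f\<in>H2 T. H2_norm T (A f) \<le> C * H2_norm T f) \<and>
     (\<exists>C. \<forall>g\<in>H2 T. H2_norm T (inv_into (H2 T) A g) \<le> C * H2_norm T g)"

end

theory Submission
  imports Defs
begin

text \<open>
  An element of \<open>H\<^sup>2\<close> is determined by two numbers and its second derivative in \<open>L\<^sub>2\<close>, and the
  \<open>H\<^sup>2\<close> norm is equivalent to the size of these data. Let \<open>y = W f\<close>. In characteristic coordinates the
  integral equation of the kernel is Duhamel's formula for the wave equation
  \<open>u\<^sub>t\<^sub>t - u\<^sub>x\<^sub>x + q u = 0\<close> on the half line, and \<open>y\<close> is the solution at time \<open>T\<close> with boundary
  control \<open>f\<close>. Hence \<open>y(T) = f(0)\<close>, \<open>y'(T) = - f'(0) - w(T,T) f(0)\<close> and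
  \<open>y'' = q y + W f'' + w(x,T) f'(0) + w\<^sub>t(x,T) f(0)\<close>, where \<open>w\<^sub>t(\<cdot>,T)\<close> is square integrable. So \<open>W\<close> maps
  \<open>H\<^sup>2\<close> to itself. Conversely, given \<open>y\<close>, these relations yield \<open>f(0)\<close>, \<open>f'(0)\<close> and, by
  solving a Volterra equation in \<open>L\<^sub>2\<close>, a function \<open>f''\<close>; for the resulting \<open>f\<close> the difference
  \<open>d = W f - y\<close> solves \<open>d'' = q d\<close> with zero data at \<open>T\<close>, hence vanishes.
\<close>

section \<open>Absolutely continuous functions of one real variable\<close>

text \<open>As \<open>q\<close> is only square integrable, the kernel need not have second
  derivatives and the wave equation cannot be applied to it pointwise. So differential identities
  are used in twice integrated form: \<open>y'' = h\<close> with data at \<open>T\<close> is read as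
  \<open>y x = a + (T - x) b + LINT s. max 0 (s - x) h(s)\<close>. In this form the facts about the
  wave operator are elementary: its Green function, integrated twice in time and twice in space, is
  a product of two ramps (\<open>integral_cone_ramp\<close>), and Fubini carries this over to the
  kernel. The same reading dictates the test controls: \<open>f(T - s) = f(0) + (T - s) f'(0) + LINT
  r. max 0 (r - s) f''(T - r)\<close>, so responses to a constant, to a linear function and to a
  ramp started at any time suffice. Only the constant starts with a jump; this is the origin of the
  terms with \<open>w(T,T)\<close> and \<open>w\<^sub>t\<close>. The term \<open>q y\<close>
  contains \<open>y\<close> itself, but the supremum of \<open>y\<close> is bounded directly by the
  data of \<open>f\<close>, so \<open>q y\<close> is controlled in the mean square. The Lebesgue
  theory at the start is there because \<open>H2\<close> is defined by absolute continuity and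
  derivatives almost everywhere.\<close>

lemma cball_eq_segment: 
  fixes x y :: real
  shows "cball ((x + y) / 2) (\<bar>y - x\<bar> / 2) = {min x y..max x y}"
  by (auto simp: cball_def dist_real_def min_def max_def abs_if field_simps split: if_splits)

text \<open>Vitali covering against Henstock's lemma. Each bad point is an end point of arbitrarily
  short bad intervals, so these form a Vitali cover. Disjoint bad intervals that are fine for the
  gauge form a tagged partial division in which each contributes at least \<open>e\<close> times its
  length to the Henstock sum; hence their total length is at most \<open>\<eta>\<close>.\<close>

lemma negligible_indefinite_integral_not_differentiable:
  fixes f :: "real \<Rightarrow> 'a::euclidean_space"
  assumes f: "f integrable_on {a..b}" and e: "e > 0"
  defines "F \<equiv> \<lambda>u. integral {a..u} f"
  shows "negligible {x \<in> {a..b}. \<forall>d>0. \<exists>y\<in>{a..b}. 0 < \<bar>y - x\<bar> \<and> \<bar>y - x\<bar> < d \<and>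
           norm (F y - F x - (y - x) *\<^sub>R f x) \<ge> e * \<bar>y - x\<bar>}" (is "negligible ?B")
  unfolding negligible_outer_le
proof (intro allI impI)
  fix \<eta> :: real assume \<eta>: "\<eta> > 0"
  have f': "f integrable_on cbox a b" using f by simp
  \<comment> \<open>The tolerance is \<open>e * \<eta>\<close> because the lower bound for the
    Henstock sum carries a factor \<open>e\<close>, which is divided out at the end.\<close>
  obtain \<gamma> where g: "gauge \<gamma>" and \<gamma>: "\<And>p. \<lbrakk>p tagged_partial_division_of (cbox a b); \<gamma> fine p\<rbrakk> \<Longrightarrow>
             sum (\<lambda>(x,k). norm(measure lborel k *\<^sub>R f x - integral k f)) p < e * \<eta>"
    by (rule Henstock_lemma[OF f' mult_pos_pos[OF e \<eta>]]) (rule that)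
  \<comment> \<open>An index \<open>(x, y)\<close> stands for the interval between the two points,
    with the bad point \<open>x\<close> as its tag. As \<open>y\<close> may lie on either side of
    \<open>x\<close>, the interval is written with \<open>min\<close> and
    \<open>max\<close>.\<close>
  define K where "K = {(x,y). x \<in> {a..b} \<and> y \<in> {a..b} \<and> y \<noteq> x \<and> {min x y..max x y} \<subseteq> \<gamma> x \<and>
           norm (F y - F x - (y - x) *\<^sub>R f x) \<ge> e * \<bar>y - x\<bar>}"
  define I where "I = (\<lambda>(x::real, y). {min x y..max x y})"
  define ce where "ce = (\<lambda>(x::real, y). (x + y) / 2)"
  define ra where "ra = (\<lambda>(x::real, y). \<bar>y - x\<bar> / 2)"
  have cb: "cball (ce i) (ra i) = I i" for i
    by (cases i) (simp add: ce_def ra_def I_def cball_eq_segment)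
  have 1: "0 < ra i" if "i \<in> K" for i using that by (auto simp: K_def ra_def)
  have 2: "\<exists>i. i \<in> K \<and> x \<in> cball (ce i) (ra i) \<and> ra i < d" if x: "x \<in> ?B" and d: "0 < d" for x d
  proof -
    obtain \<rho> where \<rho>: "\<rho> > 0" "ball x \<rho> \<subseteq> \<gamma> x"
      using g unfolding gauge_def by (meson openE)
    obtain y where y: "y\<in>{a..b}" "0 < \<bar>y - x\<bar>" "\<bar>y - x\<bar> < min \<rho> d"
           "norm (F y - F x - (y - x) *\<^sub>R f x) \<ge> e * \<bar>y - x\<bar>"
      using x d \<rho>(1) by (smt (verit) mem_Collect_eq)
    have "{min x y..max x y} \<subseteq> ball x \<rho>" using y by (auto simp: dist_real_def)
    then have "(x,y) \<in> K" using x y \<rho> by (auto simp: K_def)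
    moreover have "x \<in> cball (ce (x,y)) (ra (x,y))" unfolding cb by (auto simp: I_def)
    moreover have "ra (x,y) < d" using y by (auto simp: ra_def)
    ultimately show ?thesis by blast
  qed
  obtain C where C: "countable C" "C \<subseteq> K"
     "pairwise (\<lambda>i j. disjnt (cball (ce i) (ra i)) (cball (ce j) (ra j))) C"
     "negligible(?B - (\<Union>i \<in> C. cball (ce i) (ra i)))"
    using Vitali_covering_theorem_cballs[of K ra ?B ce, OF 1 2] by blast
  have FI: "F y - F x = integral {x..y} f" if "x \<in> {a..b}" "y \<in> {a..b}" "x \<le> y" for x y
  proof -
    have "f integrable_on {a..y}" using f that by (auto intro: integrable_on_subinterval)
    then show ?thesis
      using Henstock_Kurzweil_Integration.integral_combine[of a x y f] that by (simp add: F_def algebra_simps)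
  qed
  have trm: "e * measure lborel (I i) \<le> norm (measure lborel (I i) *\<^sub>R f (fst i) - integral (I i) f)" if "i \<in> K" for i
  proof -
    obtain x y where i: "i = (x,y)" by (cases i)
    have xy: "x \<in> {a..b}" "y \<in> {a..b}" "y \<noteq> x"
           "norm (F y - F x - (y - x) *\<^sub>R f x) \<ge> e * \<bar>y - x\<bar>" using that by (auto simp: K_def i)
    show ?thesis
    proof (cases "x \<le> y")
      case True
      then show ?thesis using xy FI[of x y] by (simp add: i I_def norm_minus_commute)
    next
      case False
      then have "F x - F y = integral {y..x} f" using FI[of y x] xy by simp
      then have "norm (measure lborel (I i) *\<^sub>R f (fst i) - integral (I i) f) = norm (F y - F x - (y - x) *\<^sub>R f x)"
        using False by (simp add: i I_def) (simp add: algebra_simps)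
      then show ?thesis using xy False by (simp add: i I_def)
    qed
  qed
  have fin: "(\<Sum>i\<in>C'. measure lborel (I i)) \<le> \<eta>" if C': "finite C'" "C' \<subseteq> C" for C'
  proof -
    have disj: "I i \<inter> I j = {}" if "i \<in> C'" "j \<in> C'" "i \<noteq> j" for i j
      using C(3) C' that unfolding pairwise_def cb by (auto simp: disjnt_def)
    have ne: "fst i \<in> I i" for i by (cases i) (auto simp: I_def)
    have inj: "inj_on (\<lambda>i. (fst i, I i)) C'"
      using disj ne by (intro inj_onI) (metis disjoint_iff prod.inject)
    let ?p = "(\<lambda>i. (fst i, I i)) ` C'"
    have sub: "I i \<subseteq> {a..b}" "I i \<subseteq> \<gamma> (fst i)" if "i \<in> C'" for i
    proof -
      have "i \<in> K" using that C' C(2) by blast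
      then show "I i \<subseteq> {a..b}" "I i \<subseteq> \<gamma> (fst i)" by (auto simp: K_def I_def)
    qed
    have box: "\<exists>c d. I i = cbox c d" for i by (cases i) (auto simp: I_def)
    have tp: "?p tagged_partial_division_of (cbox a b)"
      unfolding tagged_partial_division_of_def
    proof (intro conjI allI impI)
      show "finite ?p" using C' by simp
      fix x k assume "(x,k) \<in> ?p"
      then obtain i where i: "i \<in> C'" "x = fst i" "k = I i" by auto
      show "x \<in> k" "k \<subseteq> cbox a b" "\<exists>a b. k = cbox a b" using i ne sub[of i] box[of i] by auto
    next
      fix x k x' k' assume *: "(x,k) \<in> ?p \<and> (x',k') \<in> ?p \<and> (x,k) \<noteq> (x',k')"
      then obtain i j where "i \<in> C'" "x = fst i" "k = I i" "j \<in> C'" "x' = fst j" "k' = I j" by auto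
      then have "k \<inter> k' = {}" using * disj by metis
      then show "interior k \<inter> interior k' = {}" using interior_subset by blast
    qed
    have fi: "\<gamma> fine ?p" using sub unfolding fine_def by auto
    have "e * (\<Sum>i\<in>C'. measure lborel (I i)) = (\<Sum>i\<in>C'. e * measure lborel (I i))" by (simp add: sum_distrib_left)
    also have "\<dots> \<le> (\<Sum>i\<in>C'. norm (measure lborel (I i) *\<^sub>R f (fst i) - integral (I i) f))"
      using C' C(2) by (intro sum_mono trm) auto
    also have "\<dots> = sum (\<lambda>(x,k). norm(measure lborel k *\<^sub>R f x - integral k f)) ?p"
      by (subst sum.reindex[OF inj]) (simp add: o_def)
    also have "\<dots> < e * \<eta>" by (rule \<gamma>[OF tp fi])
    finally show ?thesis using e by simp
  qed
  have meas: "measure lebesgue (\<Union>i\<in>C'. I i) \<le> \<eta>" if C': "finite C'" "C' \<subseteq> C" for C'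
  proof -
    have "measure lebesgue (\<Union>i\<in>C'. I i) \<le> (\<Sum>i\<in>C'. measure lebesgue (I i))"
      using C' by (intro measure_UNION_le) (auto simp: I_def)
    also have "\<dots> = (\<Sum>i\<in>C'. measure lborel (I i))" by (intro sum.cong) (auto simp: I_def)
    finally show ?thesis using fin[OF C'] by simp
  qed
  have lm: "I i \<in> lmeasurable" for i by (cases i) (auto simp: I_def)
  have U: "(\<Union>i\<in>C. I i) \<in> lmeasurable" "measure lebesgue (\<Union>i\<in>C. I i) \<le> \<eta>"
    using fmeasurable_UN_bound[of C I lebesgue \<eta>] measure_UN_bound[of C I lebesgue \<eta>] C(1) lm meas \<eta>
    by (metis less_imp_le)+
  have N: "?B - (\<Union>i\<in>C. I i) \<in> null_sets lebesgue" using C(4) unfolding cb by (simp add: negligible_iff_null_sets)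
  show "\<exists>S. ?B \<subseteq> S \<and> S \<in> lmeasurable \<and> measure lebesgue S \<le> \<eta>"
  proof (intro exI conjI)
    show "?B \<subseteq> (\<Union>i\<in>C. I i) \<union> (?B - (\<Union>i\<in>C. I i))" by blast
    show "(\<Union>i\<in>C. I i) \<union> (?B - (\<Union>i\<in>C. I i)) \<in> lmeasurable"
      using fmeasurable.Un[OF U(1) negligible_imp_measurable] C(4) unfolding cb by blast
    show "measure lebesgue ((\<Union>i\<in>C. I i) \<union> (?B - (\<Union>i\<in>C. I i))) \<le> \<eta>"
      by (simp only: measure_Un_null_set[OF fmeasurableD[OF U(1)] N] U(2))
  qed
qed

text \<open>Lebesgue's differentiation theorem on an interval: the exceptional set is the union of
  the bad sets with tolerances \<open>inverse (real (Suc n))\<close>.\<close>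

lemma indefinite_integral_has_vector_derivative_ae:
  fixes f :: "real \<Rightarrow> 'a::euclidean_space"
  assumes f: "f integrable_on {a..b}"
  obtains N where "negligible N"
    "\<And>x. x \<in> {a..b} - N \<Longrightarrow> ((\<lambda>u. integral {a..u} f) has_vector_derivative f x) (at x within {a..b})"
proof -
  define F where "F = (\<lambda>u. integral {a..u} f)"
  define B where "B e = {x \<in> {a..b}. \<forall>d>0. \<exists>y\<in>{a..b}. 0 < \<bar>y - x\<bar> \<and> \<bar>y - x\<bar> < d \<and>
           norm (F y - F x - (y - x) *\<^sub>R f x) \<ge> e * \<bar>y - x\<bar>}" for e
  have nB: "negligible (B e)" if "e > 0" for e
    unfolding B_def F_def by (rule negligible_indefinite_integral_not_differentiable[OF f that])
  show ?thesis
  proof (rule that)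
    show "negligible (\<Union>n. B (inverse (real (Suc n))))"
      using nB by (intro negligible_countable_Union) auto
    fix x assume x: "x \<in> {a..b} - (\<Union>n. B (inverse (real (Suc n))))"
    show "((\<lambda>u. integral {a..u} f) has_vector_derivative f x) (at x within {a..b})"
      unfolding F_def[symmetric] has_vector_derivative_def has_derivative_within_alt
    proof (intro conjI allI impI)
      show "bounded_linear (\<lambda>y. y *\<^sub>R f x)" by (rule bounded_linear_scaleR_left)
      fix e :: real assume "e > 0"
      then obtain n where n: "inverse (real (Suc n)) < e" using reals_Archimedean by blast
      from x have "x \<notin> B (inverse (real (Suc n)))" by blast
      then obtain d where d: "d > 0" "\<And>y. y \<in> {a..b} \<Longrightarrow> 0 < \<bar>y - x\<bar> \<Longrightarrow> \<bar>y - x\<bar> < d \<Longrightarrow>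
           norm (F y - F x - (y - x) *\<^sub>R f x) < inverse (real (Suc n)) * \<bar>y - x\<bar>"
        using x unfolding B_def by (auto simp: not_le simp del: atLeastAtMost_iff) (metis zero_less_abs_iff right_minus_eq)
      have "norm (F y - F x - (y - x) *\<^sub>R f x) \<le> e * norm (y - x)"
        if "y \<in> {a..b}" "norm (y - x) < d" for y
      proof (cases "y = x")
        case False
        then have "norm (F y - F x - (y - x) *\<^sub>R f x) < inverse (real (Suc n)) * \<bar>y - x\<bar>"
          using d that by auto
        also have "\<dots> \<le> e * \<bar>y - x\<bar>" using n by (intro mult_right_mono) auto
        finally show ?thesis by simp
      qed simp
      then show "\<exists>d>0. \<forall>y\<in>{a..b}. norm (y - x) < d \<longrightarrow> norm (F y - F x - (y - x) *\<^sub>R f x) \<le> e * norm (y - x)"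
        using d(1) by blast
    qed
  qed
qed

lemma division_of_sum_Sup_Inf:
  fixes D :: "real set set"
  assumes "D division_of S"
  shows "(\<Sum>K\<in>D. Sup K - Inf K) = measure lebesgue S"
proof -
  have "(\<Sum>K\<in>D. Sup K - Inf K) = (\<Sum>K\<in>D. measure lebesgue K)"
  proof (intro sum.cong refl)
    fix K assume "K \<in> D"
    then obtain u v where "K = cbox u v" "K \<noteq> {}" using division_ofD(3,4)[OF assms] by blast
    then show "Sup K - Inf K = measure lebesgue K" by (auto simp: not_less)
  qed
  also have "\<dots> = measure lebesgue S" using content_division[OF assms] by simp
  finally show ?thesis .
qed

text \<open>The Riemann sums split by the position of the tag. Off \<open>N\<close> the error is
  controlled by differentiability. In \<open>N\<close> the gauge confines the intervals to an open
  set of measure below \<open>\<delta>\<close>, and absolute continuity makes the total increment of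
  \<open>F\<close> over them small.\<close>

lemma abs_continuous_has_integral_vector_derivative:
  fixes F :: "real \<Rightarrow> 'a::euclidean_space"
  assumes ab: "a \<le> b" and ac: "abs_continuous_on {a..b} F" and N: "negligible N"
    and der: "\<And>x. x \<in> {a..b} - N \<Longrightarrow> (F has_vector_derivative f x) (at x within {a..b})"
  shows "(f has_integral F b - F a) {a..b}"
proof -
  \<comment> \<open>With the value 0 on \<open>N\<close>, tags in \<open>N\<close> contribute only
    increments of \<open>F\<close>; changing the integrand on a null set is undone at the
    end.\<close>
  define f' where "f' x = (if x \<in> N then 0 else f x)" for x
  have "(f' has_integral F b - F a) (cbox a b)"
    unfolding has_integral
  proof (intro allI impI)
    fix e :: real assume e: "e > 0"
    obtain \<delta> where \<delta>: "\<delta> > 0" "\<And>D. D division_of \<Union>D \<Longrightarrow> \<Union>D \<subseteq> {a..b} \<Longrightarrow> (\<Sum>K\<in>D. Sup K - Inf K) < \<delta> \<Longrightarrow>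
        (\<Sum>K\<in>D. norm (F (Sup K) - F (Inf K))) < e/2"
      using ac e unfolding abs_continuous_on_def by (meson half_gt_zero)
    obtain U where U: "open U" "N \<subseteq> U" "U \<in> lmeasurable" "measure lebesgue U < \<delta>"
    proof -
      have N': "N \<in> sets lebesgue" using N by (simp add: negligible_iff_null_sets null_setsD2)
      then obtain U where U: "open U" "N \<subseteq> U" "U - N \<in> lmeasurable" "emeasure lebesgue (U - N) < ennreal \<delta>"
        using sets_lebesgue_outer_open[OF _ \<delta>(1)] by blast
      have UN: "U = (U - N) \<union> N" using U(2) by blast
      have N0: "N \<in> null_sets lebesgue" using N by (simp add: negligible_iff_null_sets)
      have "measure lebesgue U = measure lebesgue (U - N)"
        by (subst UN, subst measure_Un_null_set) (use U N0 in \<open>auto simp: fmeasurableD\<close>)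
      moreover have "U \<in> lmeasurable"
        using fmeasurable.Un[OF U(3) negligible_imp_measurable[OF N]] UN by simp
      moreover have "measure lebesgue (U - N) < \<delta>"
        using U(3,4) \<delta>(1) by (simp add: emeasure_eq_measure2 ennreal_less_iff)
      ultimately show ?thesis using that U by simp
    qed
    \<comment> \<open>Chosen so that \<open>e1 * (b - a)\<close> is at most \<open>e / 2\<close>;
      the summand 1 keeps \<open>e1\<close> positive also for \<open>a = b\<close>.\<close>
    define e1 where "e1 = e / (2 * (b - a + 1))"
    have e1: "e1 > 0" using e ab by (simp add: e1_def)
    have "\<exists>\<rho>>0. if x \<in> N then ball x \<rho> \<subseteq> U
       else x \<in> {a..b} \<longrightarrow> (\<forall>y\<in>{a..b}. \<bar>y - x\<bar> < \<rho> \<longrightarrow> norm (F y - F x - (y - x) *\<^sub>R f x) \<le> e1 * \<bar>y - x\<bar>)" for x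
    proof (cases "x \<in> N")
      case True
      then show ?thesis using U openE by (metis subsetD)
    next
      case False
      show ?thesis
      proof (cases "x \<in> {a..b}")
        case True
        with False der have "(F has_vector_derivative f x) (at x within {a..b})" by blast
        then show ?thesis using e1 False
          unfolding has_vector_derivative_def has_derivative_within_alt by (auto simp del: atLeastAtMost_iff)
      next
        case F2: False
        then show ?thesis using False zero_less_one by metis
      qed
    qed
    then obtain \<rho> where \<rho>: "\<And>x. \<rho> x > 0" "\<And>x. x \<in> N \<Longrightarrow> ball x (\<rho> x) \<subseteq> U"
       "\<And>x y. x \<notin> N \<Longrightarrow> x \<in> {a..b} \<Longrightarrow> y \<in> {a..b} \<Longrightarrow> \<bar>y - x\<bar> < \<rho> x \<Longrightarrow> norm (F y - F x - (y - x) *\<^sub>R f x) \<le> e1 * \<bar>y - x\<bar>"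
      by metis
    define \<gamma> where "\<gamma> x = ball x (\<rho> x)" for x
    show "\<exists>\<gamma>. gauge \<gamma> \<and> (\<forall>\<D>. \<D> tagged_division_of cbox a b \<and> \<gamma> fine \<D> \<longrightarrow>
             norm ((\<Sum>(x, k)\<in>\<D>. measure lborel k *\<^sub>R f' x) - (F b - F a)) < e)"
    proof (intro exI conjI allI impI)
      show "gauge \<gamma>" using \<rho>(1) unfolding \<gamma>_def gauge_def by auto
      fix p assume "p tagged_division_of cbox a b \<and> \<gamma> fine p"
      then have p: "p tagged_division_of {a..b}" and fi: "\<gamma> fine p" by auto
      have finp: "finite p" using p by blast
      define p1 where "p1 = {(x,K) \<in> p. x \<notin> N}"
      define p2 where "p2 = {(x,K) \<in> p. x \<in> N}"
      have pp: "p = p1 \<union> p2" "p1 \<inter> p2 = {}" "finite p1" "finite p2" "p1 \<subseteq> p" "p2 \<subseteq> p"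
        using finp by (auto simp: p1_def p2_def intro: finite_subset[OF _ finp])
      have K: "\<exists>u v. K = {u..v} \<and> u \<le> v \<and> x \<in> {u..v} \<and> a \<le> u \<and> v \<le> b \<and> {u..v} \<subseteq> ball x (\<rho> x)" if "(x,K) \<in> p" for x K
      proof -
        obtain u v where "K = cbox u v" "x \<in> K" "K \<subseteq> {a..b}" using tagged_division_ofD(2,3,4)[OF p \<open>(x,K) \<in> p\<close>] by blast
        moreover have "K \<subseteq> ball x (\<rho> x)" using fi that by (auto simp: fine_def \<gamma>_def)
        ultimately show ?thesis by (intro exI[of _ u] exI[of _ v]) auto
      qed
      let ?G = "\<lambda>K. F (Sup K) - F (Inf K)"
      have "(\<Sum>(x,K)\<in>p. ?G K) = F b - F a"
        using additive_tagged_division_1[OF ab p] .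
      then have "norm ((\<Sum>(x, k)\<in>p. measure lborel k *\<^sub>R f' x) - (F b - F a)) = norm (\<Sum>(x,K)\<in>p. measure lborel K *\<^sub>R f' x - ?G K)"
        by (simp add: sum_subtractf split_def)
      also have "\<dots> \<le> (\<Sum>(x,K)\<in>p. norm (measure lborel K *\<^sub>R f' x - ?G K))"
        by (metis (mono_tags, lifting) norm_sum split_def sum.cong)
      also have "\<dots> = (\<Sum>(x,K)\<in>p1. norm (measure lborel K *\<^sub>R f' x - ?G K)) + (\<Sum>(x,K)\<in>p2. norm (measure lborel K *\<^sub>R f' x - ?G K))"
        unfolding pp(1) by (rule sum.union_disjoint) (use pp in auto)
      finally have main: "norm ((\<Sum>(x, k)\<in>p. measure lborel k *\<^sub>R f' x) - (F b - F a)) \<le>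
        (\<Sum>(x,K)\<in>p1. norm (measure lborel K *\<^sub>R f' x - ?G K)) + (\<Sum>(x,K)\<in>p2. norm (measure lborel K *\<^sub>R f' x - ?G K))" .
      have "(\<Sum>(x,K)\<in>p1. norm (measure lborel K *\<^sub>R f' x - ?G K)) \<le> (\<Sum>(x,K)\<in>p1. e1 * measure lborel K)"
      proof (intro sum_mono, clarify)
        fix x K assume xK: "(x,K) \<in> p1"
        then have "(x,K) \<in> p" "x \<notin> N" by (auto simp: p1_def)
        then obtain u v where uv: "K = {u..v}" "u \<le> v" "x \<in> {u..v}" "a \<le> u" "v \<le> b" "{u..v} \<subseteq> ball x (\<rho> x)"
          using K by blast
        have "u \<in> {u..v}" "v \<in> {u..v}" using uv by auto
        then have "u \<in> ball x (\<rho> x)" "v \<in> ball x (\<rho> x)" using uv(6) by blast+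
        then have d: "\<bar>u - x\<bar> < \<rho> x" "\<bar>v - x\<bar> < \<rho> x"
          by (auto simp: dist_real_def abs_minus_commute)
        \<comment> \<open>Straddling: the increment over \<open>[u, v]\<close> is split at the tag
          \<open>x\<close>, and differentiability at \<open>x\<close> is applied to either
          half.\<close>
        have "measure lborel K *\<^sub>R f' x - ?G K = (F u - F x - (u - x) *\<^sub>R f x) - (F v - F x - (v - x) *\<^sub>R f x)"
          using uv \<open>x \<notin> N\<close> by (simp add: f'_def algebra_simps)
        also have "norm \<dots> \<le> e1 * \<bar>u - x\<bar> + e1 * \<bar>v - x\<bar>"
          by (rule order_trans[OF norm_triangle_ineq4], rule add_mono)
             (use \<rho>(3)[OF \<open>x \<notin> N\<close> _ _ d(1)] \<rho>(3)[OF \<open>x \<notin> N\<close> _ _ d(2)] uv in \<open>simp_all del: abs_diff_le_iff\<close>)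
        also have "\<dots> = e1 * measure lborel K" using uv by (simp add: algebra_simps)
        finally show "norm (measure lborel K *\<^sub>R f' x - ?G K) \<le> e1 * measure lborel K" .
      qed
      also have "\<dots> \<le> (\<Sum>(x,K)\<in>p. e1 * measure lborel K)"
        using finp pp e1 by (intro sum_mono2) auto
      also have "\<dots> = e1 * (b - a)"
        using additive_content_tagged_division[of p a b] p ab
        by (simp add: split_def sum_distrib_left[symmetric])
      also have "\<dots> \<le> e / 2" using ab e by (simp add: e1_def field_simps)
      finally have A: "(\<Sum>(x,K)\<in>p1. norm (measure lborel K *\<^sub>R f' x - ?G K)) \<le> e / 2" .
      have "(\<Sum>(x,K)\<in>p2. norm (measure lborel K *\<^sub>R f' x - ?G K)) = (\<Sum>(x,K)\<in>p2. norm (?G K))"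
        by (intro sum.cong refl) (auto simp: p2_def f'_def norm_minus_commute)
      also have "\<dots> < e / 2"
      proof -
        have "p2 tagged_partial_division_of {a..b}"
          using p pp(6) tagged_partial_division_subset tagged_division_of_def by blast
        then have td: "p2 tagged_division_of \<Union>(snd ` p2)" by (rule tagged_partial_division_of_Union_self)
        then have dv: "(snd ` p2) division_of \<Union>(snd ` p2)" by (rule division_of_tagged_division)
        have eq: "(\<Sum>(x,K)\<in>p2. norm (?G K)) = (\<Sum>K\<in>snd ` p2. norm (?G K))"
        proof -
          \<comment> \<open>Several tags may share one degenerate interval, so the passage from
            tagged pairs to intervals requires a summand that vanishes on degenerate intervals. The
            case distinction settles the empty one, where \<open>Sup\<close> and \<open>Inf\<close>
            have unspecified values.\<close>
          let ?d = "\<lambda>K. if K = {} then 0 else norm (?G K)"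
          have ne: "K \<noteq> {}" if "(x,K) \<in> p2" for x K using that pp(6) K by fastforce
          have "(\<Sum>(x,K)\<in>p2. norm (?G K)) = (\<Sum>(x,K)\<in>p2. ?d K)"
            using ne by (intro sum.cong refl) auto
          also have "\<dots> = (\<Sum>K\<in>snd ` p2. ?d K)"
            by (rule sum.over_tagged_division_lemma[OF td]) auto
          also have "\<dots> = (\<Sum>K\<in>snd ` p2. norm (?G K))"
            using ne by (intro sum.cong refl) auto
          finally show ?thesis .
        qed
        have sub: "\<Union>(snd ` p2) \<subseteq> U" "\<Union>(snd ` p2) \<subseteq> {a..b}"
        proof -
          have "K \<subseteq> U \<and> K \<subseteq> {a..b}" if "(x,K) \<in> p2" for x K
          proof -
            have "(x,K) \<in> p" "x \<in> N" using that by (auto simp: p2_def)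
            then show ?thesis using K[of x K] \<rho>(2)[of x] by auto
          qed
          then show "\<Union>(snd ` p2) \<subseteq> U" "\<Union>(snd ` p2) \<subseteq> {a..b}" by fastforce+
        qed
        have "(\<Sum>K\<in>snd ` p2. Sup K - Inf K) = measure lebesgue (\<Union>(snd ` p2))"
          by (rule division_of_sum_Sup_Inf[OF dv])
        also have "\<dots> \<le> measure lebesgue U" using sub U dv
          by (intro measure_mono_fmeasurable) (auto simp: lmeasurable_division fmeasurableD)
        also have "\<dots> < \<delta>" by (rule U)
        finally show ?thesis unfolding eq using \<delta>(2)[OF dv sub(2)] by simp
      qed
      finally show "norm ((\<Sum>(x, k)\<in>p. measure lborel k *\<^sub>R f' x) - (F b - F a)) < e" using main A by simp
    qed
  qed
  then have "(f' has_integral F b - F a) {a..b}" by simp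
  then show ?thesis
    by (rule has_integral_spike[OF N, rotated]) (auto simp: f'_def)
qed

text \<open>Young's inequality \<open>h \<le> \<eta> / 2 * h^2 + 1 / (2 * \<eta>)\<close> bounds the
  increments over any finite family of intervals by \<open>\<eta> / 2\<close> times the integral of
  \<open>h^2\<close> plus the total length divided by \<open>2 * \<eta>\<close>.\<close>

lemma abs_continuous_on_L2_primitive:
  fixes F :: "real \<Rightarrow> 'a::euclidean_space" and h :: "real \<Rightarrow> real"
  assumes h2: "(\<lambda>x. (h x)\<^sup>2) integrable_on {a..b}" and h1: "h integrable_on {a..b}"
    and F: "\<And>u v. a \<le> u \<Longrightarrow> u \<le> v \<Longrightarrow> v \<le> b \<Longrightarrow> norm (F v - F u) \<le> integral {u..v} h"
  shows "abs_continuous_on {a..b} F"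
  unfolding abs_continuous_on_def
proof (intro allI impI)
  fix e :: real assume e: "e > 0"
  define I where "I = integral {a..b} (\<lambda>x. (h x)\<^sup>2)"
  have I0: "I \<ge> 0" unfolding I_def by (intro integral_nonneg h2) auto
  \<comment> \<open>With this \<open>\<eta>\<close> the quadratic part is at most
    \<open>e / 2\<close>; total length below \<open>\<eta> * e\<close> makes the other part smaller
    than \<open>e / 2\<close>.\<close>
  define \<eta> where "\<eta> = e / (I + 1)"
  have \<eta>: "\<eta> > 0" using e I0 by (simp add: \<eta>_def)
  have amgm: "h x \<le> \<eta> / 2 * (h x)\<^sup>2 + 1 / (2 * \<eta>)" for x
  proof -
    have "0 \<le> (\<eta> * h x - 1)\<^sup>2 / (2 * \<eta>)" using \<eta> by simp
    also have "\<dots> = \<eta> / 2 * (h x)\<^sup>2 + 1 / (2 * \<eta>) - h x"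
      using \<eta> by (simp add: power2_eq_square field_simps)
    finally show ?thesis by simp
  qed
  have int: "integral {u..v} h \<le> \<eta> / 2 * integral {u..v} (\<lambda>x. (h x)\<^sup>2) + (v - u) / (2 * \<eta>)"
    if "a \<le> u" "u \<le> v" "v \<le> b" for u v
  proof -
    have i: "h integrable_on {u..v}" "(\<lambda>x. (h x)\<^sup>2) integrable_on {u..v}"
      using h1 h2 that by (auto intro: integrable_on_subinterval)
    have "integral {u..v} h \<le> integral {u..v} (\<lambda>x. \<eta> / 2 * (h x)\<^sup>2 + 1 / (2 * \<eta>))"
      using i amgm by (intro integral_le integrable_add integrable_on_mult_right) auto
    also have "\<dots> = integral {u..v} (\<lambda>x. \<eta> / 2 * (h x)\<^sup>2) + integral {u..v} (\<lambda>x. 1 / (2 * \<eta>))"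
      using i by (intro Henstock_Kurzweil_Integration.integral_add integrable_on_mult_right) auto
    finally show ?thesis using that by simp
  qed
  show "\<exists>\<delta>>0. \<forall>D. D division_of \<Union>D \<and> \<Union>D \<subseteq> {a..b} \<and> (\<Sum>K\<in>D. Sup K - Inf K) < \<delta> \<longrightarrow>
        (\<Sum>K\<in>D. norm (F (Sup K) - F (Inf K))) < e"
  proof (intro exI[of _ "\<eta> * e"] conjI allI impI)
    show "0 < \<eta> * e" using \<eta> e by simp
    fix D assume D: "D division_of \<Union>D \<and> \<Union>D \<subseteq> {a..b} \<and> (\<Sum>K\<in>D. Sup K - Inf K) < \<eta> * e"
    have K: "\<exists>u v. K = {u..v} \<and> a \<le> u \<and> u \<le> v \<and> v \<le> b" if "K \<in> D" for K
    proof -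
      obtain u v where "K = cbox u v" "K \<noteq> {}" using division_ofD(3,4)[of D "\<Union>D"] D \<open>K \<in> D\<close> by blast
      moreover have "K \<subseteq> {a..b}" using D that by blast
      ultimately show ?thesis by (intro exI[of _ u] exI[of _ v]) auto
    qed
    have "(\<Sum>K\<in>D. integral K (\<lambda>x. (h x)\<^sup>2)) = integral (\<Union>D) (\<lambda>x. (h x)\<^sup>2)"
    proof (intro integral_combine_division_bottomup[symmetric])
      show "D division_of \<Union>D" using D by blast
      fix k assume "k \<in> D"
      then obtain u v where "k = {u..v}" "a \<le> u" "v \<le> b" using K by blast
      then show "(\<lambda>x. (h x)\<^sup>2) integrable_on k" by (auto intro: integrable_on_subinterval[OF h2])
    qed
    also have "\<dots> \<le> I"
    proof -
      have "(\<lambda>x. (h x)\<^sup>2) integrable_on \<Union>D"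
        using D h2 integrable_on_subdivision by blast
      then show ?thesis
        unfolding I_def using D h2 by (intro integral_subset_le) auto
    qed
    finally have SI: "(\<Sum>K\<in>D. integral K (\<lambda>x. (h x)\<^sup>2)) \<le> I" .
    have "(\<Sum>K\<in>D. norm (F (Sup K) - F (Inf K))) \<le> (\<Sum>K\<in>D. \<eta> / 2 * integral K (\<lambda>x. (h x)\<^sup>2) + (Sup K - Inf K) / (2 * \<eta>))"
    proof (intro sum_mono)
      fix K assume "K \<in> D"
      then obtain u v where "K = {u..v}" "a \<le> u" "u \<le> v" "v \<le> b" using K by blast
      then show "norm (F (Sup K) - F (Inf K)) \<le> \<eta> / 2 * integral K (\<lambda>x. (h x)\<^sup>2) + (Sup K - Inf K) / (2 * \<eta>)"
        using F[of u v] int[of u v] by simp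
    qed
    also have "\<dots> = \<eta> / 2 * (\<Sum>K\<in>D. integral K (\<lambda>x. (h x)\<^sup>2)) + (\<Sum>K\<in>D. Sup K - Inf K) / (2 * \<eta>)"
      by (simp add: sum.distrib sum_distrib_left sum_divide_distrib)
    also have "\<dots> \<le> \<eta> / 2 * I + (\<Sum>K\<in>D. Sup K - Inf K) / (2 * \<eta>)"
      using SI \<eta> by (intro add_right_mono mult_left_mono) auto
    also have "\<dots> < \<eta> / 2 * I + (\<eta> * e) / (2 * \<eta>)"
      using D \<eta> by (intro add_strict_left_mono divide_strict_right_mono) auto
    also have "\<dots> \<le> e / 2 + e / 2"
    proof (intro add_mono)
      have "e * I \<le> e * (I + 1)" using e by simp
      then show "\<eta> / 2 * I \<le> e / 2" using I0 by (simp add: \<eta>_def field_simps)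
    qed (use \<eta> in simp)
    finally show "(\<Sum>K\<in>D. norm (F (Sup K) - F (Inf K))) < e" by simp
  qed
qed

section \<open>Gronwall's inequality and square integrable functions\<close>

lemma integrable_norm_le:
  fixes f :: "'a \<Rightarrow> 'b::{banach, second_countable_topology}" and g :: "'a \<Rightarrow> real"
  assumes g: "integrable M g" and f: "f \<in> borel_measurable M" and le: "\<And>x. norm (f x) \<le> g x"
  shows "integrable M f"
proof (rule Bochner_Integration.integrable_bound[OF g f])
  have "norm (f x) \<le> \<bar>g x\<bar>" for x by (rule order_trans[OF le abs_ge_self])
  then show "AE x in M. norm (f x) \<le> norm (g x)" by simp
qed

lemma integrable_le_nonneg:
  fixes f g :: "'a \<Rightarrow> real"
  assumes g: "integrable M g" and f: "f \<in> borel_measurable M" and "\<And>x. 0 \<le> f x" "\<And>x. f x \<le> g x"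
  shows "integrable M f"
  by (rule integrable_norm_le[OF g f]) (simp add: assms)

lemma has_bochner_integral_exp_weight:
  fixes c x :: real
  assumes "c > 0"
  shows "has_bochner_integral lborel (\<lambda>s. indicator {x..} s * exp (- c * (s - x))) (1 / c)"
proof (rule has_bochner_integral_nn_integral)
  have "((\<lambda>s. exp (- c * s)) has_integral exp (- c * x) / c) {x..}"
    by (rule has_integral_exp_minus_to_infinity[OF assms])
  then have "((\<lambda>s. exp (c * x) * exp (- c * s)) has_integral exp (c * x) * (exp (- c * x) / c)) {x..}"
    by (rule has_integral_mult_right)
  then have "((\<lambda>s. exp (- c * (s - x))) has_integral 1 / c) {x..}"
    by (simp add: exp_add[symmetric] algebra_simps)
  then have "((\<lambda>s. indicator {x..} s * exp (- c * (s - x))) has_integral 1 / c) UNIV"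
  proof (subst (asm) has_integral_restrict_UNIV[symmetric])
    have "(\<lambda>s. if s \<in> {x..} then exp (- c * (s - x)) else 0) = (\<lambda>s. indicator {x..} s * exp (- c * (s - x)))"
      by (auto simp: indicator_def)
    then show "((\<lambda>s. if s \<in> {x..} then exp (- c * (s - x)) else 0) has_integral 1 / c) UNIV \<Longrightarrow> ?thesis"
      by simp
  qed
  then show "(\<integral>\<^sup>+ s. ennreal (indicator {x..} s * exp (- c * (s - x))) \<partial>lborel) = ennreal (1 / c)"
    by (intro nn_integral_has_integral_lborel) auto
qed (use assms in auto)

text \<open>The source of the weight: Young's inequality splits the integrand into a small multiple of
  \<open>(k s)\<^sup>2\<close> and an exponential whose integral tends to \<open>0\<close> for large \<open>L\<close>.\<close>

lemma exp_weight_kernel_le_half: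
  fixes k :: "real \<Rightarrow> real"
  assumes [measurable]: "k \<in> borel_measurable borel" and k2: "integrable lborel (\<lambda>s. (k s)\<^sup>2)" and k0: "\<And>s. 0 \<le> k s"
  obtains L where "L > 0"
    "\<And>x. integrable lborel (\<lambda>s. indicator {x..} s * (k s * exp (- L * (s - x))))"
    "\<And>x. (LINT s|lborel. indicator {x..} s * (k s * exp (- L * (s - x)))) \<le> 1 / 2"
proof -
  define I where "I = (LINT s|lborel. (k s)\<^sup>2)"
  have I0: "I \<ge> 0" by (simp add: I_def)
  \<comment> \<open>The values of \<open>\<eta>\<close> and \<open>L\<close> make each half of
    Young's bound at most 1/4: \<open>\<eta> / 2 * I\<close> on one side, \<open>L / 2\<close> times
    the integral \<open>1 / (2 * L)\<close> of the squared weight on the other.\<close>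
  define \<eta> where "\<eta> = 1 / (2 * (I + 1))"
  have \<eta>: "\<eta> > 0" using I0 by (simp add: \<eta>_def)
  define L where "L = 1 / \<eta>"
  have L: "L > 0" using \<eta> by (simp add: L_def)
  define g where "g x s = \<eta> / 2 * (k s)\<^sup>2 + L / 2 * (indicator {x..} s * exp (- (2 * L) * (s - x)))" for x s
  have hb: "has_bochner_integral lborel (g x) (\<eta> / 2 * I + L / 2 * (1 / (2 * L)))" for x
    unfolding g_def I_def using k2 L
    by (intro has_bochner_integral_add has_bochner_integral_mult_right has_bochner_integral_integrable
        has_bochner_integral_exp_weight) auto
  have gi: "integrable lborel (g x)" for x using hb has_bochner_integral_iff by blast
  have le: "indicator {x..} s * (k s * exp (- L * (s - x))) \<le> g x s" for x s
  proof (cases "s \<in> {x..}")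
    case True
    define z where "z = exp (- L * (s - x))"
    have z: "exp (- (2 * L) * (s - x)) = z\<^sup>2"
      by (simp add: z_def power2_eq_square exp_add[symmetric] algebra_simps)
    have "0 \<le> (\<eta> * k s - z)\<^sup>2 / (2 * \<eta>)" using \<eta> by simp
    also have "\<dots> = \<eta> / 2 * (k s)\<^sup>2 + L / 2 * z\<^sup>2 - k s * z"
      using \<eta> by (simp add: power2_eq_square field_simps L_def)
    finally show ?thesis using True z by (simp add: g_def z_def)
  qed (use \<eta> L in \<open>simp add: g_def\<close>)
  have g0: "0 \<le> g x s" for x s using \<eta> L by (simp add: g_def)
  show thesis
  proof (rule that[OF L])
    fix x
    show i: "integrable lborel (\<lambda>s. indicator {x..} s * (k s * exp (- L * (s - x))))"
      by (rule integrable_le_nonneg[OF gi[of x] _ _ le]) (use k0 in auto)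
    have "(LINT s|lborel. indicator {x..} s * (k s * exp (- L * (s - x)))) \<le> (LINT s|lborel. g x s)"
      by (intro integral_mono i gi le)
    also have "\<dots> = \<eta> / 2 * I + L / 2 * (1 / (2 * L))"
      using hb by (rule has_bochner_integral_integral_eq)
    also have "\<dots> \<le> 1 / 2"
    proof -
      have "\<eta> / 2 * I \<le> 1 / 4" using I0 by (simp add: \<eta>_def field_simps)
      moreover have "L / 2 * (1 / (2 * L)) = 1 / 4" using L by simp
      ultimately show ?thesis by linarith
    qed
    finally show "(LINT s|lborel. indicator {x..} s * (k s * exp (- L * (s - x)))) \<le> 1 / 2" .
  qed
qed

lemma gronwall_backward:
  fixes k :: "real \<Rightarrow> real"
  assumes k: "k \<in> borel_measurable borel" "integrable lborel (\<lambda>s. (k s)\<^sup>2)" "\<And>s. 0 \<le> k s"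
    and k_out: "\<And>s. s \<notin> {0..T} \<Longrightarrow> k s = 0"
  shows "\<exists>C\<ge>0. \<forall>\<phi> M A. (\<forall>x\<in>{0..T}. 0 \<le> \<phi> x \<and> \<phi> x \<le> M) \<longrightarrow> A \<ge> 0 \<longrightarrow>
      (\<forall>x\<in>{0..T}. \<phi> x \<le> A + (LINT s|lborel. indicator {x..} s * (k s * \<phi> s))) \<longrightarrow>
      (\<forall>x\<in>{0..T}. \<phi> x \<le> C * A)"
proof -
  obtain L where L: "L > 0"
    "\<And>x. integrable lborel (\<lambda>s. indicator {x..} s * (k s * exp (- L * (s - x))))"
    "\<And>x. (LINT s|lborel. indicator {x..} s * (k s * exp (- L * (s - x)))) \<le> 1 / 2"
    using exp_weight_kernel_le_half[OF k] by blast
  show ?thesis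
  proof (rule exI[of _ "2 * exp (L * T)"], intro conjI allI impI ballI)
    fix \<phi> :: "real \<Rightarrow> real" and M A x :: real
    assume \<phi>': "\<forall>x\<in>{0..T}. 0 \<le> \<phi> x \<and> \<phi> x \<le> M" and A: "A \<ge> 0"
      and le': "\<forall>x\<in>{0..T}. \<phi> x \<le> A + (LINT s|lborel. indicator {x..} s * (k s * \<phi> s))"
      and x: "x \<in> {0..T}"
    note \<phi> = \<phi>'[rule_format] and le = le'[rule_format]
    define \<psi> where "\<psi> x = exp (- L * (T - x)) * \<phi> x" for x
    \<comment> \<open>The bound \<open>M\<close> makes this supremum finite, without which
      \<open>S \<le> A + S / 2\<close> could not be solved for \<open>S\<close>.\<close>
    define S where "S = (SUP x\<in>{0..T}. \<psi> x)"
    have "\<psi> x \<le> M" if "x \<in> {0..T}" for x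
    proof -
      have "\<psi> x \<le> 1 * \<phi> x" unfolding \<psi>_def using that \<phi> L by (intro mult_right_mono) auto
      then show ?thesis using \<phi>[OF that] by simp
    qed
    then have bdd: "bdd_above (\<psi> ` {0..T})" by (intro bdd_aboveI[of _ M]) auto
    have \<psi>S: "\<psi> x \<le> S" if "x \<in> {0..T}" for x
      unfolding S_def using that bdd by (intro cSUP_upper)
    have S0: "0 \<le> S" using \<psi>S[OF x] \<phi>[OF x] by (simp add: \<psi>_def order_trans[rotated])
    have "\<psi> x \<le> A + S / 2" if x: "x \<in> {0..T}" for x
    proof -
      have "(LINT s|lborel. indicator {x..} s * (k s * \<phi> s)) \<le>
          (LINT s|lborel. S * exp (L * (T - x)) * (indicator {x..} s * (k s * exp (- L * (s - x)))))"
      proof (rule integral_mono')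
        fix s
        show "indicator {x..} s * (k s * \<phi> s) \<le> S * exp (L * (T - x)) * (indicator {x..} s * (k s * exp (- L * (s - x))))"
        proof (cases "s \<in> {0..T}")
          case True
          have "\<phi> s = exp (L * (T - s)) * \<psi> s" by (simp add: \<psi>_def exp_add[symmetric] mult.assoc[symmetric])
          also have "\<dots> \<le> exp (L * (T - s)) * S" using \<psi>S[OF True] by simp
          also have "exp (L * (T - s)) = exp (L * (T - x)) * exp (- L * (s - x))"
            by (simp add: exp_add[symmetric] algebra_simps)
          finally have "k s * \<phi> s \<le> k s * (S * exp (L * (T - x)) * exp (- L * (s - x)))"
            using k(3) by (intro mult_left_mono) (auto simp: mult_ac)
          then show ?thesis by (auto simp: indicator_def mult_ac)
        qed (simp add: k_out)
      qed (use L S0 k in auto)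
      also have "\<dots> = S * exp (L * (T - x)) * (LINT s|lborel. (indicator {x..} s * (k s * exp (- L * (s - x)))))"
        by simp
      also have "\<dots> \<le> S * exp (L * (T - x)) * (1 / 2)"
        using L S0 by (intro mult_left_mono) auto
      finally have "\<phi> x \<le> A + S * exp (L * (T - x)) * (1 / 2)" using le[OF x] by simp
      then have "\<psi> x \<le> exp (- L * (T - x)) * (A + S * exp (L * (T - x)) * (1 / 2))"
        unfolding \<psi>_def by (intro mult_left_mono) auto
      also have "\<dots> = exp (- L * (T - x)) * A + S / 2 * (exp (- L * (T - x)) * exp (L * (T - x)))"
        by (simp add: algebra_simps)
      also have "exp (- L * (T - x)) * exp (L * (T - x)) = 1" by (simp add: exp_add[symmetric])
      also have "exp (- L * (T - x)) * A \<le> 1 * A" using A L x by (intro mult_right_mono) auto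
      finally show ?thesis by simp
    qed
    then have "S \<le> A + S / 2" unfolding S_def using x by (intro cSUP_least) auto
    then have S2: "S \<le> 2 * A" by simp
    have "\<phi> x = exp (L * (T - x)) * \<psi> x" by (simp add: \<psi>_def exp_add[symmetric] mult.assoc[symmetric])
    also have "\<dots> \<le> exp (L * T) * (2 * A)"
      using \<psi>S[OF x] S2 x L A S0 \<phi>[OF x] by (intro mult_mono) (auto simp: \<psi>_def)
    finally show "\<phi> x \<le> 2 * exp (L * T) * A" by (simp add: mult_ac)
  qed simp
qed

text \<open>Square integrable functions on \<open>[0,T]\<close> are carried as Borel functions on
  the whole line that vanish off \<open>[0,T]\<close>. All integrals then run over
  \<open>lborel\<close>, and affine substitutions and Fubini need no bookkeeping of domains.\<close>

definition L2_fun :: "real \<Rightarrow> (real \<Rightarrow> 'a::euclidean_space) \<Rightarrow> bool" where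
  "L2_fun T h \<longleftrightarrow> h \<in> borel_measurable borel \<and> integrable lborel (\<lambda>x. (norm (h x))\<^sup>2) \<and> (\<forall>x. x \<notin> {0..T} \<longrightarrow> h x = 0)"

lemma L2_funD:
  assumes "L2_fun T h"
  shows "h \<in> borel_measurable borel" "integrable lborel (\<lambda>x. (norm (h x))\<^sup>2)" "\<And>x. x \<notin> {0..T} \<Longrightarrow> h x = 0"
  using assms by (auto simp: L2_fun_def)

lemma integrable_indicator_Icc: "integrable lborel (\<lambda>x. indicator {a..b::real} x :: real)"
  by (rule integrable_real_indicator) (auto simp: emeasure_lborel_Icc_eq)

lemma L2_fun_integrable:
  assumes "L2_fun T h"
  shows "integrable lborel h"
proof -
  note [measurable] = L2_funD(1)[OF assms]
  have "integrable lborel (\<lambda>x. indicator {0..T} x + (norm (h x))\<^sup>2)"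
    using L2_funD(2)[OF assms] integrable_indicator_Icc by auto
  then show ?thesis
  proof (rule integrable_norm_le)
    show "norm (h x) \<le> indicator {0..T} x + (norm (h x))\<^sup>2" for x
    proof (cases "x \<in> {0..T}")
      case True
      have "0 \<le> (norm (h x) - 1)\<^sup>2 + (norm (h x))\<^sup>2 + 1" by simp
      then have "2 * norm (h x) \<le> 2 * (1 + (norm (h x))\<^sup>2)" by (simp add: power2_eq_square algebra_simps)
      then show ?thesis using True by simp
    qed (simp add: L2_funD(3)[OF assms])
  qed simp
qed

text \<open>The variance of \<open>norm (h x)\<close> over \<open>[0,T]\<close> is nonnegative;
  \<open>m\<close> is the mean value.\<close>

lemma L2_fun_Cauchy_Schwarz:
  assumes "L2_fun T h" and T: "T > 0"
  shows "(LINT x|lborel. norm (h x))\<^sup>2 \<le> T * (LINT x|lborel. (norm (h x))\<^sup>2)"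
proof -
  define I where "I = (LINT x|lborel. norm (h x))"
  define J where "J = (LINT x|lborel. (norm (h x))\<^sup>2)"
  note i = L2_fun_integrable[OF assms(1)] and i2 = L2_funD(2)[OF assms(1)]
  define m where "m = I / T"
  have eq: "indicator {0..T} x * (norm (h x) - m)\<^sup>2 = (norm (h x))\<^sup>2 - 2 * m * norm (h x) + m\<^sup>2 * indicator {0..T} x" for x
    using L2_funD(3)[OF assms(1), of x] by (auto simp: indicator_def power2_eq_square algebra_simps)
  have "0 \<le> (LINT x|lborel. indicator {0..T} x * (norm (h x) - m)\<^sup>2)"
    by (intro Bochner_Integration.integral_nonneg) auto
  also have "\<dots> = J - 2 * m * I + m\<^sup>2 * T"
    unfolding eq I_def J_def using i i2 T integrable_indicator_Icc[of 0 T]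
    by (subst Bochner_Integration.integral_add Bochner_Integration.integral_diff; simp)+
  also have "\<dots> = J - I\<^sup>2 / T" using T by (simp add: m_def power2_eq_square field_simps)
  finally show ?thesis using T unfolding I_def J_def by (simp add: field_simps)
qed

lemma norm_add_square_le: "(norm (a + b))\<^sup>2 \<le> 2 * (norm a)\<^sup>2 + 2 * (norm b)\<^sup>2"
proof -
  have "(norm (a + b))\<^sup>2 \<le> (norm a + norm b)\<^sup>2" by (intro power_mono norm_triangle_ineq) auto
  also have "\<dots> \<le> 2 * (norm a)\<^sup>2 + 2 * (norm b)\<^sup>2"
    using sum_squares_bound[of "norm a" "norm b"] by (simp add: power2_sum)
  finally show ?thesis .
qed

lemma L2_fun_bound:
  fixes h :: "real \<Rightarrow> 'a::euclidean_space"
  assumes "h \<in> borel_measurable borel" "integrable lborel g" "\<And>x. (norm (h x))\<^sup>2 \<le> g x" "\<And>x. x \<notin> {0..T} \<Longrightarrow> h x = 0"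
  shows "L2_fun T h"
  unfolding L2_fun_def
proof (intro conjI)
  note [measurable] = assms(1)
  show "integrable lborel (\<lambda>x. (norm (h x))\<^sup>2)"
    by (rule integrable_le_nonneg[OF assms(2) _ _ assms(3)]) auto
qed (use assms in auto)

lemma L2_fun_add:
  fixes f g :: "real \<Rightarrow> 'a::euclidean_space"
  assumes "L2_fun T f" "L2_fun T g"
  shows "L2_fun T (\<lambda>x. f x + g x)"
proof (rule L2_fun_bound)
  show "integrable lborel (\<lambda>x. 2 * (norm (f x))\<^sup>2 + 2 * (norm (g x))\<^sup>2)"
    using L2_funD(2)[OF assms(1)] L2_funD(2)[OF assms(2)] by auto
qed (use L2_funD(1,3)[OF assms(1)] L2_funD(1,3)[OF assms(2)] norm_add_square_le in auto)

lemma L2_fun_scaleR: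
  fixes f :: "real \<Rightarrow> 'a::euclidean_space"
  assumes "L2_fun T f"
  shows "L2_fun T (\<lambda>x. c *\<^sub>R f x)"
proof (rule L2_fun_bound)
  show "integrable lborel (\<lambda>x. c\<^sup>2 * (norm (f x))\<^sup>2)" using L2_funD(2)[OF assms] by auto
qed (use L2_funD(1,3)[OF assms] in \<open>auto simp: power_mult_distrib\<close>)

lemma L2_fun_diff:
  fixes f g :: "real \<Rightarrow> 'a::euclidean_space"
  assumes "L2_fun T f" "L2_fun T g"
  shows "L2_fun T (\<lambda>x. f x - g x)"
  using L2_fun_add[OF assms(1) L2_fun_scaleR[OF assms(2), of "-1"]] by simp

lemma L2_fun_bounded:
  fixes f :: "real \<Rightarrow> 'a::euclidean_space"
  assumes "f \<in> borel_measurable borel" "\<And>x. norm (f x) \<le> M" "\<And>x. x \<notin> {0..T} \<Longrightarrow> f x = 0"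
  shows "L2_fun T f"
proof (rule L2_fun_bound)
  show "integrable lborel (\<lambda>x. M\<^sup>2 * indicator {0..T} x)" using integrable_indicator_Icc by auto
  fix x show "(norm (f x))\<^sup>2 \<le> M\<^sup>2 * indicator {0..T} x"
    using assms(2)[of x] assms(3)[of x] by (cases "x \<in> {0..T}") (auto intro: power_mono)
qed (use assms in auto)

lemma lebesgue_ae_borel:
  fixes f :: "real \<Rightarrow> 'a::euclidean_space"
  assumes f: "f \<in> borel_measurable lebesgue"
  obtains g where "g \<in> borel_measurable borel" "AE x in lborel. f x = g x"
proof -
  have "\<exists>g\<in>borel_measurable lborel. AE x in lborel. f x \<bullet> b = g x" if "b \<in> Basis" for b
    by (rule completion_ex_borel_measurable_real) (use f in measurable)
  then obtain G where G: "\<And>b. b \<in> Basis \<Longrightarrow> G b \<in> borel_measurable lborel"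
     "\<And>b. b \<in> Basis \<Longrightarrow> AE x in lborel. f x \<bullet> b = G b x" by metis
  show thesis
  proof (rule that[of "\<lambda>x. \<Sum>b\<in>Basis. G b x *\<^sub>R b"])
    show "(\<lambda>x. \<Sum>b\<in>Basis. G b x *\<^sub>R b) \<in> borel_measurable borel"
      using G(1) by (intro borel_measurable_sum borel_measurable_scaleR) auto
    have "AE x in lborel. \<forall>b\<in>Basis. f x \<bullet> b = G b x"
      using G(2) by (intro AE_finite_allI) auto
    then show "AE x in lborel. f x = (\<Sum>b\<in>Basis. G b x *\<^sub>R b)"
    proof eventually_elim
      case (elim x)
      have "f x = (\<Sum>b\<in>Basis. (f x \<bullet> b) *\<^sub>R b)" by (simp add: euclidean_representation)
      also have "\<dots> = (\<Sum>b\<in>Basis. G b x *\<^sub>R b)" using elim by (intro sum.cong) auto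
      finally show ?case .
    qed
  qed
qed

lemma AE_lebesgue_on_iff:
  "(AE x in lebesgue_on {a..b::real}. P x) \<longleftrightarrow> (AE x in lborel. x \<in> {a..b} \<longrightarrow> P x)"
  by (subst AE_restrict_space_iff) (auto simp: AE_completion_iff)

lemma LINT_lebesgue_on_eq:
  fixes f g :: "real \<Rightarrow> 'a::euclidean_space"
  assumes g: "g \<in> borel_measurable borel" and eq: "AE x in lborel. x \<in> {a..b} \<longrightarrow> f x = g x"
  shows "f \<in> borel_measurable (lebesgue_on {a..b})"
    "integral\<^sup>L (lebesgue_on {a..b}) f = (LINT x|lborel. indicator {a..b} x *\<^sub>R g x)"
    "integrable (lebesgue_on {a..b}) f \<longleftrightarrow> integrable lborel (\<lambda>x. indicator {a..b} x *\<^sub>R g x)"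
proof -
  have ae: "AE x in lebesgue_on {a..b}. g x = f x"
    unfolding AE_lebesgue_on_iff using eq by eventually_elim auto
  have gm: "g \<in> borel_measurable lebesgue" by (rule measurable_completion) (use g in simp)
  have gm': "g \<in> borel_measurable (lebesgue_on {a..b})" using gm by (rule measurable_restrict_space1)
  show fm: "f \<in> borel_measurable (lebesgue_on {a..b})"
  proof -
    have "(\<lambda>x. indicator {a..b} x *\<^sub>R f x) \<in> borel_measurable lebesgue"
    proof (rule borel_measurable_AE)
      show "(\<lambda>x. indicator {a..b} x *\<^sub>R g x) \<in> borel_measurable lebesgue" by (intro borel_measurable_scaleR borel_measurable_indicator) (use gm in auto)
      show "AE x in lebesgue. indicator {a..b} x *\<^sub>R g x = indicator {a..b} x *\<^sub>R f x"
        unfolding AE_completion_iff using eq by eventually_elim (auto simp: indicator_def)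
    qed
    then show ?thesis by (subst borel_measurable_restrict_space_iff) auto
  qed
  have "integral\<^sup>L (lebesgue_on {a..b}) f = integral\<^sup>L (lebesgue_on {a..b}) g"
    using ae fm gm' by (intro integral_cong_AE) auto
  also have "\<dots> = (LINT x|lebesgue. indicator {a..b} x *\<^sub>R g x)"
    by (subst integral_restrict_space) auto
  also have "\<dots> = (LINT x|lborel. indicator {a..b} x *\<^sub>R g x)"
    using g by (intro integral_completion) auto
  finally show "integral\<^sup>L (lebesgue_on {a..b}) f = (LINT x|lborel. indicator {a..b} x *\<^sub>R g x)" .
  have "integrable (lebesgue_on {a..b}) f \<longleftrightarrow> integrable (lebesgue_on {a..b}) g"
    using ae fm gm' by (intro integrable_cong_AE) auto
  also have "\<dots> \<longleftrightarrow> integrable lebesgue (\<lambda>x. indicator {a..b} x *\<^sub>R g x)"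
    by (subst integrable_restrict_space) auto
  also have "\<dots> \<longleftrightarrow> integrable lborel (\<lambda>x. indicator {a..b} x *\<^sub>R g x)"
    using g by (intro integrable_completion) auto
  finally show "integrable (lebesgue_on {a..b}) f \<longleftrightarrow> integrable lborel (\<lambda>x. indicator {a..b} x *\<^sub>R g x)" .
qed

text \<open>Bridge from the Lebesgue measurable functions in the definitions to
  \<open>L2_fun\<close>: a Lebesgue measurable function agrees almost everywhere with a Borel one,
  which is then cut off outside \<open>[0,T]\<close>.\<close>

lemma L2_on_borel_representative:
  fixes f :: "real \<Rightarrow> 'a::euclidean_space"
  assumes "L2_on {0..T} f"
  obtains h where "L2_fun T h" "AE x in lborel. x \<in> {0..T} \<longrightarrow> f x = h x"
proof -
  have fm: "f \<in> borel_measurable (lebesgue_on {0..T})" and fi: "integrable (lebesgue_on {0..T}) (\<lambda>x. (norm (f x))\<^sup>2)"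
    using assms by (auto simp: L2_on_def)
  have "(\<lambda>x. indicator {0..T} x *\<^sub>R f x) \<in> borel_measurable lebesgue"
    using fm by (simp add: borel_measurable_restrict_space_iff)
  then obtain g where g[measurable]: "g \<in> borel_measurable borel" and ae: "AE x in lborel. indicator {0..T} x *\<^sub>R f x = g x"
    by (rule lebesgue_ae_borel)
  define h where "h x = indicator {0..T} x *\<^sub>R g x" for x
  have h[measurable]: "h \<in> borel_measurable borel" unfolding h_def by measurable
  have ae': "AE x in lborel. x \<in> {0..T} \<longrightarrow> f x = h x" using ae by eventually_elim (auto simp: h_def)
  then have "AE x in lborel. x \<in> {0..T} \<longrightarrow> (norm (f x))\<^sup>2 = (norm (h x))\<^sup>2" by eventually_elim auto
  from LINT_lebesgue_on_eq(3)[OF _ this] fi have "integrable lborel (\<lambda>x. indicator {0..T} x *\<^sub>R (norm (h x))\<^sup>2)" by simp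
  also have "(\<lambda>x. indicator {0..T} x *\<^sub>R (norm (h x))\<^sup>2) = (\<lambda>x. (norm (h x))\<^sup>2)" by (auto simp: h_def indicator_def)
  finally have "L2_fun T h" by (auto simp: L2_fun_def h_def)
  then show thesis using that ae' by blast
qed

lemma L2_fun_mult_integrable:
  fixes h :: "real \<Rightarrow> 'a::euclidean_space"
  assumes h: "L2_fun T h" and c[measurable]: "c \<in> borel_measurable borel" and M: "\<And>s. s \<in> {0..T} \<Longrightarrow> \<bar>c s\<bar> \<le> M"
  shows "integrable lborel (\<lambda>s. c s *\<^sub>R h s)" "norm (LINT s|lborel. c s *\<^sub>R h s) \<le> M * (LINT s|lborel. norm (h s))"
proof -
  note [measurable] = L2_funD(1)[OF h]
  have le: "norm (c s *\<^sub>R h s) \<le> M * norm (h s)" for s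
    using M[of s] L2_funD(3)[OF h, of s] by (cases "s \<in> {0..T}") (auto intro: mult_right_mono)
  have i: "integrable lborel (\<lambda>s. M * norm (h s))" using L2_fun_integrable[OF h] by auto
  show I: "integrable lborel (\<lambda>s. c s *\<^sub>R h s)"
    by (rule integrable_norm_le[OF i _ le]) simp
  have "norm (LINT s|lborel. c s *\<^sub>R h s) \<le> (LINT s|lborel. M * norm (h s))"
    by (rule Bochner_Integration.integral_norm_bound_integral[OF I i le])
  then show "norm (LINT s|lborel. c s *\<^sub>R h s) \<le> M * (LINT s|lborel. norm (h s))" by simp
qed

lemma L2_fun_norm:
  assumes "L2_fun T h"
  shows "L2_fun T (\<lambda>x. norm (h x))"
  using assms by (auto simp: L2_fun_def)

section \<open>First and second primitives of square integrable functions\<close>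

definition prim1 :: "(real \<Rightarrow> 'a::euclidean_space) \<Rightarrow> real \<Rightarrow> 'a" where
  "prim1 h x = (LINT s|lborel. indicator {..x} s *\<^sub>R h s)"

text \<open>Cauchy's formula for the second primitive that vanishes at 0 together with its
  derivative. A single integral with a ramp as kernel is easier to exchange with other integrals
  than an iterated one.\<close>

definition prim2 :: "(real \<Rightarrow> 'a::euclidean_space) \<Rightarrow> real \<Rightarrow> 'a" where
  "prim2 h x = (LINT s|lborel. max 0 (x - s) *\<^sub>R h s)"

lemma prim1_eq_integral:
  assumes h: "L2_fun T h" and x: "0 \<le> x"
  shows "prim1 h x = integral {0..x} h" "h integrable_on {u..v}"
proof -
  have i: "integrable lborel (\<lambda>s. indicator {u..v} s *\<^sub>R h s)" for u v
    by (rule L2_fun_mult_integrable[OF h, of _ 1]) (auto simp: indicator_def)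
  then have si: "set_integrable lborel {u..v} h" for u v by (simp add: set_integrable_def)
  show "h integrable_on {u..v}" by (rule set_borel_integral_eq_integral(1)[OF si])
  have eq: "indicator {..x} s *\<^sub>R h s = indicator {0..x} s *\<^sub>R h s" for s
    using L2_funD(3)[OF h, of s] x by (auto simp: indicator_def)
  show "prim1 h x = integral {0..x} h"
    unfolding prim1_def eq
    using set_borel_integral_eq_integral(2)[OF si, of 0 x] by (simp add: set_lebesgue_integral_def)
qed

lemma continuous_on_prim1:
  assumes h: "L2_fun T h"
  shows "continuous_on {0..T} (prim1 h)"
proof -
  have "continuous_on {0..T} (\<lambda>x. integral {0..x} h)"
    by (rule indefinite_integral_continuous_1) (rule prim1_eq_integral(2)[OF h order_refl])
  then show ?thesis by (rule continuous_on_eq) (auto simp: prim1_eq_integral[OF h])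
qed

lemma prim1_diff:
  assumes h: "L2_fun T h" and uv: "0 \<le> u" "u \<le> v"
  shows "prim1 h v - prim1 h u = integral {u..v} h"
proof -
  have "prim1 h v = integral {0..v} h" "prim1 h u = integral {0..u} h"
    using uv by (auto intro!: prim1_eq_integral(1)[OF h])
  moreover have "integral {0..u} h + integral {u..v} h = integral {0..v} h"
    using uv by (intro Henstock_Kurzweil_Integration.integral_combine prim1_eq_integral(2)[OF h order_refl]) auto
  ultimately show ?thesis by (metis add_diff_cancel_left')
qed

lemma norm_prim1_le:
  assumes h: "L2_fun T h"
  shows "norm (prim1 h x) \<le> (LINT s|lborel. norm (h s))"
  using L2_fun_mult_integrable(2)[OF h, of "indicator {..x}" 1] by (simp add: prim1_def indicator_def)

lemma norm_prim2_le:
  assumes h: "L2_fun T h" and "x \<le> T" and "T \<ge> 0"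
  shows "norm (prim2 h x) \<le> T * (LINT s|lborel. norm (h s))"
  unfolding prim2_def by (rule L2_fun_mult_integrable(2)[OF h]) (use assms in auto)

lemma prim2_lipschitz:
  assumes h: "L2_fun T h"
  shows "norm (prim2 h v - prim2 h u) \<le> \<bar>v - u\<bar> * (LINT s|lborel. norm (h s))"
proof -
  have i: "integrable lborel (\<lambda>s. max 0 (x - s) *\<^sub>R h s)" for x
    by (rule L2_fun_mult_integrable[OF h, of _ "\<bar>x\<bar>"]) auto
  have "prim2 h v - prim2 h u = (LINT s|lborel. (max 0 (v - s) - max 0 (u - s)) *\<^sub>R h s)"
    unfolding prim2_def scaleR_diff_left by (rule Bochner_Integration.integral_diff[OF i i, symmetric])
  also have "norm \<dots> \<le> \<bar>v - u\<bar> * (LINT s|lborel. norm (h s))"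
    by (rule L2_fun_mult_integrable(2)[OF h]) auto
  finally show ?thesis .
qed

text \<open>Differentiability holds at every point although \<open>h\<close> is only square
  integrable: the linearisation error has the kernel \<open>?c\<close>, which is supported between
  \<open>x\<close> and \<open>y\<close> and bounded by the distance of the two. So the error is at
  most that distance times the increment of the continuous function \<open>H\<close>.\<close>

lemma prim2_has_vector_derivative:
  assumes h: "L2_fun T h" and x: "x \<in> {0..T}"
  shows "(prim2 h has_vector_derivative prim1 h x) (at x within {0..T})"
proof -
  define H where "H = prim1 (\<lambda>s. norm (h s))"
  have nh: "L2_fun T (\<lambda>s. norm (h s))" by (rule L2_fun_norm[OF h])
  have i: "integrable lborel (\<lambda>s. max 0 (x - s) *\<^sub>R h s)" for x
    by (rule L2_fun_mult_integrable[OF h, of _ "\<bar>x\<bar>"]) auto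
  have i1: "integrable lborel (\<lambda>s. indicator {..x} s *\<^sub>R h s)" for x
    by (rule L2_fun_mult_integrable[OF h, of _ 1]) (auto simp: indicator_def)
  have i2: "integrable lborel (\<lambda>s. indicator {..x} s *\<^sub>R norm (h s))" for x
    by (rule L2_fun_mult_integrable[OF nh, of _ 1]) (auto simp: indicator_def)
  have key: "norm (prim2 h y - prim2 h x - (y - x) *\<^sub>R prim1 h x) \<le> \<bar>y - x\<bar> * \<bar>H y - H x\<bar>" for y
  proof -
    let ?c = "\<lambda>s. max 0 (y - s) - max 0 (x - s) - (y - x) * indicator {..x} s"
    \<comment> \<open>The factor \<open>sgn (y - x)\<close> turns the difference of the half line
      indicators into the indicator of the points between \<open>x\<close> and \<open>y\<close>, for
      either order of the two.\<close>
    let ?g = "\<lambda>s. \<bar>y - x\<bar> * (sgn (y - x) * (indicator {..y} s *\<^sub>R norm (h s) - indicator {..x} s *\<^sub>R norm (h s)))"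
    have 1: "prim2 h y - prim2 h x - (y - x) *\<^sub>R prim1 h x
        = (LINT s|lborel. max 0 (y - s) *\<^sub>R h s - max 0 (x - s) *\<^sub>R h s - (y - x) *\<^sub>R (indicator {..x} s *\<^sub>R h s))"
      unfolding prim2_def prim1_def using i i1 by (simp del: scaleR_scaleR)
    have 2: "norm (prim2 h y - prim2 h x - (y - x) *\<^sub>R prim1 h x) \<le> (LINT s|lborel. ?g s)"
      unfolding 1
    proof (rule Bochner_Integration.integral_norm_bound_integral)
      show "integrable lborel (\<lambda>s. max 0 (y - s) *\<^sub>R h s - max 0 (x - s) *\<^sub>R h s - (y - x) *\<^sub>R (indicator {..x} s *\<^sub>R h s))"
        by (rule Bochner_Integration.integrable_diff[OF Bochner_Integration.integrable_diff[OF i i] integrable_scaleR_right[OF i1]])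
      show "integrable lborel ?g"
        by (rule integrable_mult_right[OF integrable_mult_right[OF Bochner_Integration.integrable_diff[OF i2 i2]]])
    next
      fix s
      have "\<bar>?c s\<bar> \<le> \<bar>y - x\<bar> * (sgn (y - x) * (indicator {..y} s - indicator {..x} s))"
        by (auto simp: indicator_def sgn_if max_def abs_if)
      then have "\<bar>?c s\<bar> * norm (h s) \<le> \<bar>y - x\<bar> * (sgn (y - x) * (indicator {..y} s - indicator {..x} s)) * norm (h s)"
        by (rule mult_right_mono) simp
      moreover have "max 0 (y - s) *\<^sub>R h s - max 0 (x - s) *\<^sub>R h s - (y - x) *\<^sub>R (indicator {..x} s *\<^sub>R h s) = ?c s *\<^sub>R h s"
        by (simp add: algebra_simps)
      then have "norm (max 0 (y - s) *\<^sub>R h s - max 0 (x - s) *\<^sub>R h s - (y - x) *\<^sub>R (indicator {..x} s *\<^sub>R h s)) = \<bar>?c s\<bar> * norm (h s)"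
        by (simp only: norm_scaleR)
      moreover have "\<bar>y - x\<bar> * (sgn (y - x) * (indicator {..y} s - indicator {..x} s)) * norm (h s) = ?g s"
        by (simp add: algebra_simps)
      ultimately show "norm (max 0 (y - s) *\<^sub>R h s - max 0 (x - s) *\<^sub>R h s - (y - x) *\<^sub>R (indicator {..x} s *\<^sub>R h s)) \<le> ?g s"
        by (simp only:)
    qed
    have 3: "(LINT s|lborel. ?g s) = \<bar>y - x\<bar> * (sgn (y - x) * (H y - H x))"
      unfolding H_def prim1_def
      by (simp only: Bochner_Integration.integral_mult_right_zero Bochner_Integration.integral_diff[OF i2 i2])
    have 4: "\<bar>y - x\<bar> * (sgn (y - x) * (H y - H x)) \<le> \<bar>y - x\<bar> * \<bar>H y - H x\<bar>"
      by (intro mult_left_mono) (auto simp: sgn_if)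
    show ?thesis using 2 4 unfolding 3 by (rule order_trans)
  qed
  have cont: "continuous_on {0..T} H" unfolding H_def by (rule continuous_on_prim1[OF nh])
  show ?thesis
    unfolding has_vector_derivative_def has_derivative_within_alt
  proof (intro conjI allI impI)
    show "bounded_linear (\<lambda>y. y *\<^sub>R prim1 h x)" by (rule bounded_linear_scaleR_left)
    fix e :: real assume "e > 0"
    then obtain d where d: "d > 0" "\<And>y. y \<in> {0..T} \<Longrightarrow> dist y x < d \<Longrightarrow> dist (H y) (H x) < e"
      using cont x unfolding continuous_on_iff by metis
    have "norm (prim2 h y - prim2 h x - (y - x) *\<^sub>R prim1 h x) \<le> e * norm (y - x)"
      if "y \<in> {0..T}" "norm (y - x) < d" for y
    proof -
      have "\<bar>y - x\<bar> * \<bar>H y - H x\<bar> \<le> \<bar>y - x\<bar> * e"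
        using d(2)[of y] that by (intro mult_left_mono) (auto simp: dist_real_def)
      then show ?thesis using key[of y] by (simp add: mult.commute)
    qed
    then show "\<exists>d>0. \<forall>y\<in>{0..T}. norm (y - x) < d \<longrightarrow> norm (prim2 h y - prim2 h x - (y - x) *\<^sub>R prim1 h x) \<le> e * norm (y - x)"
      using d(1) by blast
  qed
qed

section \<open>The Sobolev space as a space of twice integrated functions\<close>

text \<open>The data are \<open>a = y(0)\<close>, \<open>b = y'(0)\<close> and
  \<open>h = y''\<close>.\<close>

definition H2_rep :: "real \<Rightarrow> (real \<Rightarrow> complex^'n) \<Rightarrow> complex^'n \<Rightarrow> complex^'n \<Rightarrow> (real \<Rightarrow> complex^'n) \<Rightarrow> bool" where
  "H2_rep T y a b h \<longleftrightarrow> L2_fun T h \<and> (\<forall>x\<in>{0..T}. y x = a + x *\<^sub>R b + prim2 h x) \<and> (\<forall>x. x \<notin> {0..T} \<longrightarrow> y x = 0)"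

lemma negligible_imp_AE_lborel:
  assumes "negligible N" "\<And>x. x \<notin> N \<Longrightarrow> P x"
  shows "AE x in lborel. P x"
proof -
  have "N \<in> null_sets lebesgue" using assms(1) by (simp add: negligible_iff_null_sets)
  then have "AE x in lebesgue. x \<notin> N" by (rule AE_not_in)
  then have "AE x in lborel. x \<notin> N" by (simp add: AE_completion_iff)
  then show ?thesis by eventually_elim (rule assms(2))
qed

lemma AE_lborel_imp_negligible:
  assumes "AE x in lborel. P x"
  obtains N where "negligible N" "\<And>x. x \<notin> N \<Longrightarrow> P x"
proof -
  obtain N where N: "N \<in> null_sets lborel" "{x \<in> space lborel. \<not> P x} \<subseteq> N"
    using assms by (auto simp: eventually_ae_filter)
  then have "negligible N" using null_sets_completionI negligible_iff_null_sets by blast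
  then show thesis using that N(2) by auto
qed

lemma H2_rep_imp:
  fixes y :: "real \<Rightarrow> complex^'n"
  assumes T: "T > 0" and rep: "H2_rep T y a b h"
  shows "y \<in> H2 T"
    and "\<And>x. x \<in> {0..T} \<Longrightarrow> deriv_on T y x = b + prim1 h x"
    and "AE x in lborel. x \<in> {0..T} \<longrightarrow> deriv_on T (deriv_on T y) x = h x"
proof -
  have h: "L2_fun T h" and y: "\<And>x. x \<in> {0..T} \<Longrightarrow> y x = a + x *\<^sub>R b + prim2 h x"
    and y0: "\<And>x. x \<notin> {0..T} \<Longrightarrow> y x = 0"
    using rep by (auto simp: H2_rep_def)
  have nh: "L2_fun T (\<lambda>s. norm (h s))" by (rule L2_fun_norm[OF h])
  have d1: "(y has_vector_derivative b + prim1 h x) (at x within {0..T})" if x: "x \<in> {0..T}" for x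
  proof -
    have "((\<lambda>x. a + x *\<^sub>R b + prim2 h x) has_vector_derivative (0 + (1 *\<^sub>R b)) + prim1 h x) (at x within {0..T})"
      by (intro has_vector_derivative_add has_vector_derivative_const prim2_has_vector_derivative[OF h x])
         (auto intro!: derivative_eq_intros)
    then show ?thesis
      by (intro has_vector_derivative_transform[OF x y, rotated]) auto
  qed
  show dy: "deriv_on T y x = b + prim1 h x" if "x \<in> {0..T}" for x
    unfolding deriv_on_def by (rule vector_derivative_within_closed_interval[OF T that d1[OF that]])
  obtain N where N: "negligible N"
    "\<And>x. x \<in> {0..T} - N \<Longrightarrow> ((\<lambda>u. integral {0..u} h) has_vector_derivative h x) (at x within {0..T})"
    using indefinite_integral_has_vector_derivative_ae[OF prim1_eq_integral(2)[OF h order_refl, of 0 T]] by blast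
  have d2: "(deriv_on T y has_vector_derivative h x) (at x within {0..T})" if x: "x \<in> {0..T} - N" for x
  proof -
    have "((\<lambda>u. b + integral {0..u} h) has_vector_derivative 0 + h x) (at x within {0..T})"
      by (intro has_vector_derivative_add has_vector_derivative_const N x)
    then show ?thesis
      using x by (intro has_vector_derivative_transform[of x "{0..T}" "deriv_on T y"]) (auto simp: dy prim1_eq_integral(1)[OF h])
  qed
  show ae: "AE x in lborel. x \<in> {0..T} \<longrightarrow> deriv_on T (deriv_on T y) x = h x"
  proof (rule negligible_imp_AE_lborel[OF N(1)], intro impI)
    fix x assume "x \<notin> N" "x \<in> {0..T}"
    then show "deriv_on T (deriv_on T y) x = h x"
      by (subst deriv_on_def) (intro vector_derivative_within_closed_interval[OF T] d2, auto)
  qed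
  define M where "M = norm b + (LINT s|lborel. norm (h s))"
  have "abs_continuous_on {0..T} y"
  \<comment> \<open>\<open>y\<close> is Lipschitz, so a constant serves as the square integrable
    density of its increments.\<close>
  proof (rule abs_continuous_on_L2_primitive[of "\<lambda>_. M"])
    fix u v assume uv: "0 \<le> u" "u \<le> v" "v \<le> T"
    have "y v - y u = (v - u) *\<^sub>R b + (prim2 h v - prim2 h u)" using uv y[of u] y[of v] by (simp add: algebra_simps)
    then have "norm (y v - y u) \<le> (v - u) * norm b + (v - u) * (LINT s|lborel. norm (h s))"
      using prim2_lipschitz[OF h, of v u] norm_triangle_ineq[of "(v - u) *\<^sub>R b" "prim2 h v - prim2 h u"] uv by simp
    then show "norm (y v - y u) \<le> integral {u..v} (\<lambda>_. M)" using uv by (simp add: M_def algebra_simps)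
  qed auto
  moreover have "abs_continuous_on {0..T} (deriv_on T y)"
  proof (rule abs_continuous_on_L2_primitive[of "\<lambda>x. norm (h x)"])
    have "integrable lborel (\<lambda>x. (norm (h x))\<^sup>2)" by (rule L2_funD(2)[OF h])
    then show "(\<lambda>x. (norm (h x))\<^sup>2) integrable_on {0..T}"
      by (intro integrable_on_subinterval[OF integrable_on_lborel]) auto
    show "(\<lambda>x. norm (h x)) integrable_on {0..T}" by (rule prim1_eq_integral(2)[OF nh order_refl])
    fix u v assume uv: "0 \<le> u" "u \<le> v" "v \<le> T"
    have "deriv_on T y v - deriv_on T y u = integral {u..v} h"
      using uv dy[of u] dy[of v] prim1_diff[OF h, of u v] by simp
    then show "norm (deriv_on T y v - deriv_on T y u) \<le> integral {u..v} (\<lambda>x. norm (h x))"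
      using prim1_eq_integral(2)[OF h order_refl] prim1_eq_integral(2)[OF nh order_refl]
      by (auto intro!: Henstock_Kurzweil_Integration.integral_norm_bound_integral)
  qed
  moreover have "\<forall>x\<in>{0..T}. y differentiable (at x within {0..T})"
    using d1 differentiableI_vector by blast
  moreover have "AE x in lebesgue_on {0..T}. deriv_on T y differentiable (at x within {0..T})"
    unfolding AE_lebesgue_on_iff
    by (rule negligible_imp_AE_lborel[OF N(1)]) (use d2 differentiableI_vector in blast)
  moreover have "L2_on {0..T} (deriv_on T (deriv_on T y))"
  proof -
    note m = L2_funD(1)[OF h]
    have ae2: "AE x in lborel. x \<in> {0..T} \<longrightarrow> (norm (deriv_on T (deriv_on T y) x))\<^sup>2 = (norm (h x))\<^sup>2"
      using ae by eventually_elim auto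
    have "(\<lambda>x. indicator {0..T} x *\<^sub>R (norm (h x))\<^sup>2) = (\<lambda>x. (norm (h x))\<^sup>2)"
      using L2_funD(3)[OF h] by (auto simp: indicator_def fun_eq_iff)
    then show ?thesis unfolding L2_on_def
      using LINT_lebesgue_on_eq(1)[OF m ae] LINT_lebesgue_on_eq(3)[OF _ ae2] m L2_funD(2)[OF h] by simp
  qed
  ultimately show "y \<in> H2 T" using y0 by (auto simp: H2_def)
qed

text \<open>The two integrations rest on different facts. \<open>y'\<close> has a derivative almost
  everywhere only and is recovered from it by absolute continuity; \<open>y\<close> is
  differentiable everywhere, so the difference \<open>z\<close> to the candidate has derivative zero
  at each point and is constant.\<close>

lemma H2_imp_rep:
  fixes y :: "real \<Rightarrow> complex^'n"
  assumes T: "T > 0" and yH: "y \<in> H2 T"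
  obtains a b h where "H2_rep T y a b h"
proof -
  have y0: "\<And>x. x \<notin> {0..T} \<Longrightarrow> y x = 0"
    and dy: "\<And>x. x \<in> {0..T} \<Longrightarrow> y differentiable (at x within {0..T})"
    and ac: "abs_continuous_on {0..T} (deriv_on T y)"
    and ddy: "AE x in lborel. x \<in> {0..T} \<longrightarrow> deriv_on T y differentiable (at x within {0..T})"
    and L2: "L2_on {0..T} (deriv_on T (deriv_on T y))"
    using yH unfolding H2_def AE_lebesgue_on_iff by auto
  obtain h where h: "L2_fun T h" and hae: "AE x in lborel. x \<in> {0..T} \<longrightarrow> deriv_on T (deriv_on T y) x = h x"
    using L2_on_borel_representative[OF L2] by blast
  have "AE x in lborel. x \<in> {0..T} \<longrightarrow> deriv_on T y differentiable (at x within {0..T}) \<and> deriv_on T (deriv_on T y) x = h x"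
    using ddy hae by eventually_elim auto
  then obtain N where N: "negligible N"
    "\<And>x. x \<notin> N \<Longrightarrow> x \<in> {0..T} \<longrightarrow> deriv_on T y differentiable (at x within {0..T}) \<and> deriv_on T (deriv_on T y) x = h x"
    by (rule AE_lborel_imp_negligible) blast
  have d2: "(deriv_on T y has_vector_derivative h x) (at x within {0..T})" if x: "x \<in> {0..T} - N" for x
  proof -
    have "deriv_on T y differentiable (at x within {0..T})" "vector_derivative (deriv_on T y) (at x within {0..T}) = h x"
      using N(2)[of x] x by (simp_all add: deriv_on_def[of T "deriv_on T y"])
    then show ?thesis using vector_derivative_works by metis
  qed
  define b where "b = deriv_on T y 0"
  have int: "deriv_on T y x = b + prim1 h x" if x: "x \<in> {0..T}" for x
  proof -
    have "(h has_integral deriv_on T y x - deriv_on T y 0) {0..x}"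
    proof (rule abs_continuous_has_integral_vector_derivative[OF _ _ N(1)])
      show "abs_continuous_on {0..x} (deriv_on T y)"
        using ac x unfolding abs_continuous_on_def
        by (meson atLeastatMost_subset_iff atLeastAtMost_iff order_refl order_trans)
      fix s assume "s \<in> {0..x} - N"
      then show "(deriv_on T y has_vector_derivative h s) (at s within {0..x})"
        using x by (intro has_vector_derivative_within_subset[OF d2]) auto
    qed (use x in auto)
    then show ?thesis using x prim1_eq_integral(1)[OF h, of x] by (simp add: b_def integral_unique)
  qed
  define z where "z x = y x - (x *\<^sub>R b + prim2 h x)" for x
  have "(z has_derivative (\<lambda>_. 0)) (at x within {0..T})" if x: "x \<in> {0..T}" for x
  proof -
    have "(y has_vector_derivative b + prim1 h x) (at x within {0..T})"
      using dy[OF x] int[OF x] by (metis deriv_on_def vector_derivative_works)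
    moreover have "((\<lambda>x. x *\<^sub>R b + prim2 h x) has_vector_derivative (1 *\<^sub>R b) + prim1 h x) (at x within {0..T})"
      by (intro has_vector_derivative_add prim2_has_vector_derivative[OF h x])
         (auto intro!: derivative_eq_intros)
    ultimately have "(z has_vector_derivative (b + prim1 h x) - ((1 *\<^sub>R b) + prim1 h x)) (at x within {0..T})"
      unfolding z_def by (rule has_vector_derivative_diff)
    then show ?thesis by (simp add: has_vector_derivative_def)
  qed
  then have "z x = z 0" if "x \<in> {0..T}" for x
    using that T by (intro has_derivative_zero_unique[of "{0..T}"]) auto
  then have "y x = z 0 + x *\<^sub>R b + prim2 h x" if "x \<in> {0..T}" for x
    using that by (metis z_def add.assoc diff_add_cancel)
  then have "H2_rep T y (z 0) b h" using h y0 by (auto simp: H2_rep_def)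
  then show thesis by (rule that)
qed

text \<open>The norm becomes an integral over the line of an explicit expression in the data.
  Integrability comes along because both comparisons with \<open>rep_size\<close> rest on
  monotonicity of the integral.\<close>

lemma H2_norm_rep:
  fixes y :: "real \<Rightarrow> complex^'n"
  assumes T: "T > 0" and rep: "H2_rep T y a b h"
  shows "integrable lborel (\<lambda>s. indicator {0..T} s * ((norm (a + s *\<^sub>R b + prim2 h s))\<^sup>2 + (norm (b + prim1 h s))\<^sup>2 + (norm (h s))\<^sup>2))"
    "(H2_norm T y)\<^sup>2 = (LINT s|lborel. indicator {0..T} s * ((norm (a + s *\<^sub>R b + prim2 h s))\<^sup>2 + (norm (b + prim1 h s))\<^sup>2 + (norm (h s))\<^sup>2))"
    (is "_ = ?R")
proof -
  have h: "L2_fun T h" and y: "\<And>x. x \<in> {0..T} \<Longrightarrow> y x = a + x *\<^sub>R b + prim2 h x"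
    using rep by (auto simp: H2_rep_def)
  note imp = H2_rep_imp[OF T rep]
  note hm[measurable] = L2_funD(1)[OF h]
  define A where "A s = indicator {0..T} s *\<^sub>R (a + s *\<^sub>R b + prim2 h s)" for s
  define B where "B s = indicator {0..T} s *\<^sub>R (b + prim1 h s)" for s
  have m1: "prim1 h \<in> borel_measurable borel"
  proof -
    have "(\<lambda>x. LINT s|lborel. indicator {s. s \<le> x} s *\<^sub>R h s) \<in> borel_measurable borel"
      by measurable
    then show ?thesis by (simp add: prim1_def[abs_def] atMost_def)
  qed
  have m2: "prim2 h \<in> borel_measurable borel"
    unfolding prim2_def[abs_def] by measurable
  have [measurable]: "A \<in> borel_measurable borel" "B \<in> borel_measurable borel"
    unfolding A_def[abs_def] B_def[abs_def] using m1 m2 by measurable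
  define I where "I = (LINT s|lborel. norm (h s))"
  have I0: "I \<ge> 0" by (simp add: I_def)
  have AL: "L2_fun T A"
  proof (rule L2_fun_bounded[of _ "norm a + T * norm b + T * I"])
    fix s
    show "norm (A s) \<le> norm a + T * norm b + T * I"
    proof (cases "s \<in> {0..T}")
      case True
      have "norm (A s) \<le> norm a + norm (s *\<^sub>R b) + norm (prim2 h s)"
        using True norm_triangle_ineq[of "a + s *\<^sub>R b" "prim2 h s"] norm_triangle_ineq[of a "s *\<^sub>R b"] by (simp add: A_def)
      also have "\<dots> \<le> norm a + T * norm b + T * I"
        using True norm_prim2_le[OF h, of s] T unfolding I_def by (intro add_mono) (auto intro: mult_right_mono)
      finally show ?thesis .
    qed (use T I0 in \<open>simp add: A_def\<close>)
  qed (auto simp: A_def)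
  have BL: "L2_fun T B"
  proof (rule L2_fun_bounded[of _ "norm b + I"])
    fix s
    show "norm (B s) \<le> norm b + I"
      using norm_triangle_ineq[of b "prim1 h s"] norm_prim1_le[OF h, of s] I0 unfolding I_def by (auto simp: B_def indicator_def)
  qed (auto simp: B_def)
  have eq: "indicator {0..T} s * ((norm (a + s *\<^sub>R b + prim2 h s))\<^sup>2 + (norm (b + prim1 h s))\<^sup>2 + (norm (h s))\<^sup>2)
     = (norm (A s))\<^sup>2 + (norm (B s))\<^sup>2 + (norm (h s))\<^sup>2" for s
    using L2_funD(3)[OF h, of s] by (auto simp: A_def B_def indicator_def)
  show int: "integrable lborel (\<lambda>s. indicator {0..T} s * ((norm (a + s *\<^sub>R b + prim2 h s))\<^sup>2 + (norm (b + prim1 h s))\<^sup>2 + (norm (h s))\<^sup>2))"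
    unfolding eq using L2_funD(2)[OF AL] L2_funD(2)[OF BL] L2_funD(2)[OF h] by auto
  have "(H2_norm T y)\<^sup>2 = (LINT x|lebesgue_on {0..T}. (norm (y x))\<^sup>2 + (norm (deriv_on T y x))\<^sup>2 + (norm (deriv_on T (deriv_on T y) x))\<^sup>2)"
    unfolding H2_norm_def by (intro real_sqrt_pow2 Bochner_Integration.integral_nonneg) auto
  also have "\<dots> = (LINT s|lborel. indicator {0..T} s *\<^sub>R ((norm (A s))\<^sup>2 + (norm (B s))\<^sup>2 + (norm (h s))\<^sup>2))"
  proof (rule LINT_lebesgue_on_eq(2))
    show "AE x in lborel. x \<in> {0..T} \<longrightarrow> (norm (y x))\<^sup>2 + (norm (deriv_on T y x))\<^sup>2 + (norm (deriv_on T (deriv_on T y) x))\<^sup>2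
      = (norm (A x))\<^sup>2 + (norm (B x))\<^sup>2 + (norm (h x))\<^sup>2"
      using imp(3) by eventually_elim (auto simp: A_def B_def y imp(2))
  qed measurable
  also have "\<dots> = ?R"
    by (intro Bochner_Integration.integral_cong refl) (auto simp: eq[symmetric] indicator_def)
  finally show "(H2_norm T y)\<^sup>2 = ?R" .
qed

lemma norm_add3_square_le: "(norm (a + b + c))\<^sup>2 \<le> 3 * (norm a)\<^sup>2 + 3 * (norm b)\<^sup>2 + 3 * (norm c)\<^sup>2"
proof -
  have "norm (a + b + c) \<le> norm a + norm b + norm c"
    by (rule order_trans[OF norm_triangle_ineq add_right_mono[OF norm_triangle_ineq]])
  then have "(norm (a + b + c))\<^sup>2 \<le> (norm a + norm b + norm c)\<^sup>2" by (rule power_mono) simp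
  moreover have "(norm a + norm b + norm c)\<^sup>2 \<le> 3 * (norm a)\<^sup>2 + 3 * (norm b)\<^sup>2 + 3 * (norm c)\<^sup>2"
    using sum_squares_bound[of "norm a" "norm b"] sum_squares_bound[of "norm a" "norm c"] sum_squares_bound[of "norm b" "norm c"]
    by (simp add: power2_eq_square algebra_simps)
  ultimately show ?thesis by linarith
qed

text \<open>The squared norm of the data in the product space; by the two lemmas that follow it is
  equivalent to the squared \<open>H\<^sup>2\<close> norm of the function represented.\<close>

definition rep_size :: "'a::euclidean_space \<Rightarrow> 'a \<Rightarrow> (real \<Rightarrow> 'a) \<Rightarrow> real" where
  "rep_size a b h = (norm a)\<^sup>2 + (norm b)\<^sup>2 + (LINT s|lborel. (norm (h s))\<^sup>2)"

lemma rep_size_bounds: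
  "(norm a)\<^sup>2 \<le> rep_size a b h" "(norm b)\<^sup>2 \<le> rep_size a b h" "(LINT s|lborel. (norm (h s))\<^sup>2) \<le> rep_size a b h"
  by (auto simp: rep_size_def)

lemma rep_size_nonneg: "0 \<le> rep_size a b h"
  by (simp add: rep_size_def)

lemma H2_norm_le_rep_size:
  assumes T: "T > 0"
  obtains C where "C \<ge> 0" "\<And>(y :: real \<Rightarrow> complex^'n) a b h. H2_rep T y a b h \<Longrightarrow> (H2_norm T y)\<^sup>2 \<le> C * rep_size a b h"
\<comment> \<open>The constant adds up pointwise bounds: 5 = 3 + 2 from \<open>a\<close> in
  \<open>y\<close> and \<open>b\<close> in \<open>y'\<close>, \<open>3 * T\<^sup>2\<close> from
  \<open>s *\<^sub>R b\<close>, \<open>3 * T^3\<close> and \<open>2 * T\<close> from the two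
  primitives of \<open>h\<close> by Cauchy-Schwarz. Integration gives the factor \<open>T\<close>,
  and \<open>h\<close> itself the final 1.\<close>
proof (rule that[of "T * (5 + 3 * T\<^sup>2 + 3 * T^3 + 2 * T) + 1"])
  show "0 \<le> T * (5 + 3 * T\<^sup>2 + 3 * T^3 + 2 * T) + 1" using T by simp
  fix y :: "real \<Rightarrow> complex^'n" and a b h
  assume rep: "H2_rep T y a b h"
  then have h: "L2_fun T h" by (simp add: H2_rep_def)
  define I where "I = (LINT s|lborel. norm (h s))"
  define J where "J = (LINT s|lborel. (norm (h s))\<^sup>2)"
  have IJ: "I\<^sup>2 \<le> T * J" unfolding I_def J_def by (rule L2_fun_Cauchy_Schwarz[OF h T])
  have I0: "I \<ge> 0" and J0: "J \<ge> 0" by (simp_all add: I_def J_def)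
  define K where "K = 3 * (norm a)\<^sup>2 + 3 * (T\<^sup>2 * (norm b)\<^sup>2) + 3 * (T\<^sup>2 * I\<^sup>2) + 2 * (norm b)\<^sup>2 + 2 * I\<^sup>2"
  have K0: "K \<ge> 0" by (simp add: K_def)
  have le: "indicator {0..T} s * ((norm (a + s *\<^sub>R b + prim2 h s))\<^sup>2 + (norm (b + prim1 h s))\<^sup>2 + (norm (h s))\<^sup>2)
    \<le> K * indicator {0..T} s + (norm (h s))\<^sup>2" for s
  proof (cases "s \<in> {0..T}")
    case True
    have "(norm (s *\<^sub>R b))\<^sup>2 \<le> T\<^sup>2 * (norm b)\<^sup>2"
      using True by (auto simp: power_mult_distrib intro!: mult_right_mono power_mono)
    moreover have "(norm (prim2 h s))\<^sup>2 \<le> T\<^sup>2 * I\<^sup>2"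
      using True norm_prim2_le[OF h, of s] T unfolding I_def power_mult_distrib[symmetric] by (intro power_mono) auto
    moreover have "(norm (prim1 h s))\<^sup>2 \<le> I\<^sup>2"
      using norm_prim1_le[OF h] unfolding I_def by (intro power_mono) auto
    ultimately show ?thesis
      using True norm_add3_square_le[of a "s *\<^sub>R b" "prim2 h s"] norm_add_square_le[of b "prim1 h s"] by (simp add: K_def)
  qed simp
  have i: "integrable lborel (\<lambda>s. K * indicator {0..T} s + (norm (h s))\<^sup>2)"
    using L2_funD(2)[OF h] integrable_indicator_Icc by auto
  have "(H2_norm T y)\<^sup>2 \<le> (LINT s|lborel. K * indicator {0..T} s + (norm (h s))\<^sup>2)"
    unfolding H2_norm_rep(2)[OF T rep] by (rule integral_mono[OF H2_norm_rep(1)[OF T rep] i le])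
  moreover have "(LINT s|lborel. K * indicator {0..T} s + (norm (h s))\<^sup>2) = K * T + J"
    unfolding J_def using L2_funD(2)[OF h] integrable_indicator_Icc[of 0 T] T
    by (subst Bochner_Integration.integral_add) auto
  moreover have "K * T + J \<le> (T * (5 + 3 * T\<^sup>2 + 3 * T^3 + 2 * T) + 1) * rep_size a b h"
  proof -
    have b: "(norm a)\<^sup>2 \<le> rep_size a b h" "(norm b)\<^sup>2 \<le> rep_size a b h" "J \<le> rep_size a b h"
      unfolding J_def by (rule rep_size_bounds)+
    have I2: "I\<^sup>2 \<le> T * rep_size a b h" using IJ b(3) T by (meson mult_left_mono less_imp_le order_trans)
    have "3 * (T\<^sup>2 * (norm b)\<^sup>2) \<le> 3 * (T\<^sup>2 * rep_size a b h)" using b(2) by (simp add: mult_left_mono)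
    moreover have "3 * (T\<^sup>2 * I\<^sup>2) \<le> 3 * (T\<^sup>2 * (T * rep_size a b h))" using I2 by (simp add: mult_left_mono)
    ultimately have "K \<le> 3 * rep_size a b h + 3 * (T\<^sup>2 * rep_size a b h) + 3 * (T\<^sup>2 * (T * rep_size a b h)) + 2 * rep_size a b h + 2 * (T * rep_size a b h)"
      unfolding K_def using b I2 by linarith
    also have "\<dots> = (5 + 3 * T\<^sup>2 + 3 * T^3 + 2 * T) * rep_size a b h"
      by (simp add: algebra_simps power2_eq_square power3_eq_cube)
    finally have "T * K \<le> T * ((5 + 3 * T\<^sup>2 + 3 * T^3 + 2 * T) * rep_size a b h)" using T by simp
    then show ?thesis using b(3) by (simp add: algebra_simps)
  qed
  ultimately show "(H2_norm T y)\<^sup>2 \<le> (T * (5 + 3 * T\<^sup>2 + 3 * T^3 + 2 * T) + 1) * rep_size a b h" by linarith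
qed

text \<open>The data are recovered from the top: \<open>h\<close> is part of the norm,
  \<open>b\<close> is \<open>y'\<close> minus a primitive of \<open>h\<close>, and \<open>a\<close>
  is \<open>y\<close> minus the rest. Since \<open>b\<close> and \<open>a\<close> are constants,
  averaging over \<open>[0,T]\<close> bounds them by integrals.\<close>

lemma rep_size_le_H2_norm:
  assumes T: "T > 0"
  obtains C where "C \<ge> 0" "\<And>(y :: real \<Rightarrow> complex^'n) a b h. H2_rep T y a b h \<Longrightarrow> rep_size a b h \<le> C * (H2_norm T y)\<^sup>2"
proof -
  \<comment> \<open>\<open>K1\<close> and \<open>K2\<close> are read off from the averaged
    inequalities for \<open>b\<close> and \<open>a\<close>, divided by \<open>T\<close>.\<close>
  define K1 where "K1 = (2 + 2 * T\<^sup>2) / T"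
  have K1: "K1 \<ge> 0" using T by (simp add: K1_def)
  define K2 where "K2 = (3 + 3 * T^3 * K1 + 3 * T^4) / T"
  have K2: "K2 \<ge> 0" using T K1 by (simp add: K2_def)
  show thesis
  proof (rule that[of "K1 + K2 + 1"])
    show "0 \<le> K1 + K2 + 1" using K1 K2 by simp
    fix y :: "real \<Rightarrow> complex^'n" and a b h
    assume rep: "H2_rep T y a b h"
    then have h: "L2_fun T h" by (simp add: H2_rep_def)
    define I where "I = (LINT s|lborel. norm (h s))"
    define J where "J = (LINT s|lborel. (norm (h s))\<^sup>2)"
    define N where "N = (H2_norm T y)\<^sup>2"
    have IJ: "I\<^sup>2 \<le> T * J" unfolding I_def J_def by (rule L2_fun_Cauchy_Schwarz[OF h T])
    have I0: "I \<ge> 0" and J0: "J \<ge> 0" by (simp_all add: I_def J_def)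
    note Nint = H2_norm_rep(1)[OF T rep] and Neq = H2_norm_rep(2)[OF T rep, folded N_def]
    let ?f = "\<lambda>s. indicator {0..T} s * ((norm (a + s *\<^sub>R b + prim2 h s))\<^sup>2 + (norm (b + prim1 h s))\<^sup>2 + (norm (h s))\<^sup>2)"
    have JN: "J \<le> N" unfolding J_def Neq
    proof (rule integral_mono[OF L2_funD(2)[OF h] Nint])
      fix s show "(norm (h s))\<^sup>2 \<le> ?f s" using L2_funD(3)[OF h, of s] by (cases "s \<in> {0..T}") auto
    qed
    have ic: "integrable lborel (\<lambda>s. c * indicator {0..T} s)" "(LINT s|lborel. c * indicator {0..T} s) = c * T" for c :: real
      using integrable_indicator_Icc[of 0 T] T by auto
    have ic1: "(LINT s|lborel. indicator {0..T} s) = T" using ic(2)[of 1] by simp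
    \<comment> \<open>The averaging step: a bound for the constant \<open>c\<close> that holds at
      each point of \<open>[0,T]\<close> is integrated over \<open>[0,T]\<close>.\<close>
    have lower: "c * T \<le> k * N + d * T" if "\<And>s. s \<in> {0..T} \<Longrightarrow> c \<le> k * ?f s + d" for c d k
    proof -
      have "(LINT s|lborel. c * indicator {0..T} s) \<le> (LINT s|lborel. k * ?f s + d * indicator {0..T} s)"
      proof (rule integral_mono)
        show "integrable lborel (\<lambda>s. c * indicator {0..T} s)" by (rule ic)
        show "integrable lborel (\<lambda>s. k * ?f s + d * indicator {0..T} s)"
          by (rule Bochner_Integration.integrable_add[OF integrable_mult_right[OF Nint] ic(1)])
        fix s show "c * indicator {0..T} s \<le> k * ?f s + d * indicator {0..T} s"
          using that[of s] by (cases "s \<in> {0..T}") auto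
      qed
      moreover have "(LINT s|lborel. k * ?f s + d * indicator {0..T} s) = k * N + d * T"
        unfolding Neq by (simp only: Bochner_Integration.integral_add[OF integrable_mult_right[OF Nint] ic(1)] Bochner_Integration.integral_mult_right_zero ic1)
      ultimately show ?thesis unfolding ic(2) by linarith
    qed
    have "(norm b)\<^sup>2 * T \<le> 2 * N + (2 * I\<^sup>2) * T"
    proof (rule lower)
      fix s assume s: "s \<in> {0..T}"
      have "(norm (prim1 h s))\<^sup>2 \<le> I\<^sup>2"
        using norm_prim1_le[OF h] unfolding I_def by (intro power_mono) auto
      moreover have "(norm b)\<^sup>2 \<le> 2 * (norm (b + prim1 h s))\<^sup>2 + 2 * (norm (prim1 h s))\<^sup>2"
        using norm_add_square_le[of "b + prim1 h s" "- prim1 h s"] by simp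
      moreover have "(norm (b + prim1 h s))\<^sup>2 \<le> ?f s" using s by simp
      ultimately show "(norm b)\<^sup>2 \<le> 2 * ?f s + 2 * I\<^sup>2" by linarith
    qed
    also have "\<dots> \<le> 2 * N + (2 * (T * N)) * T"
      using IJ JN T by (intro add_left_mono mult_right_mono mult_left_mono) (auto intro: order_trans mult_left_mono)
    finally have bN: "(norm b)\<^sup>2 \<le> K1 * N"
      using T by (simp add: K1_def field_simps power2_eq_square)
    have I2: "I\<^sup>2 \<le> T * N" using IJ JN T by (meson mult_left_mono less_imp_le order_trans)
    have "(norm a)\<^sup>2 * T \<le> 3 * N + (3 * (T\<^sup>2 * (norm b)\<^sup>2) + 3 * (T\<^sup>2 * I\<^sup>2)) * T"
    proof (rule lower)
      fix s assume s: "s \<in> {0..T}"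
      have "(norm (s *\<^sub>R b))\<^sup>2 \<le> T\<^sup>2 * (norm b)\<^sup>2"
        using s by (auto simp: power_mult_distrib intro!: mult_right_mono power_mono)
      moreover have "(norm (prim2 h s))\<^sup>2 \<le> T\<^sup>2 * I\<^sup>2"
        using s norm_prim2_le[OF h, of s] T unfolding I_def power_mult_distrib[symmetric] by (intro power_mono) auto
      moreover have "(norm a)\<^sup>2 \<le> 3 * (norm (a + s *\<^sub>R b + prim2 h s))\<^sup>2 + 3 * (norm (s *\<^sub>R b))\<^sup>2 + 3 * (norm (prim2 h s))\<^sup>2"
        using norm_add3_square_le[of "a + s *\<^sub>R b + prim2 h s" "- (s *\<^sub>R b)" "- prim2 h s"] by simp
      moreover have "(norm (a + s *\<^sub>R b + prim2 h s))\<^sup>2 \<le> ?f s" using s by simp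
      ultimately show "(norm a)\<^sup>2 \<le> 3 * ?f s + (3 * (T\<^sup>2 * (norm b)\<^sup>2) + 3 * (T\<^sup>2 * I\<^sup>2))" by linarith
    qed
    also have "\<dots> \<le> 3 * N + (3 * (T\<^sup>2 * (K1 * N)) + 3 * (T\<^sup>2 * (T * N))) * T"
      using bN I2 T by (intro add_left_mono mult_right_mono add_mono mult_left_mono) auto
    finally have aN: "(norm a)\<^sup>2 \<le> K2 * N"
      using T by (simp add: K2_def field_simps power2_eq_square power3_eq_cube power4_eq_xxxx)
    show "rep_size a b h \<le> (K1 + K2 + 1) * (H2_norm T y)\<^sup>2"
      using aN bN JN by (simp add: rep_size_def J_def N_def algebra_simps)
  qed
qed

text \<open>Representation by data at the right end point \<open>T\<close>, where the Volterra term of the operator vanishes.\<close>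

definition back2 :: "(real \<Rightarrow> 'a::euclidean_space) \<Rightarrow> real \<Rightarrow> 'a" where
  "back2 h x = (LINT s|lborel. max 0 (s - x) *\<^sub>R h s)"

text \<open>Here \<open>a = y(T)\<close> and \<open>b = - y'(T)\<close>: the expansion is in the
  distance \<open>T - x\<close> from the end point.\<close>

definition H2_rep_back :: "real \<Rightarrow> (real \<Rightarrow> complex^'n) \<Rightarrow> complex^'n \<Rightarrow> complex^'n \<Rightarrow> (real \<Rightarrow> complex^'n) \<Rightarrow> bool" where
  "H2_rep_back T y a b h \<longleftrightarrow> L2_fun T h \<and> (\<forall>x\<in>{0..T}. y x = a + (T - x) *\<^sub>R b + back2 h x) \<and> (\<forall>x. x \<notin> {0..T} \<longrightarrow> y x = 0)"

text \<open>The ramps \<open>max 0 (s - x)\<close> and \<open>max 0 (x - s)\<close> differ by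
  \<open>s - x\<close>, so the two second primitives differ by an affine function whose coefficients
  are the moments of \<open>h\<close>.\<close>

lemma back2_eq_prim2:
  assumes h: "L2_fun T h"
  shows "back2 h x = prim2 h x - x *\<^sub>R (LINT s|lborel. h s) + (LINT s|lborel. s *\<^sub>R h s)"
proof -
  have i: "integrable lborel (\<lambda>s. max 0 (x - s) *\<^sub>R h s)"
    by (rule L2_fun_mult_integrable[OF h, of _ "\<bar>x\<bar>"]) auto
  have i1: "integrable lborel (\<lambda>s. s *\<^sub>R h s)"
    by (rule L2_fun_mult_integrable[OF h, of _ "T"]) auto
  have i0: "integrable lborel (\<lambda>s. x *\<^sub>R h s)" by (rule integrable_scaleR_right[OF L2_fun_integrable[OF h]])
  have eq: "max 0 (s - x) *\<^sub>R h s = max 0 (x - s) *\<^sub>R h s - x *\<^sub>R h s + s *\<^sub>R h s" for s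
    by (auto simp: max_def algebra_simps)
  show ?thesis unfolding back2_def prim2_def eq
    by (simp only: Bochner_Integration.integral_add[OF Bochner_Integration.integrable_diff[OF i i0] i1]
        Bochner_Integration.integral_diff[OF i i0] Bochner_Integration.integral_scaleR_right)
qed

lemma square_triangle4:
  assumes "x \<le> p + q + r + s" "0 \<le> x"
  shows "x\<^sup>2 \<le> 4 * (p\<^sup>2 + q\<^sup>2 + r\<^sup>2 + s\<^sup>2 :: real)"
proof -
  have "x\<^sup>2 \<le> (p + q + r + s)\<^sup>2" using assms by (intro power_mono)
  also have "\<dots> \<le> 4 * (p\<^sup>2 + q\<^sup>2 + r\<^sup>2 + s\<^sup>2)"
    using sum_squares_bound[of p q] sum_squares_bound[of p r] sum_squares_bound[of p s]
      sum_squares_bound[of q r] sum_squares_bound[of q s] sum_squares_bound[of r s]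
    by (simp add: power2_eq_square algebra_simps)
  finally show ?thesis .
qed

lemma moments_le:
  assumes h: "L2_fun T h" and T: "T > 0"
  shows "(norm (LINT s|lborel. h s))\<^sup>2 \<le> T * (LINT s|lborel. (norm (h s))\<^sup>2)"
    "(norm (LINT s|lborel. s *\<^sub>R h s))\<^sup>2 \<le> T^3 * (LINT s|lborel. (norm (h s))\<^sup>2)"
proof -
  define I where "I = (LINT s|lborel. norm (h s))"
  define J where "J = (LINT s|lborel. (norm (h s))\<^sup>2)"
  have IJ: "I\<^sup>2 \<le> T * J" unfolding I_def J_def by (rule L2_fun_Cauchy_Schwarz[OF h T])
  have "(norm (LINT s|lborel. h s))\<^sup>2 \<le> I\<^sup>2" unfolding I_def by (intro power_mono) auto
  then show "(norm (LINT s|lborel. h s))\<^sup>2 \<le> T * (LINT s|lborel. (norm (h s))\<^sup>2)" using IJ by (simp add: J_def)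
  have "norm (LINT s|lborel. s *\<^sub>R h s) \<le> T * I"
    unfolding I_def by (rule L2_fun_mult_integrable(2)[OF h]) (use T in auto)
  then have "(norm (LINT s|lborel. s *\<^sub>R h s))\<^sup>2 \<le> (T * I)\<^sup>2" by (intro power_mono) auto
  also have "\<dots> \<le> T\<^sup>2 * (T * J)" using IJ by (simp add: power_mult_distrib mult_left_mono)
  finally show "(norm (LINT s|lborel. s *\<^sub>R h s))\<^sup>2 \<le> T^3 * (LINT s|lborel. (norm (h s))\<^sup>2)"
    by (simp add: J_def power2_eq_square power3_eq_cube)
qed

text \<open>Changing the end point keeps \<open>h\<close> and shifts the other data by the moments
  \<open>M0\<close> and \<open>M1\<close>, which Cauchy-Schwarz bounds. The constant must not depend
  on the function, hence the quantifiers inside the conclusion.\<close>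

lemma H2_rep_back_imp_rep:
  assumes T: "T > 0"
  obtains C where "C \<ge> 0" "\<And>(y :: real \<Rightarrow> complex^'n) a b h. H2_rep_back T y a b h \<Longrightarrow>
    \<exists>a' b'. H2_rep T y a' b' h \<and> rep_size a' b' h \<le> C * rep_size a b h"
proof (rule that[of "4 * (1 + T\<^sup>2 + T^3) + 2 + 2 * T + 1"])
  show "0 \<le> 4 * (1 + T\<^sup>2 + T^3) + 2 + 2 * T + 1" using T by simp
  fix y :: "real \<Rightarrow> complex^'n" and a b h
  assume rep: "H2_rep_back T y a b h"
  then have h: "L2_fun T h" by (simp add: H2_rep_back_def)
  define M0 where "M0 = (LINT s|lborel. h s)"
  define M1 where "M1 = (LINT s|lborel. s *\<^sub>R h s)"
  define S where "S = rep_size a b h"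
  define J where "J = (LINT s|lborel. (norm (h s))\<^sup>2)"
  have "H2_rep T y (a + T *\<^sub>R b + M1) (- b - M0) h"
    using rep unfolding H2_rep_def H2_rep_back_def
    by (auto simp: back2_eq_prim2[OF h] M0_def M1_def algebra_simps)
  moreover have "rep_size (a + T *\<^sub>R b + M1) (- b - M0) h \<le> (4 * (1 + T\<^sup>2 + T^3) + 2 + 2 * T + 1) * S"
  proof -
    have m: "(norm M0)\<^sup>2 \<le> T * J" "(norm M1)\<^sup>2 \<le> T^3 * J"
      unfolding M0_def M1_def J_def by (rule moments_le[OF h T])+
    have bd: "(norm a)\<^sup>2 \<le> S" "(norm b)\<^sup>2 \<le> S" "J \<le> S"
      unfolding S_def J_def by (rule rep_size_bounds)+
    have TJ: "T * J \<le> T * S" "T^3 * J \<le> T^3 * S" "T\<^sup>2 * (norm b)\<^sup>2 \<le> T\<^sup>2 * S" using bd T by auto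
    have "(norm (a + T *\<^sub>R b + M1))\<^sup>2 \<le> 4 * ((norm a)\<^sup>2 + (T * norm b)\<^sup>2 + (norm M1)\<^sup>2 + 0\<^sup>2)"
    proof (rule square_triangle4)
      show "norm (a + T *\<^sub>R b + M1) \<le> norm a + T * norm b + norm M1 + 0"
        using norm_triangle_ineq[of "a + T *\<^sub>R b" M1] norm_triangle_ineq[of a "T *\<^sub>R b"] T by simp
    qed simp
    then have A: "(norm (a + T *\<^sub>R b + M1))\<^sup>2 \<le> 4 * (S + T\<^sup>2 * S + T^3 * S)"
      unfolding power_mult_distrib using m(2) TJ bd(1) by simp
    have "(norm (- b - M0))\<^sup>2 \<le> 2 * (norm b)\<^sup>2 + 2 * (norm M0)\<^sup>2"
      using norm_add_square_le[of "-b" "-M0"] by simp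
    then have B: "(norm (- b - M0))\<^sup>2 \<le> 2 * S + 2 * (T * S)"
      using m(1) TJ(1) bd(2) by simp
    have "rep_size (a + T *\<^sub>R b + M1) (- b - M0) h \<le> 4 * (S + T\<^sup>2 * S + T^3 * S) + (2 * S + 2 * (T * S)) + S"
      unfolding rep_size_def J_def[symmetric] by (intro add_mono A B bd)
    then show ?thesis by (simp add: algebra_simps)
  qed
  ultimately show "\<exists>a' b'. H2_rep T y a' b' h \<and> rep_size a' b' h \<le> (4 * (1 + T\<^sup>2 + T^3) + 2 + 2 * T + 1) * rep_size a b h"
    unfolding S_def by blast
qed

lemma H2_rep_imp_rep_back:
  assumes T: "T > 0"
  obtains C where "C \<ge> 0" "\<And>(y :: real \<Rightarrow> complex^'n) a b h. H2_rep T y a b h \<Longrightarrow>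
    \<exists>a' b'. H2_rep_back T y a' b' h \<and> rep_size a' b' h \<le> C * rep_size a b h"
proof (rule that[of "4 * (1 + T^3 + T\<^sup>2 + T^3) + 2 + 2 * T + 1"])
  show "0 \<le> 4 * (1 + T^3 + T\<^sup>2 + T^3) + 2 + 2 * T + 1" using T by simp
  fix y :: "real \<Rightarrow> complex^'n" and a b h
  assume rep: "H2_rep T y a b h"
  then have h: "L2_fun T h" by (simp add: H2_rep_def)
  define M0 where "M0 = (LINT s|lborel. h s)"
  define M1 where "M1 = (LINT s|lborel. s *\<^sub>R h s)"
  define S where "S = rep_size a b h"
  define J where "J = (LINT s|lborel. (norm (h s))\<^sup>2)"
  let ?a = "a - M1 + T *\<^sub>R (b + M0)"
  have eq: "a + x *\<^sub>R b + prim2 h x = ?a + (T - x) *\<^sub>R (- b - M0) + back2 h x" for x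
    unfolding back2_eq_prim2[OF h] M0_def[symmetric] M1_def[symmetric] by (simp add: algebra_simps)
  have "H2_rep_back T y ?a (- b - M0) h"
    using rep unfolding H2_rep_def H2_rep_back_def eq by blast
  moreover have "rep_size ?a (- b - M0) h \<le> (4 * (1 + T^3 + T\<^sup>2 + T^3) + 2 + 2 * T + 1) * S"
  proof -
    have m: "(norm M0)\<^sup>2 \<le> T * J" "(norm M1)\<^sup>2 \<le> T^3 * J"
      unfolding M0_def M1_def J_def by (rule moments_le[OF h T])+
    have bd: "(norm a)\<^sup>2 \<le> S" "(norm b)\<^sup>2 \<le> S" "J \<le> S"
      unfolding S_def J_def by (rule rep_size_bounds)+
    have TJ: "T * J \<le> T * S" "T^3 * J \<le> T^3 * S" "T\<^sup>2 * (norm b)\<^sup>2 \<le> T\<^sup>2 * S" using bd T by auto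
    have "T\<^sup>2 * (norm M0)\<^sup>2 \<le> T\<^sup>2 * (T * J)" using m(1) by (intro mult_left_mono) auto
    also have "\<dots> = T^3 * J" by (simp add: power2_eq_square power3_eq_cube)
    finally have m0: "T\<^sup>2 * (norm M0)\<^sup>2 \<le> T^3 * S" using TJ by linarith
    have "(norm ?a)\<^sup>2 \<le> 4 * ((norm a)\<^sup>2 + (norm M1)\<^sup>2 + (T * norm b)\<^sup>2 + (T * norm M0)\<^sup>2)"
    proof (rule square_triangle4)
      have "?a = (a - M1) + (T *\<^sub>R b + T *\<^sub>R M0)" by (simp add: algebra_simps)
      then show "norm ?a \<le> norm a + norm M1 + T * norm b + T * norm M0"
        using norm_triangle_ineq[of "a - M1" "T *\<^sub>R b + T *\<^sub>R M0"] norm_triangle_ineq4[of a M1]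
          norm_triangle_ineq[of "T *\<^sub>R b" "T *\<^sub>R M0"] T by simp
    qed simp
    then have A: "(norm ?a)\<^sup>2 \<le> 4 * (S + T^3 * S + T\<^sup>2 * S + T^3 * S)"
      by (rule order_trans, intro mult_left_mono add_mono)
         (use m(2) TJ bd(1) m0 in \<open>auto simp: power_mult_distrib intro: order_trans\<close>)
    have "(norm (- b - M0))\<^sup>2 \<le> 2 * (norm b)\<^sup>2 + 2 * (norm M0)\<^sup>2"
      using norm_add_square_le[of "-b" "-M0"] by simp
    then have B: "(norm (- b - M0))\<^sup>2 \<le> 2 * S + 2 * (T * S)"
      using m(1) TJ(1) bd(2) by simp
    have "rep_size ?a (- b - M0) h \<le> 4 * (S + T^3 * S + T\<^sup>2 * S + T^3 * S) + (2 * S + 2 * (T * S)) + S"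
      unfolding rep_size_def J_def[symmetric] by (intro add_mono A B bd)
    then show ?thesis by (simp add: algebra_simps)
  qed
  ultimately show "\<exists>a' b'. H2_rep_back T y a' b' h \<and> rep_size a' b' h \<le> (4 * (1 + T^3 + T\<^sup>2 + T^3) + 2 + 2 * T + 1) * rep_size a b h"
    unfolding S_def by blast
qed

lemma H2_rep_back_bound:
  assumes T: "T > 0"
  obtains C where "C \<ge> 0" "\<And>(y :: real \<Rightarrow> complex^'n) a b h. H2_rep_back T y a b h \<Longrightarrow>
    y \<in> H2 T \<and> (H2_norm T y)\<^sup>2 \<le> C * rep_size a b h"
proof -
  obtain C1 where C1: "C1 \<ge> 0" "\<And>(y :: real \<Rightarrow> complex^'n) a b h. H2_rep_back T y a b h \<Longrightarrow>
    \<exists>a' b'. H2_rep T y a' b' h \<and> rep_size a' b' h \<le> C1 * rep_size a b h"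
    using H2_rep_back_imp_rep[OF T] by blast
  obtain C2 where C2: "C2 \<ge> 0" "\<And>(y :: real \<Rightarrow> complex^'n) a b h. H2_rep T y a b h \<Longrightarrow> (H2_norm T y)\<^sup>2 \<le> C2 * rep_size a b h"
    using H2_norm_le_rep_size[OF T] by blast
  show thesis
  proof (rule that[of "C2 * C1"])
    fix y :: "real \<Rightarrow> complex^'n" and a b h assume "H2_rep_back T y a b h"
    then obtain a' b' where r: "H2_rep T y a' b' h" "rep_size a' b' h \<le> C1 * rep_size a b h"
      using C1(2) by blast
    then show "y \<in> H2 T \<and> (H2_norm T y)\<^sup>2 \<le> C2 * C1 * rep_size a b h"
      using H2_rep_imp(1)[OF T r(1)] C2(2)[OF r(1)] mult_left_mono[OF r(2) C2(1)] by (simp add: mult.assoc)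
  qed (use C1 C2 in simp)
qed

lemma H2_obtain_rep_back:
  assumes T: "T > 0"
  obtains C where "C \<ge> 0" "\<And>y :: real \<Rightarrow> complex^'n. y \<in> H2 T \<Longrightarrow>
    \<exists>a b h. H2_rep_back T y a b h \<and> rep_size a b h \<le> C * (H2_norm T y)\<^sup>2"
proof -
  obtain C1 where C1: "C1 \<ge> 0" "\<And>(y :: real \<Rightarrow> complex^'n) a b h. H2_rep T y a b h \<Longrightarrow>
    \<exists>a' b'. H2_rep_back T y a' b' h \<and> rep_size a' b' h \<le> C1 * rep_size a b h"
    using H2_rep_imp_rep_back[OF T] by blast
  obtain C2 where C2: "C2 \<ge> 0" "\<And>(y :: real \<Rightarrow> complex^'n) a b h. H2_rep T y a b h \<Longrightarrow> rep_size a b h \<le> C2 * (H2_norm T y)\<^sup>2"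
    using rep_size_le_H2_norm[OF T] by blast
  show thesis
  proof (rule that[of "C1 * C2"])
    fix y :: "real \<Rightarrow> complex^'n" assume "y \<in> H2 T"
    then obtain a b h where r: "H2_rep T y a b h" by (rule H2_imp_rep[OF T])
    obtain a' b' where r': "H2_rep_back T y a' b' h" "rep_size a' b' h \<le> C1 * rep_size a b h"
      using C1(2)[OF r] by blast
    have "rep_size a' b' h \<le> C1 * C2 * (H2_norm T y)\<^sup>2"
      using r'(2) mult_left_mono[OF C2(2)[OF r] C1(1)] by (simp add: mult.assoc)
    then show "\<exists>a b h. H2_rep_back T y a b h \<and> rep_size a b h \<le> C1 * C2 * (H2_norm T y)\<^sup>2"
      using r'(1) by blast
  qed (use C1 C2 in simp)
qed

section \<open>Volterra operators with a bounded kernel\<close>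

lemma bounded_bilinear_matrix_vector_mult:
  "bounded_bilinear (\<lambda>(A :: complex^'n^'m) x. A *v x)"
  unfolding bilinear_conv_bounded_bilinear[symmetric]
  by (auto intro!: linearI simp: bilinear_def matrix_vector_mult_def vec_eq_iff sum.distrib algebra_simps scaleR_sum_right)

lemma bounded_bilinear_matrix_matrix_mult:
  "bounded_bilinear (\<lambda>(A :: complex^'n^'m) (B :: complex^'k^'n). A ** B)"
  unfolding bilinear_conv_bounded_bilinear[symmetric]
  by (auto intro!: linearI simp: bilinear_def matrix_matrix_mult_def vec_eq_iff sum.distrib algebra_simps scaleR_sum_right)

lemma borel_measurable_matrix_vector_mult [measurable]:
  fixes f :: "'a \<Rightarrow> complex^'n^'m"
  assumes "f \<in> borel_measurable M" "g \<in> borel_measurable M"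
  shows "(\<lambda>x. f x *v g x) \<in> borel_measurable M"
  by (rule borel_measurable_continuous_Pair[OF assms])
     (intro bounded_bilinear.continuous_on[OF bounded_bilinear_matrix_vector_mult] continuous_intros)

lemma borel_measurable_matrix_matrix_mult [measurable]:
  fixes f :: "'a \<Rightarrow> complex^'n^'m" and g :: "'a \<Rightarrow> complex^'k^'n"
  assumes "f \<in> borel_measurable M" "g \<in> borel_measurable M"
  shows "(\<lambda>x. f x ** g x) \<in> borel_measurable M"
  by (rule borel_measurable_continuous_Pair[OF assms])
     (intro bounded_bilinear.continuous_on[OF bounded_bilinear_matrix_matrix_mult] continuous_intros)

lemma norm_matrix_vector_mult_bound:
  obtains c where "c > 0" "\<And>(A :: complex^'n^'m) x. norm (A *v x) \<le> norm A * norm x * c"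
  using bounded_bilinear.pos_bounded[OF bounded_bilinear_matrix_vector_mult] by blast

lemma norm_matrix_matrix_mult_bound:
  obtains c where "c > 0" "\<And>(A :: complex^'n^'m) (B :: complex^'k^'n). norm (A ** B) \<le> norm A * norm B * c"
  using bounded_bilinear.pos_bounded[OF bounded_bilinear_matrix_matrix_mult] by blast

text \<open>The kernel is extended by zero off the triangle, so that Volterra integrals become
  integrals over the line. The extension may jump across the diagonal; therefore continuity in
  \<open>x\<close> is demanded only for \<open>s \<noteq> x\<close>, and the excluded point is a
  null set for dominated convergence.\<close>

locale volterra_kernel =
  fixes T :: real and W :: "real \<Rightarrow> real \<Rightarrow> complex^'n^'n" and B :: real
  assumes T: "T > 0"
    and W_measurable: "(\<lambda>z. W (fst z) (snd z)) \<in> borel_measurable (borel \<Otimes>\<^sub>M borel)"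
    and W_bound: "norm (W x s) \<le> B"
    and W_outside: "\<not> (0 \<le> x \<and> x \<le> s \<and> s \<le> T) \<Longrightarrow> W x s = 0"
    and W_tendsto: "x \<in> {0..T} \<Longrightarrow> s \<noteq> x \<Longrightarrow> ((\<lambda>x. W x s) \<longlongrightarrow> W x s) (at x within {0..T})"
begin

lemma B_nonneg: "0 \<le> B"
  using W_bound norm_ge_zero order_trans by blast

lemma W_measurable' [measurable (raw)]:
  assumes "f \<in> borel_measurable M" "g \<in> borel_measurable M"
  shows "(\<lambda>x. W (f x) (g x)) \<in> borel_measurable M"
proof -
  have "(\<lambda>x. (f x, g x)) \<in> M \<rightarrow>\<^sub>M borel \<Otimes>\<^sub>M borel" using assms by measurable
  from measurable_compose[OF this W_measurable] show ?thesis by simp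
qed

lemma W_mult_integrable:
  fixes h :: "real \<Rightarrow> complex^'n"
  assumes h: "integrable lborel h"
  shows "integrable lborel (\<lambda>s. W x s *v h s)"
proof -
  obtain c where c: "c > 0" "\<And>(A :: complex^'n^'n) x. norm (A *v x) \<le> norm A * norm x * c"
    using norm_matrix_vector_mult_bound by blast
  have [measurable]: "h \<in> borel_measurable borel" using borel_measurable_integrable[OF h] by simp
  show ?thesis
  proof (rule integrable_norm_le)
    show "integrable lborel (\<lambda>s. B * c * norm (h s))" using h by (intro integrable_mult_right integrable_norm)
    fix s
    have "norm (W x s *v h s) \<le> norm (W x s) * norm (h s) * c" by (rule c)
    also have "\<dots> \<le> B * norm (h s) * c" using c(1) W_bound by (intro mult_right_mono) auto
    finally show "norm (W x s *v h s) \<le> B * c * norm (h s)" by (simp add: mult_ac)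
  qed measurable
qed

lemma W_mult_bound:
  obtains c where "c \<ge> 0" "\<And>x s (z :: complex^'n). norm (W x s *v z) \<le> c * norm z"
proof -
  obtain c where c: "c > 0" "\<And>(A :: complex^'n^'n) x. norm (A *v x) \<le> norm A * norm x * c"
    using norm_matrix_vector_mult_bound by blast
  have pw: "norm (W x s *v z) \<le> (B * c) * norm z" for x s z
  proof -
    have "norm (W x s *v z) \<le> norm (W x s) * norm z * c" by (rule c)
    also have "\<dots> \<le> B * norm z * c" using c(1) W_bound by (intro mult_right_mono) auto
    finally show ?thesis by (simp add: mult_ac)
  qed
  show thesis
    by (rule that[of "B * c"]) (use B_nonneg c pw in auto)
qed

lemma W_int_bound:
  obtains c where "c \<ge> 0" "\<And>x (h :: real \<Rightarrow> complex^'n). integrable lborel h \<Longrightarrow> norm (LINT s|lborel. W x s *v h s) \<le> c * (LINT s|lborel. norm (h s))"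
proof -
  obtain c where c: "c \<ge> 0" "\<And>x s (z :: complex^'n). norm (W x s *v z) \<le> c * norm z" by (rule W_mult_bound) (rule that)
  show thesis
  proof (rule that[OF c(1)])
    fix x and h :: "real \<Rightarrow> complex^'n" assume h: "integrable lborel h"
    have "norm (LINT s|lborel. W x s *v h s) \<le> (LINT s|lborel. c * norm (h s))"
      by (rule Bochner_Integration.integral_norm_bound_integral[OF W_mult_integrable[OF h] _ c(2)])
         (use h in \<open>intro integrable_mult_right integrable_norm\<close>)
    then show "norm (LINT s|lborel. W x s *v h s) \<le> c * (LINT s|lborel. norm (h s))" by simp
  qed
qed

lemma continuous_on_W_int:
  fixes h :: "real \<Rightarrow> complex^'n"
  assumes h: "integrable lborel h"
  shows "continuous_on {0..T} (\<lambda>x. LINT s|lborel. W x s *v h s)"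
  unfolding continuous_on_sequentially o_def
proof (intro ballI allI impI, elim conjE)
  fix X x assume x: "x \<in> {0..T}" and X: "\<forall>n::nat. X n \<in> {0..T}" and lim: "X \<longlonglongrightarrow> x"
  obtain c where c: "c \<ge> 0" "\<And>x s (z :: complex^'n). norm (W x s *v z) \<le> c * norm z" by (rule W_mult_bound) (rule that)
  have [measurable]: "h \<in> borel_measurable borel" using borel_measurable_integrable[OF h] by simp
  show "(\<lambda>n. LINT s|lborel. W (X n) s *v h s) \<longlonglongrightarrow> (LINT s|lborel. W x s *v h s)"
  proof (rule integral_dominated_convergence[where w="\<lambda>s. c * norm (h s)"])
    show "integrable lborel (\<lambda>s. c * norm (h s))" using h by (intro integrable_mult_right integrable_norm)
    show "AE s in lborel. (\<lambda>n. W (X n) s *v h s) \<longlonglongrightarrow> W x s *v h s"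
    proof -
      have "AE s in lborel. s \<noteq> x" by (rule AE_lborel_singleton)
      then show ?thesis
      proof eventually_elim
        case (elim s)
        have "isCont_W": "((\<lambda>x. W x s) \<longlongrightarrow> W x s) (at x within {0..T})" by (rule W_tendsto[OF x]) (use elim in auto)
        then have "continuous (at x within {0..T}) (\<lambda>x. W x s)" by (simp add: continuous_within)
        then have "(\<lambda>n. W (X n) s) \<longlonglongrightarrow> W x s"
          using X lim continuous_within_sequentially[of x "{0..T}" "\<lambda>x. W x s"] by (auto simp: o_def)
        then show ?case
          by (intro bounded_bilinear.tendsto[OF bounded_bilinear_matrix_vector_mult] tendsto_const)
      qed
    qed
  qed (use c in auto)
qed

text \<open>Banach's fixed point theorem in an exponentially weighted supremum norm, where the
  Volterra operator has norm at most 1/2. The weight is moved into the unknown,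
  \<open>\<kappa> x = exp (- L * (T - x)) u x\<close>, so that the unweighted metric of bounded
  continuous functions can be used.\<close>

lemma volterra_solvable:
  fixes r :: "real \<Rightarrow> complex^'n"
  assumes r: "continuous_on {0..T} r"
  obtains u where "u \<in> borel_measurable borel" "continuous_on {0..T} u" "\<And>x. x \<notin> {0..T} \<Longrightarrow> u x = 0"
    "\<And>x. x \<in> {0..T} \<Longrightarrow> u x + (LINT s|lborel. W x s *v u s) = r x"
proof -
  obtain c where c: "c \<ge> 0" "\<And>x s (z :: complex^'n). norm (W x s *v z) \<le> c * norm z" by (rule W_mult_bound) (rule that)
  define k where "k s = c * indicator {0..T} s" for s :: real
  have km: "k \<in> borel_measurable borel" unfolding k_def by measurable
  have k2: "integrable lborel (\<lambda>s. (k s)\<^sup>2)"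
  proof -
    have "(\<lambda>s. (k s)\<^sup>2) = (\<lambda>s. c\<^sup>2 * indicator {0..T} s)" by (auto simp: k_def indicator_def)
    then show ?thesis using integrable_indicator_Icc[of 0 T] by simp
  qed
  have k0: "0 \<le> k s" for s using c by (simp add: k_def)
  obtain L where L: "L > 0"
    "\<And>x. integrable lborel (\<lambda>s. indicator {x..} s * (k s * exp (- L * (s - x))))"
    "\<And>x. (LINT s|lborel. indicator {x..} s * (k s * exp (- L * (s - x)))) \<le> 1 / 2"
    using exp_weight_kernel_le_half[OF km k2 k0] by blast
  \<comment> \<open>The complete metric space consists of functions on the whole line; clamping the
    argument extends a continuous function from \<open>[0,T]\<close> to it.\<close>
  define cl where "cl x = max 0 (min T x)" for x :: real
  have cl: "cl x \<in> {0..T}" for x using T by (auto simp: cl_def)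
  have cl_id: "cl x = x" if "x \<in> {0..T}" for x using that by (auto simp: cl_def)
  have cl_cont: "continuous_on UNIV cl" unfolding cl_def by (intro continuous_intros)
  \<comment> \<open>The equation for the rescaled unknown: the weights
    \<open>exp (- L * (T - x))\<close> and \<open>exp (L * (T - s))\<close> combine to
    \<open>exp (L * x)\<close> and \<open>exp (- L * s)\<close>.\<close>
  define G where "G \<kappa> x = exp (- L * (T - x)) *\<^sub>R r x -
     exp (L * x) *\<^sub>R (LINT s|lborel. W x s *v (indicator {0..T} s *\<^sub>R exp (- L * s) *\<^sub>R \<kappa> s))" for \<kappa> :: "real \<Rightarrow> complex^'n" and x
  have hint: "integrable lborel (\<lambda>s. indicator {0..T} s *\<^sub>R exp (- L * s) *\<^sub>R \<kappa> s)" if "continuous_on UNIV \<kappa>" for \<kappa> :: "real \<Rightarrow> complex^'n"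
  proof -
    have "continuous_on {0..T} (\<lambda>s. exp (- L * s) *\<^sub>R \<kappa> s)"
      using that by (intro continuous_intros) (auto intro: continuous_on_subset)
    then have "set_integrable lborel {0..T} (\<lambda>s. exp (- L * s) *\<^sub>R \<kappa> s)"
      by (rule borel_integrable_atLeastAtMost')
    then show ?thesis by (simp add: set_integrable_def)
  qed
  have Gcont: "continuous_on {0..T} (G \<kappa>)" if "continuous_on UNIV \<kappa>" for \<kappa>
    unfolding G_def by (intro continuous_intros r continuous_on_W_int hint that)
  have Gcl: "(\<lambda>x. G \<kappa> (cl x)) \<in> bcontfun" if "continuous_on UNIV \<kappa>" for \<kappa>
  proof -
    have "bounded (G \<kappa> ` {0..T})"
      by (intro compact_imp_bounded compact_continuous_image Gcont that) auto
    then obtain M where "\<And>x. x \<in> {0..T} \<Longrightarrow> norm (G \<kappa> x) \<le> M" unfolding bounded_iff by blast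
    then have "norm (G \<kappa> (cl x)) \<le> M" for x using cl by blast
    moreover have "continuous_on UNIV (\<lambda>x. G \<kappa> (cl x))"
      by (rule continuous_on_compose2[OF Gcont[OF that] cl_cont]) (use cl in auto)
    ultimately show ?thesis by (intro bcontfun_normI)
  qed
  define F where "F \<phi> = Bcontfun (\<lambda>x. G (apply_bcontfun \<phi>) (cl x))" for \<phi> :: "real \<Rightarrow>\<^sub>C (complex^'n)"
  have ac: "continuous_on UNIV (apply_bcontfun \<phi>)" for \<phi> :: "real \<Rightarrow>\<^sub>C (complex^'n)" by (rule continuous_on_apply_bcontfun) 
  have F: "apply_bcontfun (F \<phi>) x = G (apply_bcontfun \<phi>) (cl x)" for \<phi> x
    unfolding F_def using Bcontfun_inverse[OF Gcl[OF ac]] by simp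
  have contr: "dist (F \<phi>) (F \<psi>) \<le> 1 / 2 * dist \<phi> \<psi>" for \<phi> \<psi>
  proof (rule dist_bound)
    fix x0
    define x where "x = cl x0"
    define d where "d = dist \<phi> \<psi>"
    have d0: "0 \<le> d" by (simp add: d_def)
    let ?e = "\<lambda>\<kappa> s. indicator {0..T} s *\<^sub>R exp (- L * s) *\<^sub>R apply_bcontfun \<kappa> s"
    have "G (apply_bcontfun \<phi>) x - G (apply_bcontfun \<psi>) x = 
       exp (L * x) *\<^sub>R ((LINT s|lborel. W x s *v ?e \<psi> s) - (LINT s|lborel. W x s *v ?e \<phi> s))"
      by (simp add: G_def scaleR_diff_right)
    also have "(LINT s|lborel. W x s *v ?e \<psi> s) - (LINT s|lborel. W x s *v ?e \<phi> s) = (LINT s|lborel. W x s *v ?e \<psi> s - W x s *v ?e \<phi> s)"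
      by (rule Bochner_Integration.integral_diff[OF W_mult_integrable[OF hint[OF ac]] W_mult_integrable[OF hint[OF ac]], symmetric])
    finally have 1: "G (apply_bcontfun \<phi>) x - G (apply_bcontfun \<psi>) x = exp (L * x) *\<^sub>R (LINT s|lborel. W x s *v ?e \<psi> s - W x s *v ?e \<phi> s)" .
    have 2: "norm (LINT s|lborel. W x s *v ?e \<psi> s - W x s *v ?e \<phi> s) \<le> (LINT s|lborel. d * exp (- L * x) * (indicator {x..} s * (k s * exp (- L * (s - x)))))"
    proof (rule Bochner_Integration.integral_norm_bound_integral)
      show "integrable lborel (\<lambda>s. W x s *v ?e \<psi> s - W x s *v ?e \<phi> s)"
        by (rule Bochner_Integration.integrable_diff[OF W_mult_integrable[OF hint[OF ac]] W_mult_integrable[OF hint[OF ac]]])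
      show "integrable lborel (\<lambda>s. d * exp (- L * x) * (indicator {x..} s * (k s * exp (- L * (s - x)))))"
        by (rule integrable_mult_right[OF L(2)])
      fix s
      show "norm (W x s *v ?e \<psi> s - W x s *v ?e \<phi> s) \<le> d * exp (- L * x) * (indicator {x..} s * (k s * exp (- L * (s - x))))"
      proof (cases "x \<le> s \<and> s \<in> {0..T}")
        case True
        have "W x s *v ?e \<psi> s - W x s *v ?e \<phi> s = W x s *v (exp (- L * s) *\<^sub>R (apply_bcontfun \<psi> s - apply_bcontfun \<phi> s))"
          using True by (simp add: bounded_bilinear.diff_right[OF bounded_bilinear_matrix_vector_mult, symmetric] scaleR_diff_right)
        also have "norm \<dots> \<le> c * norm (exp (- L * s) *\<^sub>R (apply_bcontfun \<psi> s - apply_bcontfun \<phi> s))" by (rule c)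
        also have "\<dots> \<le> c * (exp (- L * s) * d)"
          using c(1) dist_bounded[of \<phi> s \<psi>] by (intro mult_left_mono) (auto simp: dist_norm d_def norm_minus_commute)
        also have "\<dots> = d * exp (- L * x) * (c * exp (- L * (s - x)))"
          by (simp add: exp_add[symmetric] algebra_simps)
        finally show ?thesis using True by (simp add: k_def)
      next
        case False
        have "W x s *v ?e \<kappa> s = 0" for \<kappa> using False W_outside[of x s] cl[of x0] by (auto simp: x_def)
        then show ?thesis using c d0 by (simp add: k_def)
      qed
    qed
    have 3: "(LINT s|lborel. d * exp (- L * x) * (indicator {x..} s * (k s * exp (- L * (s - x))))) \<le> d * exp (- L * x) * (1 / 2)"
      unfolding Bochner_Integration.integral_mult_right_zero by (rule mult_left_mono[OF L(3)]) (use d0 in simp)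
    have "norm (G (apply_bcontfun \<phi>) x - G (apply_bcontfun \<psi>) x) \<le> exp (L * x) * (d * exp (- L * x) * (1 / 2))"
      unfolding 1 using order_trans[OF 2 3] by simp
    also have "\<dots> = 1 / 2 * d" by (simp add: exp_minus)
    finally show "dist (apply_bcontfun (F \<phi>) x0) (apply_bcontfun (F \<psi>) x0) \<le> 1 / 2 * dist \<phi> \<psi>"
      unfolding F dist_norm x_def[symmetric] d_def .
  qed
  obtain \<phi> where \<phi>: "F \<phi> = \<phi>" using banach_fix_type[of "1/2" F] contr by auto
  have fix_eq: "apply_bcontfun \<phi> x = G (apply_bcontfun \<phi>) x" if "x \<in> {0..T}" for x
    using F[of \<phi> x] \<phi> cl_id[OF that] by simp
  define u where "u x = indicator {0..T} x *\<^sub>R exp (L * (T - x)) *\<^sub>R apply_bcontfun \<phi> x" for x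
  show thesis
  proof (rule that[of u])
    show "u \<in> borel_measurable borel" unfolding u_def[abs_def]
      by (intro borel_measurable_continuous_on_indicator) (auto intro!: continuous_intros continuous_on_subset[OF ac])
    have "continuous_on {0..T} (\<lambda>x. exp (L * (T - x)) *\<^sub>R apply_bcontfun \<phi> x)"
      by (intro continuous_intros continuous_on_subset[OF ac]) auto
    then show "continuous_on {0..T} u" by (rule continuous_on_eq) (simp add: u_def)
    show "u x = 0" if "x \<notin> {0..T}" for x using that by (simp add: u_def)
    fix x assume x: "x \<in> {0..T}"
    have e1: "u s = exp (L * T) *\<^sub>R (indicator {0..T} s *\<^sub>R exp (- L * s) *\<^sub>R apply_bcontfun \<phi> s)" for s
      by (simp add: u_def exp_add[symmetric] algebra_simps)
    have "(LINT s|lborel. W x s *v u s) = exp (L * T) *\<^sub>R (LINT s|lborel. W x s *v (indicator {0..T} s *\<^sub>R exp (- L * s) *\<^sub>R apply_bcontfun \<phi> s))"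
      unfolding e1 bounded_bilinear.scaleR_right[OF bounded_bilinear_matrix_vector_mult] by (rule Bochner_Integration.integral_scaleR_right)
    moreover have "u x = exp (L * (T - x)) *\<^sub>R G (apply_bcontfun \<phi>) x" using x fix_eq[OF x] by (simp add: u_def)
    ultimately show "u x + (LINT s|lborel. W x s *v u s) = r x"
      by (simp add: G_def scaleR_diff_right exp_add[symmetric] algebra_simps)
  qed
qed

end

section \<open>Fubini's theorem for dominated and scalar kernels\<close>

lemma (in pair_sigma_finite) integrable_pair_bound:
  fixes f :: "'a \<times> 'b \<Rightarrow> 'c::{banach, second_countable_topology}" and \<alpha> :: "'a \<Rightarrow> real" and \<beta> :: "'b \<Rightarrow> real"
  assumes f: "f \<in> borel_measurable (M1 \<Otimes>\<^sub>M M2)" and \<alpha>: "integrable M1 \<alpha>" and \<beta>: "integrable M2 \<beta>"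
    and le: "\<And>x y. norm (f (x, y)) \<le> \<alpha> x * \<beta> y"
  shows "integrable (M1 \<Otimes>\<^sub>M M2) f"
proof (rule Fubini_integrable[OF f])
  have i: "integrable M2 (\<lambda>y. f (x, y))" if "x \<in> space M1" for x
  proof (rule integrable_norm_le[OF integrable_mult_right[OF \<beta>] _ le])
    have "(\<lambda>y. (x, y)) \<in> M2 \<rightarrow>\<^sub>M M1 \<Otimes>\<^sub>M M2" using that by measurable
    from measurable_compose[OF this f] show "(\<lambda>y. f (x, y)) \<in> borel_measurable M2" .
  qed
  then show "AE x in M1. integrable M2 (\<lambda>y. f (x, y))" by simp
  show "integrable M1 (\<lambda>x. LINT y|M2. norm (f (x, y)))"
  proof (rule Bochner_Integration.integrable_bound)
    show "integrable M1 (\<lambda>x. (LINT y|M2. \<beta> y) * \<alpha> x)" using \<alpha> by (rule integrable_mult_right)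
    show "(\<lambda>x. LINT y|M2. norm (f (x, y))) \<in> borel_measurable M1" using f by measurable
    show "AE x in M1. norm (LINT y|M2. norm (f (x, y))) \<le> norm ((LINT y|M2. \<beta> y) * \<alpha> x)"
    proof (rule AE_I2)
      fix x assume x: "x \<in> space M1"
      have "(LINT y|M2. norm (f (x, y))) \<le> (LINT y|M2. \<alpha> x * \<beta> y)"
        by (rule integral_mono[OF integrable_norm[OF i[OF x]] integrable_mult_right[OF \<beta>] le])
      moreover have "(LINT y|M2. \<alpha> x * \<beta> y) = (LINT y|M2. \<beta> y) * \<alpha> x" by simp
      moreover have "0 \<le> (LINT y|M2. norm (f (x, y)))" by simp
      ultimately show "norm (LINT y|M2. norm (f (x, y))) \<le> norm ((LINT y|M2. \<beta> y) * \<alpha> x)"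
        by (simp only: real_norm_def)
    qed
  qed
qed

text \<open>The measure \<open>M\<close> is left general because Duhamel's formula has two parts: an
  integral over the line, for the source on the diagonal, and one over the plane, for the source in
  the interior.\<close>

lemma (in sigma_finite_measure) Fubini_scalar_kernel:
  fixes G :: "'a \<Rightarrow> 'b::{banach, second_countable_topology}" and h :: "real \<Rightarrow> 'a \<Rightarrow> real"
  assumes G: "integrable M G" and h[measurable]: "(\<lambda>(t, z). h t z) \<in> borel_measurable (borel \<Otimes>\<^sub>M M)"
    and bound: "\<And>t z. \<bar>h t z\<bar> \<le> C" and supp: "\<And>t z. t \<notin> {a..b} \<Longrightarrow> h t z = 0"
  shows "(LINT t|lborel. (LINT z|M. h t z *\<^sub>R G z)) = (LINT z|M. (LINT t|lborel. h t z) *\<^sub>R G z)"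
    and "integrable lborel (\<lambda>t. LINT z|M. h t z *\<^sub>R G z)"
    and "integrable M (\<lambda>z. (LINT t|lborel. h t z) *\<^sub>R G z)"
proof -
  interpret P: pair_sigma_finite lborel M ..
  note [measurable] = borel_measurable_integrable[OF G]
  have int: "integrable (lborel \<Otimes>\<^sub>M M) (\<lambda>(t, z). h t z *\<^sub>R G z)"
  proof (rule P.integrable_pair_bound)
    show "(\<lambda>(t, z). h t z *\<^sub>R G z) \<in> borel_measurable (lborel \<Otimes>\<^sub>M M)" by measurable
    show "integrable lborel (\<lambda>t. indicator {a..b} t :: real)" by (rule integrable_indicator_Icc)
    show "integrable M (\<lambda>z. C * norm (G z))" using G by auto
    fix t z show "norm (case (t, z) of (t, z) \<Rightarrow> h t z *\<^sub>R G z) \<le> indicator {a..b} t * (C * norm (G z))"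
      using supp[of t z] bound[of t z] by (cases "t \<in> {a..b}") (auto intro: mult_right_mono)
  qed
  have sw: "(LINT t|lborel. h t z *\<^sub>R G z) = (LINT t|lborel. h t z) *\<^sub>R G z" if z: "z \<in> space M" for z
  proof -
    have "integrable lborel (\<lambda>t. h t z)"
    proof (rule integrable_norm_le)
      show "integrable lborel (\<lambda>t. C * indicator {a..b} t)" using integrable_indicator_Icc by (rule integrable_mult_right)
      have "(\<lambda>t. (t, z)) \<in> borel \<rightarrow>\<^sub>M borel \<Otimes>\<^sub>M M" using z by measurable
      from measurable_compose[OF this h] show "(\<lambda>t. h t z) \<in> borel_measurable lborel" by simp
      fix t show "norm (h t z) \<le> C * indicator {a..b} t" using bound[of t z] supp[of t z] by (cases "t \<in> {a..b}") auto
    qed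
    then show ?thesis by (rule integral_scaleR_left)
  qed
  have "(LINT t|lborel. (LINT z|M. h t z *\<^sub>R G z)) = (LINT z|M. (LINT t|lborel. h t z *\<^sub>R G z))"
    using P.Fubini_integral[OF int] by simp
  also have "\<dots> = (LINT z|M. (LINT t|lborel. h t z) *\<^sub>R G z)"
    by (intro Bochner_Integration.integral_cong refl sw)
  finally show "(LINT t|lborel. (LINT z|M. h t z *\<^sub>R G z)) = (LINT z|M. (LINT t|lborel. h t z) *\<^sub>R G z)" .
  show "integrable lborel (\<lambda>t. LINT z|M. h t z *\<^sub>R G z)" using P.integrable_fst[OF int] by simp
  have "integrable M (\<lambda>z. LINT t|lborel. h t z *\<^sub>R G z)" using P.integrable_snd[OF int] by simp
  then show "integrable M (\<lambda>z. (LINT t|lborel. h t z) *\<^sub>R G z)"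
    by (rule Bochner_Integration.integrable_cong[THEN iffD1, rotated -1]) (auto simp: sw)
qed

section \<open>Duhamel's formula for the kernel\<close>

lemma integral_max_power2_aux:
  fixes x u :: real
  shows "(LINT s|lborel. (s - x) * indicator {x..u} s) = (max 0 (u - x))\<^sup>2 / 2"
proof (cases "x \<le> u")
  case True
  have "(LINT s|lborel. (s - x) * indicator {x..u} s) = (u - x)\<^sup>2 / 2 - (x - x)\<^sup>2 / 2"
    by (rule integral_FTC_Icc_real[OF True]) (auto intro!: derivative_eq_intros)
  then show ?thesis using True by simp
next
  case False
  then have "(s - x) * indicator {x..u} s = 0" for s by simp
  then show ?thesis using False by simp
qed

text \<open>Both versions are needed since \<open>cone_diff\<close> subtracts a strict condition
  from a weak one; they differ at the single point \<open>s = u\<close>.\<close>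

lemma integral_left_ramp:
  fixes x \<sigma> u :: real
  shows "(LINT s|lborel. indicator {x..\<sigma>} s * (s - x) * (if s \<le> u then 1 else 0)) = (max 0 (min u \<sigma> - x))\<^sup>2 / 2"
    and "(LINT s|lborel. indicator {x..\<sigma>} s * (s - x) * (if s < u then 1 else 0)) = (max 0 (min u \<sigma> - x))\<^sup>2 / 2"
proof -
  have "indicator {x..\<sigma>} s * (s - x) * (if s \<le> u then 1 else 0) = (s - x) * indicator {x..min u \<sigma>} s" for s
    by (auto simp: indicator_def)
  then show *: "(LINT s|lborel. indicator {x..\<sigma>} s * (s - x) * (if s \<le> u then 1 else 0)) = (max 0 (min u \<sigma> - x))\<^sup>2 / 2"
    by (simp only: integral_max_power2_aux)
  have "(LINT s|lborel. indicator {x..\<sigma>} s * (s - x) * (if s < u then 1 else 0)) = (LINT s|lborel. indicator {x..\<sigma>} s * (s - x) * (if s \<le> u then 1 else 0))"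
  proof (rule integral_cong_AE)
    show "AE s in lborel. indicator {x..\<sigma>} s * (s - x) * (if s < u then 1 else 0) = indicator {x..\<sigma>} s * (s - x) * (if s \<le> u then 1 else 0)"
      using AE_lborel_singleton[of u] by eventually_elim auto
  qed measurable
  then show "(LINT s|lborel. indicator {x..\<sigma>} s * (s - x) * (if s < u then 1 else 0)) = (max 0 (min u \<sigma> - x))\<^sup>2 / 2"
    using * by simp
qed

text \<open>Reflection of \<open>s\<close> at 0 reduces this to the left ramp.\<close>

lemma integral_right_ramp:
  fixes x \<sigma> d :: real
  shows "(LINT s|lborel. indicator {x..\<sigma>} s * (\<sigma> - s) * (if d \<le> s then 1 else 0)) = (max 0 (\<sigma> - max x d))\<^sup>2 / 2"
    and "(LINT s|lborel. indicator {x..\<sigma>} s * (\<sigma> - s) * (if d < s then 1 else 0)) = (max 0 (\<sigma> - max x d))\<^sup>2 / 2"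
proof -
  have refl: "(LINT s|lborel. f s) = (LINT s|lborel. f (- s))" for f :: "real \<Rightarrow> real"
    using lborel_integral_real_affine[of "-1" f 0] by simp
  have 1: "indicator {x..\<sigma>} (-s) * (\<sigma> - (- s)) * (if d \<le> - s then 1 else 0) = indicator {-\<sigma>..-x} s * (s - (-\<sigma>)) * (if s \<le> - d then 1 else (0::real))" for s
    by (auto simp: indicator_def)
  have 2: "indicator {x..\<sigma>} (-s) * (\<sigma> - (- s)) * (if d < - s then 1 else 0) = indicator {-\<sigma>..-x} s * (s - (-\<sigma>)) * (if s < - d then 1 else (0::real))" for s
    by (auto simp: indicator_def)
  have 3: "min (- d) (- x) - - \<sigma> = \<sigma> - max x d" by auto
  show "(LINT s|lborel. indicator {x..\<sigma>} s * (\<sigma> - s) * (if d \<le> s then 1 else 0)) = (max 0 (\<sigma> - max x d))\<^sup>2 / 2"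
    by (subst refl) (simp only: 1 integral_left_ramp 3)
  show "(LINT s|lborel. indicator {x..\<sigma>} s * (\<sigma> - s) * (if d < s then 1 else 0)) = (max 0 (\<sigma> - max x d))\<^sup>2 / 2"
    by (subst refl) (simp only: 2 integral_left_ramp 3)
qed

lemma integral_step:
  fixes x \<sigma> d :: real
  shows "(LINT s|lborel. indicator {x..\<sigma>} s * (if d \<le> s then 1 else 0)) = max 0 (\<sigma> - max x d)"
    and "(LINT s|lborel. indicator {x..\<sigma>} s * (if d < s then 1 else 0)) = max 0 (\<sigma> - max x d)"
proof -
  have "indicator {x..\<sigma>} s * (if d \<le> s then 1 else (0::real)) = indicator {max x d..\<sigma>} s" for s
    by (auto simp: indicator_def)
  then show *: "(LINT s|lborel. indicator {x..\<sigma>} s * (if d \<le> s then 1 else 0)) = max 0 (\<sigma> - max x d)"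
    by (simp add: max_def)
  have "(LINT s|lborel. indicator {x..\<sigma>} s * (if d < s then 1 else 0)) = (LINT s|lborel. indicator {x..\<sigma>} s * (if d \<le> s then 1 else (0::real)))"
  proof (rule integral_cong_AE)
    show "AE s in lborel. indicator {x..\<sigma>} s * (if d < s then 1 else 0) = indicator {x..\<sigma>} s * (if d \<le> s then 1 else (0::real))"
      using AE_lborel_singleton[of d] by eventually_elim auto
  qed measurable
  then show "(LINT s|lborel. indicator {x..\<sigma>} s * (if d < s then 1 else 0)) = max 0 (\<sigma> - max x d)"
    using * by simp
qed

text \<open>The difference of the indicators of the backward light cones of \<open>(x, t)\<close> and of its mirror image
  \<open>(- x, t)\<close>: with it the integral equation of the kernel becomes Duhamel's formula on the half line.\<close>

definition cone_diff :: "real \<Rightarrow> real \<Rightarrow> real \<Rightarrow> real \<Rightarrow> real" where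
  "cone_diff x t y c = (if \<bar>x - y\<bar> + c \<le> t then 1 else 0) - (if x + y + c < t then 1 else 0)"

lemma cone_bound: "\<bar>cone_diff x t y c\<bar> \<le> 1"
  by (simp add: cone_diff_def)

lemma borel_measurable_cone_diff [measurable (raw)]:
  assumes [measurable]: "f \<in> borel_measurable M" "g \<in> borel_measurable M" "h \<in> borel_measurable M" "k \<in> borel_measurable M"
  shows "(\<lambda>z. cone_diff (f z) (g z) (h z) (k z)) \<in> borel_measurable M"
  unfolding cone_diff_def by measurable

text \<open>Half of \<open>cone_diff\<close> is the Green function of the wave operator on the half
  line with zero boundary value at 0. Its equation with a point source at \<open>(y, c)\<close> is
  integrated twice in time from the past, with weight \<open>\<sigma> - t\<close>, and twice in
  space from the right, with weight \<open>t - x\<close>; the point source turns into the product of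
  ramps. The factor is -2 since \<open>cone_diff\<close> is twice the Green function.\<close>

lemma integral_cone_ramp:
  assumes x: "0 \<le> x" "x \<le> \<sigma>" and y: "0 \<le> y" "y \<le> c"
  shows "(LINT t|lborel. indicator {x..\<sigma>} t * ((\<sigma> - t) * cone_diff x t y c - (t - x) * cone_diff t \<sigma> y c)) = - 2 * (max 0 (y - x) * max 0 (\<sigma> - c))"
proof -
  have bi: "integrable lborel (\<lambda>t. indicator {x..\<sigma>} t * (\<sigma> - t) * (if P t then 1 else 0))"
    "integrable lborel (\<lambda>t. indicator {x..\<sigma>} t * (t - x) * (if P t then 1 else 0))"
    if [measurable]: "Measurable.pred borel P" for P :: "real \<Rightarrow> bool"
  proof -
    have i: "integrable lborel (\<lambda>t. (\<sigma> - x) * indicator {x..\<sigma>} t)" by (rule integrable_mult_right[OF integrable_indicator_Icc])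
    show "integrable lborel (\<lambda>t. indicator {x..\<sigma>} t * (\<sigma> - t) * (if P t then 1 else 0))"
      by (rule integrable_norm_le[OF i]) (use x in \<open>auto simp: indicator_def\<close>)
    show "integrable lborel (\<lambda>t. indicator {x..\<sigma>} t * (t - x) * (if P t then 1 else 0))"
      by (rule integrable_norm_le[OF i]) (use x in \<open>auto simp: indicator_def\<close>)
  qed
  define m where "m = \<sigma> - c"
  have m\<sigma>: "m \<le> \<sigma>" using y by (simp add: m_def)
  let ?R = "\<lambda>P t. indicator {x..\<sigma>} t * (\<sigma> - t) * (if P t then 1 else (0::real))"
  let ?L = "\<lambda>P t. indicator {x..\<sigma>} t * (t - x) * (if P t then 1 else (0::real))"
  have eq: "indicator {x..\<sigma>} t * ((\<sigma> - t) * cone_diff x t y c - (t - x) * cone_diff t \<sigma> y c)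
     = ?R (\<lambda>t. \<bar>x - y\<bar> + c \<le> t) t - ?R (\<lambda>t. x + y + c < t) t - (?L (\<lambda>t. \<bar>t - y\<bar> \<le> m) t - ?L (\<lambda>t. t < m - y) t)" for t
    by (auto simp: cone_diff_def m_def algebra_simps indicator_def)
  have "(LINT t|lborel. indicator {x..\<sigma>} t * ((\<sigma> - t) * cone_diff x t y c - (t - x) * cone_diff t \<sigma> y c))
    = (LINT t|lborel. ?R (\<lambda>t. \<bar>x - y\<bar> + c \<le> t) t) - (LINT t|lborel. ?R (\<lambda>t. x + y + c < t) t)
     - ((LINT t|lborel. ?L (\<lambda>t. \<bar>t - y\<bar> \<le> m) t) - (LINT t|lborel. ?L (\<lambda>t. t < m - y) t))"
    unfolding eq by (subst Bochner_Integration.integral_diff Bochner_Integration.integral_diff;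
        (intro Bochner_Integration.integrable_diff bi; measurable)?)+ simp
  \<comment> \<open>The section of the direct cone is the interval \<open>[y - m, y + m]\<close>: a
    closed half line minus an open one for \<open>m \<ge> 0\<close>, and empty for
    \<open>m < 0\<close>.\<close>
  also have "(LINT t|lborel. ?L (\<lambda>t. \<bar>t - y\<bar> \<le> m) t) = (if m \<ge> 0 then (max 0 (y + m - x))\<^sup>2 / 2 - (max 0 (y - m - x))\<^sup>2 / 2 else 0)"
  proof (cases "m \<ge> 0")
    case True
    have "?L (\<lambda>t. \<bar>t - y\<bar> \<le> m) t = ?L (\<lambda>t. t \<le> y + m) t - ?L (\<lambda>t. t < y - m) t" for t
      using True by (auto simp: indicator_def)
    moreover have "min (y + m) \<sigma> = y + m" "min (y - m) \<sigma> = y - m" using True y by (auto simp: m_def)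
    moreover have "integrable lborel (?L (\<lambda>t. t \<le> y + m))" "integrable lborel (?L (\<lambda>t. t < y - m))"
      by (rule bi(2); measurable)+
    ultimately show ?thesis
      using True by (simp only: Bochner_Integration.integral_diff integral_left_ramp) simp
  next
    case False
    then have "?L (\<lambda>t. \<bar>t - y\<bar> \<le> m) t = 0" for t by auto
    then have "(LINT t|lborel. ?L (\<lambda>t. \<bar>t - y\<bar> \<le> m) t) = 0" by (simp only: Bochner_Integration.integral_zero)
    then show ?thesis using False by simp
  qed
  also have "(LINT t|lborel. ?L (\<lambda>t. t < m - y) t) = (max 0 (m - y - x))\<^sup>2 / 2"
  proof -
    have "min (m - y) \<sigma> = m - y" using y m\<sigma> by simp
    then show ?thesis by (simp only: integral_left_ramp)
  qed
  also have "(LINT t|lborel. ?R (\<lambda>t. \<bar>x - y\<bar> + c \<le> t) t) = (max 0 (m - \<bar>y - x\<bar>))\<^sup>2 / 2"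
  proof -
    have "\<sigma> - max x (\<bar>x - y\<bar> + c) = m - \<bar>y - x\<bar>" using y by (auto simp: m_def)
    then show ?thesis by (simp only: integral_right_ramp)
  qed
  also have "(LINT t|lborel. ?R (\<lambda>t. x + y + c < t) t) = (max 0 (m - y - x))\<^sup>2 / 2"
  proof -
    have "\<sigma> - max x (x + y + c) = m - y - x" using y by (auto simp: m_def)
    then show ?thesis by (simp only: integral_right_ramp)
  qed
  \<comment> \<open>The two mirror terms cancel; what remains is an identity of piecewise quadratic
    functions, checked case by case.\<close>
  also have "(max 0 (m - \<bar>y - x\<bar>))\<^sup>2 / 2 - (max 0 (m - y - x))\<^sup>2 / 2 -
     ((if m \<ge> 0 then (max 0 (y + m - x))\<^sup>2 / 2 - (max 0 (y - m - x))\<^sup>2 / 2 else 0) - (max 0 (m - y - x))\<^sup>2 / 2)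
     = - 2 * (max 0 (y - x) * max 0 m)"
    by (auto simp: max_def abs_if power2_eq_square algebra_simps)
  finally show ?thesis unfolding m_def .
qed

text \<open>With \<open>d = T - c \<ge> 0\<close> and \<open>z = y - x\<close> the direct cone has
  length \<open>max 0 (d - \<bar>z\<bar>)\<close>, which equals
  \<open>max 0 (z + d) + max 0 (z - d) - 2 * max 0 z\<close>. In this form every term is a ramp
  \<open>max 0 (p - x)\<close>, as in a second primitive taken from the right. The last ramp
  produces the potential term, the others produce \<open>c0\<close> and \<open>D\<close>.\<close>

lemma integral_cone:
  assumes x: "0 \<le> x" "x \<le> T" and y: "0 \<le> y" "y \<le> c" "c \<le> T"
  shows "(LINT t|lborel. indicator {x..T} t * cone_diff x t y c) =
    max 0 (y + T - c - x) + max 0 (y + c - T - x) - max 0 (T - c - x - y) - 2 * max 0 (y - x)"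
proof -
  have bi: "integrable lborel (\<lambda>t. indicator {x..T} t * (if P t then 1 else (0::real)))"
    if [measurable]: "Measurable.pred borel P" for P :: "real \<Rightarrow> bool"
    by (rule integrable_norm_le[OF integrable_indicator_Icc[of x T]]) (auto simp: indicator_def)
  have eq: "indicator {x..T} t * cone_diff x t y c =
    indicator {x..T} t * (if \<bar>x - y\<bar> + c \<le> t then 1 else 0) - indicator {x..T} t * (if x + y + c < t then 1 else 0)" for t
    by (simp add: cone_diff_def algebra_simps)
  have "(LINT t|lborel. indicator {x..T} t * cone_diff x t y c) =
    (LINT t|lborel. indicator {x..T} t * (if \<bar>x - y\<bar> + c \<le> t then 1 else 0)) - (LINT t|lborel. indicator {x..T} t * (if x + y + c < t then 1 else 0))"
    unfolding eq by (rule Bochner_Integration.integral_diff; rule bi; measurable)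
  also have "\<dots> = max 0 (T - max x (\<bar>x - y\<bar> + c)) - max 0 (T - max x (x + y + c))"
    by (simp only: integral_step)
  also have "\<dots> = max 0 (y + T - c - x) + max 0 (y + c - T - x) - max 0 (T - c - x - y) - 2 * max 0 (y - x)"
    using x y by (auto simp: max_def abs_if)
  finally show ?thesis .
qed

text \<open>In \<open>W_eq\<close> the single integral is the effect of the potential on the
  incident pulse, which travels along the diagonal, and the double integral its effect on the
  scattered wave \<open>W\<close>. \<open>Q\<close> is a Borel representative of the
  potential.\<close>

locale wave_kernel = volterra_kernel T W B
  for T :: real and W :: "real \<Rightarrow> real \<Rightarrow> complex^'n^'n" and B :: real +
  fixes Q :: "real \<Rightarrow> complex^'n^'n"
  assumes Q: "L2_fun T Q"
    and W_eq: "0 \<le> x \<Longrightarrow> x \<le> t \<Longrightarrow> t \<le> T \<Longrightarrow>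
      W x t = - (1/2) *\<^sub>R ((LINT y|lborel. cone_diff x t y y *\<^sub>R Q y) +
        (LINT z|(lborel \<Otimes>\<^sub>M lborel). cone_diff x t (fst z) (snd z) *\<^sub>R (Q (fst z) ** W (fst z) (snd z))))"
begin

lemma Q_measurable [measurable]: "Q \<in> borel_measurable borel"
  by (rule L2_funD(1)[OF Q])

lemma Q_outside: "x \<notin> {0..T} \<Longrightarrow> Q x = 0"
  by (rule L2_funD(3)[OF Q])

lemma Q_integrable: "integrable lborel Q"
  by (rule L2_fun_integrable[OF Q])

lemma matrix_zero_left: "(0 :: complex^'n^'n) ** A = 0"
  by (rule bounded_bilinear.zero_left[OF bounded_bilinear_matrix_matrix_mult])

lemma matrix_zero_right: "(A :: complex^'n^'n) ** 0 = 0"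
  by (rule bounded_bilinear.zero_right[OF bounded_bilinear_matrix_matrix_mult])

definition QW :: "real \<times> real \<Rightarrow> complex^'n^'n" where
  "QW z = Q (fst z) ** W (fst z) (snd z)"

lemma QW_measurable [measurable]: "QW \<in> borel_measurable (borel \<Otimes>\<^sub>M borel)"
  unfolding QW_def by measurable

lemma QW_outside: "\<not> (0 \<le> y \<and> y \<le> c \<and> c \<le> T) \<Longrightarrow> QW (y, c) = 0"
  using W_outside[of y c] by (simp add: QW_def matrix_zero_right)

lemma QW_bound:
  obtains C where "C \<ge> 0" "\<And>y x s. norm (Q y ** W x s) \<le> C * norm (Q y)"
proof -
  obtain c where c: "c > 0" "\<And>(A :: complex^'n^'n) (B :: complex^'n^'n). norm (A ** B) \<le> norm A * norm B * c"
    using norm_matrix_matrix_mult_bound by blast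
  show thesis
  proof (rule that[of "B * c"])
    show "0 \<le> B * c" using c B_nonneg by simp
    fix y x s
    have "norm (Q y ** W x s) \<le> norm (Q y) * norm (W x s) * c" by (rule c)
    also have "\<dots> \<le> norm (Q y) * B * c" using c W_bound by (intro mult_right_mono mult_left_mono) auto
    finally show "norm (Q y ** W x s) \<le> B * c * norm (Q y)" by (simp add: mult_ac)
  qed
qed

lemma QW_integrable: "integrable (lborel \<Otimes>\<^sub>M lborel) QW"
proof -
  obtain C where C: "C \<ge> 0" "\<And>y x s. norm (Q y ** W x s) \<le> C * norm (Q y)" by (rule QW_bound) (rule that)
  show ?thesis
  proof (rule lborel_pair.integrable_pair_bound)
    show "integrable lborel (\<lambda>y. C * norm (Q y))" using Q_integrable by (intro integrable_mult_right integrable_norm)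
    show "integrable lborel (\<lambda>c. indicator {0..T} c :: real)" by (rule integrable_indicator_Icc)
    fix y c show "norm (QW (y, c)) \<le> C * norm (Q y) * indicator {0..T} c"
      using C(2)[of y y c] QW_outside[of y c] by (cases "0 \<le> y \<and> y \<le> c \<and> c \<le> T") (auto simp: QW_def C(1))
  qed measurable
qed

text \<open>Integration of \<open>h\<close> against \<open>Q\<close> times the full wave, that is, a
  unit mass on the diagonal plus \<open>W\<close>. As a linear functional of \<open>h\<close> it
  transfers identities between scalar kernels, such as \<open>integral_cone_ramp\<close>, to the
  matrix kernel.\<close>

definition duhamel :: "(real \<Rightarrow> real \<Rightarrow> real) \<Rightarrow> complex^'n^'n" where
  "duhamel h = (LINT y|lborel. h y y *\<^sub>R Q y) + (LINT z|(lborel \<Otimes>\<^sub>M lborel). h (fst z) (snd z) *\<^sub>R QW z)"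

lemma W_eq_duhamel: "0 \<le> x \<Longrightarrow> x \<le> t \<Longrightarrow> t \<le> T \<Longrightarrow> W x t = - (1/2) *\<^sub>R duhamel (cone_diff x t)"
  using W_eq by (simp add: duhamel_def QW_def)

lemma duhamel_cong:
  assumes "\<And>y c. 0 \<le> y \<Longrightarrow> y \<le> c \<Longrightarrow> c \<le> T \<Longrightarrow> h y c = h' y c"
  shows "duhamel h = duhamel h'"
proof -
  have "h y y *\<^sub>R Q y = h' y y *\<^sub>R Q y" for y
    using assms[of y y] Q_outside[of y] by (cases "y \<in> {0..T}") auto
  moreover have "h (fst z) (snd z) *\<^sub>R QW z = h' (fst z) (snd z) *\<^sub>R QW z" for z
    using assms[of "fst z" "snd z"] QW_outside[of "fst z" "snd z"]
    by (cases "0 \<le> fst z \<and> fst z \<le> snd z \<and> snd z \<le> T") auto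
  ultimately show ?thesis unfolding duhamel_def by (simp only:)
qed

text \<open>The bound is asked only on the triangle that carries \<open>Q\<close> and
  \<open>W\<close>, since ramps are unbounded on the plane.\<close>

definition bounded_kernel :: "(real \<Rightarrow> real \<Rightarrow> real) \<Rightarrow> bool" where
  "bounded_kernel h \<longleftrightarrow> (\<lambda>z. h (fst z) (snd z)) \<in> borel_measurable (borel \<Otimes>\<^sub>M borel) \<and>
     (\<exists>C. \<forall>y c. 0 \<le> y \<longrightarrow> y \<le> c \<longrightarrow> c \<le> T \<longrightarrow> \<bar>h y c\<bar> \<le> C)"

lemma bounded_kernel_diag_measurable:
  assumes "bounded_kernel h"
  shows "(\<lambda>y. h y y) \<in> borel_measurable borel"
proof -
  have "(\<lambda>y::real. (y, y)) \<in> borel \<rightarrow>\<^sub>M borel \<Otimes>\<^sub>M borel" by measurable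
  from measurable_compose[OF this, of "\<lambda>z. h (fst z) (snd z)"] assms show ?thesis by (simp add: bounded_kernel_def)
qed

lemma bounded_kernel_integrable:
  assumes h: "bounded_kernel h"
  shows "integrable lborel (\<lambda>y. h y y *\<^sub>R Q y)"
    "integrable (lborel \<Otimes>\<^sub>M lborel) (\<lambda>z. h (fst z) (snd z) *\<^sub>R QW z)"
proof -
  obtain C where C: "\<And>y c. 0 \<le> y \<Longrightarrow> y \<le> c \<Longrightarrow> c \<le> T \<Longrightarrow> \<bar>h y c\<bar> \<le> C" using h unfolding bounded_kernel_def by blast
  have hm: "(\<lambda>z. h (fst z) (snd z)) \<in> borel_measurable (borel \<Otimes>\<^sub>M borel)" using h by (simp add: bounded_kernel_def)
  show "integrable lborel (\<lambda>y. h y y *\<^sub>R Q y)"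
    by (rule L2_fun_mult_integrable(1)[OF Q bounded_kernel_diag_measurable[OF h], of C]) (use C in auto)
  show "integrable (lborel \<Otimes>\<^sub>M lborel) (\<lambda>z. h (fst z) (snd z) *\<^sub>R QW z)"
  proof (rule integrable_norm_le)
    show "integrable (lborel \<Otimes>\<^sub>M lborel) (\<lambda>z. C * norm (QW z))" using QW_integrable by (intro integrable_mult_right integrable_norm)
    show "(\<lambda>z. h (fst z) (snd z) *\<^sub>R QW z) \<in> borel_measurable (lborel \<Otimes>\<^sub>M lborel)" using hm by measurable
    fix z show "norm (h (fst z) (snd z) *\<^sub>R QW z) \<le> C * norm (QW z)"
      using C[of "fst z" "snd z"] QW_outside[of "fst z" "snd z"]
      by (cases "0 \<le> fst z \<and> fst z \<le> snd z \<and> snd z \<le> T") (auto intro: mult_right_mono)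
  qed
qed

lemma duhamel_diff_scale:
  assumes h: "bounded_kernel h" and k: "bounded_kernel k"
  shows "a *\<^sub>R duhamel h - b *\<^sub>R duhamel k = duhamel (\<lambda>y c. a * h y c - b * k y c)"
proof -
  note i = bounded_kernel_integrable[OF h] bounded_kernel_integrable[OF k]
  have 1: "(LINT y|lborel. (a * h y y - b * k y y) *\<^sub>R Q y) = a *\<^sub>R (LINT y|lborel. h y y *\<^sub>R Q y) - b *\<^sub>R (LINT y|lborel. k y y *\<^sub>R Q y)"
    unfolding scaleR_diff_left scaleR_scaleR[symmetric]
    by (simp only: Bochner_Integration.integral_diff[OF integrable_scaleR_right[OF i(1)] integrable_scaleR_right[OF i(3)]]
        Bochner_Integration.integral_scaleR_right)
  have 2: "(LINT z|(lborel \<Otimes>\<^sub>M lborel). (a * h (fst z) (snd z) - b * k (fst z) (snd z)) *\<^sub>R QW z)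
    = a *\<^sub>R (LINT z|(lborel \<Otimes>\<^sub>M lborel). h (fst z) (snd z) *\<^sub>R QW z) - b *\<^sub>R (LINT z|(lborel \<Otimes>\<^sub>M lborel). k (fst z) (snd z) *\<^sub>R QW z)"
    unfolding scaleR_diff_left scaleR_scaleR[symmetric]
    by (simp only: Bochner_Integration.integral_diff[OF integrable_scaleR_right[OF i(2)] integrable_scaleR_right[OF i(4)]]
        Bochner_Integration.integral_scaleR_right)
  show ?thesis unfolding duhamel_def 1 2 by (simp add: scaleR_add_right)
qed

lemma bounded_kernel_cone: "bounded_kernel (cone_diff x t)"
  unfolding bounded_kernel_def using cone_bound by (auto intro!: exI[of _ 1])

lemma sigma_finite_lborel_pair: "sigma_finite_measure (lborel \<Otimes>\<^sub>M lborel :: (real \<times> real) measure)"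
  unfolding lborel_prod by (rule sigma_finite_lborel)

lemma duhamel_integral:
  fixes h :: "real \<Rightarrow> real \<Rightarrow> real \<Rightarrow> real"
  assumes h: "(\<lambda>z. h (fst z) (fst (snd z)) (snd (snd z))) \<in> borel_measurable (borel \<Otimes>\<^sub>M (borel \<Otimes>\<^sub>M borel))"
    and bound: "\<And>t y c. \<bar>h t y c\<bar> \<le> C" and supp: "\<And>t y c. t \<notin> {a..b} \<Longrightarrow> h t y c = 0"
  shows "(LINT t|lborel. duhamel (h t)) = duhamel (\<lambda>y c. LINT t|lborel. h t y c)" "integrable lborel (\<lambda>t. duhamel (h t))"
proof -
  have m1: "(\<lambda>(t, y). h t y y) \<in> borel_measurable (borel \<Otimes>\<^sub>M lborel)"
  proof -
    have "(\<lambda>z::real \<times> real. (fst z, snd z, snd z)) \<in> borel \<Otimes>\<^sub>M lborel \<rightarrow>\<^sub>M borel \<Otimes>\<^sub>M (borel \<Otimes>\<^sub>M borel)" by measurable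
    from measurable_compose[OF this h] show ?thesis by (simp add: split_def)
  qed
  have m2: "(\<lambda>(t, z). h t (fst z) (snd z)) \<in> borel_measurable (borel \<Otimes>\<^sub>M (lborel \<Otimes>\<^sub>M lborel))"
    using h by (simp add: split_def cong: measurable_cong_sets sets_pair_measure_cong)
  note F1 = lborel.Fubini_scalar_kernel[where h="\<lambda>t y. h t y y", OF Q_integrable m1 bound supp]
  note F2 = sigma_finite_measure.Fubini_scalar_kernel[OF sigma_finite_lborel_pair QW_integrable m2, of C a b, OF bound supp]
  have "(LINT t|lborel. duhamel (h t)) = (LINT t|lborel. LINT y|lborel. h t y y *\<^sub>R Q y) +
      (LINT t|lborel. LINT z|(lborel \<Otimes>\<^sub>M lborel). h t (fst z) (snd z) *\<^sub>R QW z)"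
    unfolding duhamel_def by (rule Bochner_Integration.integral_add[OF F1(2) F2(2)])
  moreover have "(LINT t|lborel. LINT y|lborel. h t y y *\<^sub>R Q y) = (LINT y|lborel. (LINT t|lborel. h t y y) *\<^sub>R Q y)"
    by (rule F1(1))
  moreover have "(LINT t|lborel. LINT z|(lborel \<Otimes>\<^sub>M lborel). h t (fst z) (snd z) *\<^sub>R QW z) =
      (LINT z|(lborel \<Otimes>\<^sub>M lborel). (LINT t|lborel. h t (fst z) (snd z)) *\<^sub>R QW z)"
    by (rule F2(1))
  ultimately show "(LINT t|lborel. duhamel (h t)) = duhamel (\<lambda>y c. LINT t|lborel. h t y c)"
    unfolding duhamel_def by (simp only:)
  show "integrable lborel (\<lambda>t. duhamel (h t))"
    unfolding duhamel_def by (rule Bochner_Integration.integrable_add[OF F1(2) F2(2)])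
qed

lemma bounded_kernel_W_integrable:
  assumes h: "bounded_kernel h" and s: "s \<in> {0..T}"
  shows "integrable lborel (\<lambda>c. h s c *\<^sub>R W s c)"
proof -
  obtain C where C: "\<And>y c. 0 \<le> y \<Longrightarrow> y \<le> c \<Longrightarrow> c \<le> T \<Longrightarrow> \<bar>h y c\<bar> \<le> C" using h unfolding bounded_kernel_def by blast
  have hm: "(\<lambda>z. h (fst z) (snd z)) \<in> borel_measurable (borel \<Otimes>\<^sub>M borel)" using h by (simp add: bounded_kernel_def)
  have "(\<lambda>c::real. (s, c)) \<in> borel \<rightarrow>\<^sub>M borel \<Otimes>\<^sub>M borel" by measurable
  from measurable_compose[OF this hm] have [measurable]: "(\<lambda>c. h s c) \<in> borel_measurable borel" by simp
  have C0: "0 \<le> C" using C[of s s] s by fastforce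
  show ?thesis
  proof (rule integrable_norm_le)
    show "integrable lborel (\<lambda>c. C * B * indicator {0..T} c)" using integrable_indicator_Icc by (rule integrable_mult_right)
    fix c show "norm (h s c *\<^sub>R W s c) \<le> C * B * indicator {0..T} c"
    proof (cases "0 \<le> s \<and> s \<le> c \<and> c \<le> T")
      case True
      then show ?thesis using C[of s c] W_bound[of s c] C0 by (auto intro: mult_mono)
    qed (use W_outside[of s c] C0 B_nonneg in auto)
  qed measurable
qed

lemma integral_QW:
  assumes h: "bounded_kernel h"
  shows "(LINT z|(lborel \<Otimes>\<^sub>M lborel). h (fst z) (snd z) *\<^sub>R QW z) = (LINT s|lborel. Q s ** (LINT c|lborel. h s c *\<^sub>R W s c))"
    and "integrable lborel (\<lambda>s. Q s ** (LINT c|lborel. h s c *\<^sub>R W s c))"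
proof -
  note i = bounded_kernel_integrable[OF h]
  have in1: "(LINT c|lborel. h s c *\<^sub>R QW (s, c)) = Q s ** (LINT c|lborel. h s c *\<^sub>R W s c)" for s
  proof (cases "s \<in> {0..T}")
    case True
    have "bounded_linear (\<lambda>X. Q s ** X)"
      by (rule bounded_bilinear.bounded_linear_right[OF bounded_bilinear_matrix_matrix_mult])
    from integral_bounded_linear[OF this bounded_kernel_W_integrable[OF h True]]
    show ?thesis by (simp add: QW_def bounded_bilinear.scaleR_right[OF bounded_bilinear_matrix_matrix_mult])
  next
    case False
    then show ?thesis by (simp add: QW_def Q_outside matrix_zero_left)
  qed
  show "(LINT z|(lborel \<Otimes>\<^sub>M lborel). h (fst z) (snd z) *\<^sub>R QW z) = (LINT s|lborel. Q s ** (LINT c|lborel. h s c *\<^sub>R W s c))"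
    using lborel_pair.integral_fst'[OF i(2)] by (simp add: in1)
  show "integrable lborel (\<lambda>s. Q s ** (LINT c|lborel. h s c *\<^sub>R W s c))"
    using lborel_pair.integrable_fst'[OF i(2)] by (simp add: in1)
qed

text \<open>Matrix products do not commute, so \<open>Q\<close> is pulled out to the left of the
  inner integral; the unit matrix represents the mass on the diagonal.\<close>

lemma duhamel_eq:
  assumes h: "bounded_kernel h"
  shows "duhamel h = (LINT s|lborel. Q s ** (h s s *\<^sub>R mat 1 + (LINT c|lborel. h s c *\<^sub>R W s c)))"
    and "integrable lborel (\<lambda>s. Q s ** (h s s *\<^sub>R mat 1 + (LINT c|lborel. h s c *\<^sub>R W s c)))"
proof -
  note i = bounded_kernel_integrable(1)[OF h] integral_QW(2)[OF h]
  have eq: "Q s ** (h s s *\<^sub>R mat 1 + (LINT c|lborel. h s c *\<^sub>R W s c)) = h s s *\<^sub>R Q s + Q s ** (LINT c|lborel. h s c *\<^sub>R W s c)" for s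
    by (simp add: bounded_bilinear.add_right[OF bounded_bilinear_matrix_matrix_mult]
        bounded_bilinear.scaleR_right[OF bounded_bilinear_matrix_matrix_mult])
  show "duhamel h = (LINT s|lborel. Q s ** (h s s *\<^sub>R mat 1 + (LINT c|lborel. h s c *\<^sub>R W s c)))"
    unfolding eq duhamel_def integral_QW(1)[OF h] by (rule Bochner_Integration.integral_add[OF i, symmetric])
  show "integrable lborel (\<lambda>s. Q s ** (h s s *\<^sub>R mat 1 + (LINT c|lborel. h s c *\<^sub>R W s c)))"
    unfolding eq by (rule Bochner_Integration.integrable_add[OF i])
qed

text \<open>The response to a ramp instead of a pulse: it has two more derivatives than the kernel, so that the
  wave equation can be stated for it (\<open>W2_wave\<close>) although \<open>Q\<close> is only square integrable.\<close>

definition W2 :: "real \<Rightarrow> real \<Rightarrow> complex^'n^'n" where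
  "W2 x \<sigma> = (LINT c|lborel. max 0 (\<sigma> - c) *\<^sub>R W x c)"

lemma W_scaled_integrable:
  assumes [measurable]: "k \<in> borel_measurable borel" and M: "\<And>c. c \<in> {0..T} \<Longrightarrow> \<bar>k c\<bar> \<le> M"
  shows "integrable lborel (\<lambda>c. k c *\<^sub>R W x c)" "integrable lborel (\<lambda>c. k c *\<^sub>R W c x)"
proof -
  have M0: "0 \<le> M" using M[of 0] T by fastforce
  have i: "integrable lborel (\<lambda>c. M * B * indicator {0..T} c)" using integrable_indicator_Icc by (rule integrable_mult_right)
  show "integrable lborel (\<lambda>c. k c *\<^sub>R W x c)"
  proof (rule integrable_norm_le[OF i])
    fix c show "norm (k c *\<^sub>R W x c) \<le> M * B * indicator {0..T} c"
      using M[of c] W_bound[of x c] W_outside[of x c] M0 by (cases "c \<in> {0..T}") (auto intro: mult_mono)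
  qed measurable
  show "integrable lborel (\<lambda>c. k c *\<^sub>R W c x)"
  proof (rule integrable_norm_le[OF i])
    fix c show "norm (k c *\<^sub>R W c x) \<le> M * B * indicator {0..T} c"
      using M[of c] W_bound[of c x] W_outside[of c x] M0 by (cases "c \<in> {0..T}") (auto intro: mult_mono)
  qed measurable
qed

lemma W2_zero: "\<sigma> \<le> x \<Longrightarrow> W2 x \<sigma> = 0"
proof -
  assume "\<sigma> \<le> x"
  then have "max 0 (\<sigma> - c) *\<^sub>R W x c = 0" for c using W_outside[of x c] by (cases "x \<le> c") auto
  then show ?thesis by (simp only: W2_def Bochner_Integration.integral_zero)
qed

lemma bounded_kernel_ramp:
  assumes "0 \<le> x" "\<sigma> \<le> T"
  shows "bounded_kernel (\<lambda>y c. max 0 (y - x) * max 0 (\<sigma> - c))"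
  unfolding bounded_kernel_def
proof (intro conjI exI allI impI)
  fix y c assume "0 \<le> y" "y \<le> c" "c \<le> T"
  then have "max 0 (y - x) * max 0 (\<sigma> - c) \<le> T * T" using assms by (intro mult_mono) auto
  then show "\<bar>max 0 (y - x) * max 0 (\<sigma> - c)\<bar> \<le> T * T" by (simp add: abs_mult)
qed measurable

text \<open>Both terms on the left are integrals in \<open>t\<close> of Duhamel's formula, with cone
  vertices \<open>(x, t)\<close> and \<open>(t, \<sigma>)\<close>. Fubini moves the integral in
  \<open>t\<close> onto the cones, where \<open>integral_cone_ramp\<close> evaluates it; its factor
  -2 cancels the \<open>- (1/2)\<close> of Duhamel's formula.\<close>

lemma W2_wave_aux:
  assumes x: "0 \<le> x" "x \<le> \<sigma>" "\<sigma> \<le> T"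
  shows "W2 x \<sigma> - (LINT s|lborel. max 0 (s - x) *\<^sub>R W s \<sigma>) = duhamel (\<lambda>y c. max 0 (y - x) * max 0 (\<sigma> - c))"
proof -
  let ?i = "indicator {x..\<sigma>} :: real \<Rightarrow> real"
  let ?h = "\<lambda>t y c. ?i t * ((\<sigma> - t) * cone_diff x t y c - (t - x) * cone_diff t \<sigma> y c)"
  have i1: "integrable lborel (\<lambda>t. (?i t * (\<sigma> - t)) *\<^sub>R W x t)" "integrable lborel (\<lambda>t. (?i t * (t - x)) *\<^sub>R W t \<sigma>)"
    by (rule W_scaled_integrable[of _ "\<sigma> - x"]; use x in \<open>auto simp: indicator_def\<close>)+
  have e1: "max 0 (\<sigma> - t) *\<^sub>R W x t = (?i t * (\<sigma> - t)) *\<^sub>R W x t" for t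
    using W_outside[of x t] by (cases "x \<le> t"; cases "t \<le> \<sigma>") (auto simp: indicator_def)
  have e2: "max 0 (t - x) *\<^sub>R W t \<sigma> = (?i t * (t - x)) *\<^sub>R W t \<sigma>" for t
    using W_outside[of t \<sigma>] by (cases "x \<le> t"; cases "t \<le> \<sigma>") (auto simp: indicator_def)
  have pt: "(?i t * (\<sigma> - t)) *\<^sub>R W x t - (?i t * (t - x)) *\<^sub>R W t \<sigma> = - (1/2) *\<^sub>R duhamel (?h t)" for t
  proof (cases "t \<in> {x..\<sigma>}")
    case True
    then have "W x t = - (1/2) *\<^sub>R duhamel (cone_diff x t)" "W t \<sigma> = - (1/2) *\<^sub>R duhamel (cone_diff t \<sigma>)"
      using x by (intro W_eq_duhamel; simp)+
    then have "(?i t * (\<sigma> - t)) *\<^sub>R W x t - (?i t * (t - x)) *\<^sub>R W t \<sigma> = - (1/2) *\<^sub>R ((\<sigma> - t) *\<^sub>R duhamel (cone_diff x t) - (t - x) *\<^sub>R duhamel (cone_diff t \<sigma>))"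
      using True by (simp only: scaleR_diff_right scaleR_left_commute[of "- (1/2)"]) simp
    also have "(\<sigma> - t) *\<^sub>R duhamel (cone_diff x t) - (t - x) *\<^sub>R duhamel (cone_diff t \<sigma>) = duhamel (\<lambda>y c. (\<sigma> - t) * cone_diff x t y c - (t - x) * cone_diff t \<sigma> y c)"
      by (rule duhamel_diff_scale[OF bounded_kernel_cone bounded_kernel_cone])
    finally show ?thesis using True by simp
  next
    case False
    then have "duhamel (?h t) = 0" by (simp add: duhamel_def)
    then show ?thesis using False by simp
  qed
  have hm: "(\<lambda>z. ?h (fst z) (fst (snd z)) (snd (snd z))) \<in> borel_measurable (borel \<Otimes>\<^sub>M (borel \<Otimes>\<^sub>M borel))"
    by (intro borel_measurable_times borel_measurable_diff borel_measurable_cone_diff) measurable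
  have bnd: "\<bar>?h t y c\<bar> \<le> 2 * (\<sigma> - x)" for t y c
  proof (cases "t \<in> {x..\<sigma>}")
    case True
    have "\<bar>(\<sigma> - t) * cone_diff x t y c\<bar> \<le> (\<sigma> - x) * 1" "\<bar>(t - x) * cone_diff t \<sigma> y c\<bar> \<le> (\<sigma> - x) * 1"
      unfolding abs_mult using True cone_bound by (intro mult_mono; auto)+
    then show ?thesis using True by auto
  qed (use x in simp)
  have "W2 x \<sigma> - (LINT s|lborel. max 0 (s - x) *\<^sub>R W s \<sigma>) = (LINT t|lborel. (?i t * (\<sigma> - t)) *\<^sub>R W x t - (?i t * (t - x)) *\<^sub>R W t \<sigma>)"
    unfolding W2_def e1 e2 by (rule Bochner_Integration.integral_diff[OF i1, symmetric])
  also have "\<dots> = (LINT t|lborel. - (1/2) *\<^sub>R duhamel (?h t))" unfolding pt ..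
  also have "\<dots> = - (1/2) *\<^sub>R (LINT t|lborel. duhamel (?h t))" by (rule Bochner_Integration.integral_scaleR_right)
  also have "(LINT t|lborel. duhamel (?h t)) = duhamel (\<lambda>y c. LINT t|lborel. ?h t y c)"
    by (rule duhamel_integral(1)[OF hm bnd, where a=x and b=\<sigma>]) simp
  \<comment> \<open>The zero subtracted here brings a multiple of one kernel into the form of a
    difference, to which \<open>duhamel_diff_scale\<close> applies.\<close>
  also have "\<dots> = duhamel (\<lambda>y c. - 2 * (max 0 (y - x) * max 0 (\<sigma> - c)) - 0 * 0)"
    by (rule duhamel_cong) (use x integral_cone_ramp in simp)
  also have "\<dots> = - 2 *\<^sub>R duhamel (\<lambda>y c. max 0 (y - x) * max 0 (\<sigma> - c)) - 0 *\<^sub>R duhamel (\<lambda>y c. 0)"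
    by (rule duhamel_diff_scale[OF bounded_kernel_ramp[OF x(1,3)], symmetric]) (auto simp: bounded_kernel_def)
  finally show ?thesis by simp
qed

text \<open>The full response to a ramp: the incident wave, which travels unchanged, plus the
  scattered wave.\<close>

definition V2 :: "real \<Rightarrow> real \<Rightarrow> complex^'n^'n" where
  "V2 s \<sigma> = max 0 (\<sigma> - s) *\<^sub>R mat 1 + W2 s \<sigma>"

text \<open>The twice integrated wave equation of the ramp response, whose second derivative in
  \<open>\<sigma>\<close> is \<open>W\<close>. There is no affine term because \<open>W2\<close>
  vanishes for \<open>\<sigma> \<le> x\<close>.\<close>

lemma W2_wave:
  assumes x: "0 \<le> x" and \<sigma>: "\<sigma> \<le> T"
  shows "W2 x \<sigma> = (LINT s|lborel. max 0 (s - x) *\<^sub>R (Q s ** V2 s \<sigma> + W s \<sigma>))"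
    and "integrable lborel (\<lambda>s. max 0 (s - x) *\<^sub>R (Q s ** V2 s \<sigma>))"
    and "integrable lborel (\<lambda>s. max 0 (s - x) *\<^sub>R W s \<sigma>)"
proof -
  let ?k = "\<lambda>y c. max 0 (y - x) * max 0 (\<sigma> - c)"
  have bk: "bounded_kernel ?k" by (rule bounded_kernel_ramp[OF x \<sigma>])
  have eq: "Q s ** (?k s s *\<^sub>R mat 1 + (LINT c|lborel. ?k s c *\<^sub>R W s c)) = max 0 (s - x) *\<^sub>R (Q s ** V2 s \<sigma>)" for s
    unfolding V2_def W2_def scaleR_scaleR[symmetric] Bochner_Integration.integral_scaleR_right scaleR_add_right[symmetric]
      bounded_bilinear.scaleR_right[OF bounded_bilinear_matrix_matrix_mult] ..
  show i1: "integrable lborel (\<lambda>s. max 0 (s - x) *\<^sub>R (Q s ** V2 s \<sigma>))"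
    using duhamel_eq(2)[OF bk] unfolding eq .
  show i2: "integrable lborel (\<lambda>s. max 0 (s - x) *\<^sub>R W s \<sigma>)"
    by (rule W_scaled_integrable(2)[of _ T]) (use x in auto)
  have sum: "(LINT s|lborel. max 0 (s - x) *\<^sub>R (Q s ** V2 s \<sigma> + W s \<sigma>)) = duhamel ?k + (LINT s|lborel. max 0 (s - x) *\<^sub>R W s \<sigma>)"
    unfolding scaleR_add_right duhamel_eq(1)[OF bk] eq by (rule Bochner_Integration.integral_add[OF i1 i2])
  show "W2 x \<sigma> = (LINT s|lborel. max 0 (s - x) *\<^sub>R (Q s ** V2 s \<sigma> + W s \<sigma>))"
  proof (cases "x \<le> \<sigma>")
    case True
    then show ?thesis using W2_wave_aux[OF x True \<sigma>] sum by (simp add: algebra_simps)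
  next
    case False
    have "max 0 (s - x) *\<^sub>R (Q s ** V2 s \<sigma> + W s \<sigma>) = 0" for s
    proof (cases "x < s")
      case True
      then have "W2 s \<sigma> = 0" "W s \<sigma> = 0" "max 0 (\<sigma> - s) = 0" using False W2_zero[of \<sigma> s] W_outside[of s \<sigma>] by auto
      then show ?thesis by (simp add: V2_def matrix_zero_right)
    qed simp
    then show ?thesis using W2_zero[of \<sigma> x] False by (simp only: Bochner_Integration.integral_zero not_le less_imp_le)
  qed
qed

end

lemma L2_fun_affine:
  fixes h :: "real \<Rightarrow> 'a::euclidean_space"
  assumes h: "L2_fun T h" and c: "c \<noteq> 0"
  shows "L2_fun T (\<lambda>s. indicator {0..T} s *\<^sub>R h (t + c * s))"
proof (rule L2_fun_bound)
  note [measurable] = L2_funD(1)[OF h]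
  show "integrable lborel (\<lambda>s. (norm (h (t + c * s)))\<^sup>2)"
    using lborel_integrable_real_affine[OF L2_funD(2)[OF h] c] by simp
qed (use L2_funD(1)[OF h] in \<open>auto simp: indicator_def\<close>)

section \<open>Response to a constant control and the time derivative of the kernel\<close>

context wave_kernel
begin

text \<open>The scattered response at time \<open>T\<close> to a constant control. This control
  starts with a jump instead of a kink, so one time derivative falls on the kernel itself.\<close>

definition W1 :: "real \<Rightarrow> complex^'n^'n" where
  "W1 x = (LINT c|lborel. W x c)"

text \<open>What remains of \<open>integral_cone\<close> without the ramp
  \<open>- 2 * max 0 (y - x)\<close>.\<close>

definition ramp_rest :: "real \<Rightarrow> real \<Rightarrow> real \<Rightarrow> real" where
  "ramp_rest x y c = max 0 (y + T - c - x) + max 0 (y + c - T - x) - max 0 (T - c - x - y)"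

lemma ramp_rest_measurable: "(\<lambda>z. ramp_rest x (fst z) (snd z)) \<in> borel_measurable (borel \<Otimes>\<^sub>M borel)"
  unfolding ramp_rest_def by measurable

lemma bounded_kernel_ramp_rest: "0 \<le> x \<Longrightarrow> bounded_kernel (ramp_rest x)"
  unfolding bounded_kernel_def using ramp_rest_measurable
  by (auto intro!: exI[of _ "3 * T"] simp: ramp_rest_def max_def)

lemma bounded_kernel_ramp1: "0 \<le> x \<Longrightarrow> bounded_kernel (\<lambda>y c. max 0 (y - x))"
  unfolding bounded_kernel_def by (auto intro!: exI[of _ "T"])

lemma W1_eq_duhamel:
  assumes x: "0 \<le> x" "x \<le> T"
  shows "W1 x = duhamel (\<lambda>y c. max 0 (y - x)) - (1/2) *\<^sub>R duhamel (ramp_rest x)"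
proof -
  let ?i = "indicator {x..T} :: real \<Rightarrow> real"
  let ?h = "\<lambda>t y c. ?i t * cone_diff x t y c"
  have pt: "W x t = - (1/2) *\<^sub>R duhamel (?h t)" for t
  proof (cases "t \<in> {x..T}")
    case True
    then show ?thesis using W_eq_duhamel[of x t] x by simp
  next
    case False
    then have "duhamel (?h t) = 0" by (simp add: duhamel_def)
    then show ?thesis using False W_outside[of x t] by auto
  qed
  have hm: "(\<lambda>z. ?h (fst z) (fst (snd z)) (snd (snd z))) \<in> borel_measurable (borel \<Otimes>\<^sub>M (borel \<Otimes>\<^sub>M borel))"
    by (intro borel_measurable_times borel_measurable_cone_diff) measurable
  have bnd: "\<bar>?h t y c\<bar> \<le> 1" for t y c
    using cone_bound[of x t y c] by (simp add: abs_mult indicator_def)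
  have 1: "W1 x = - (1/2) *\<^sub>R (LINT t|lborel. duhamel (?h t))"
  proof -
    have "W1 x = (LINT t|lborel. - (1/2) *\<^sub>R duhamel (?h t))"
      unfolding W1_def by (rule Bochner_Integration.integral_cong[OF _ pt]) simp
    also have "\<dots> = - (1/2) *\<^sub>R (LINT t|lborel. duhamel (?h t))" by (rule Bochner_Integration.integral_scaleR_right)
    finally show ?thesis .
  qed
  have 2: "(LINT t|lborel. duhamel (?h t)) = duhamel (\<lambda>y c. LINT t|lborel. ?h t y c)"
    by (rule duhamel_integral(1)[OF hm bnd, where a=x and b=T]) simp
  have 3: "duhamel (\<lambda>y c. LINT t|lborel. ?h t y c) = duhamel (\<lambda>y c. 1 * ramp_rest x y c - 2 * max 0 (y - x))"
    by (rule duhamel_cong) (use x integral_cone in \<open>simp add: ramp_rest_def\<close>)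
  have 4: "duhamel (\<lambda>y c. 1 * ramp_rest x y c - 2 * max 0 (y - x)) = 1 *\<^sub>R duhamel (ramp_rest x) - 2 *\<^sub>R duhamel (\<lambda>y c. max 0 (y - x))"
    by (rule duhamel_diff_scale[symmetric]) (intro bounded_kernel_ramp_rest bounded_kernel_ramp1 x)+
  show ?thesis unfolding 1 2 3 4 by (simp add: scaleR_diff_right)
qed

definition V1 :: "real \<Rightarrow> complex^'n^'n" where
  "V1 s = mat 1 + W1 s"

lemma duhamel_ramp1:
  assumes x: "0 \<le> x"
  shows "duhamel (\<lambda>y c. max 0 (y - x)) = (LINT s|lborel. max 0 (s - x) *\<^sub>R (Q s ** V1 s))"
    and "integrable lborel (\<lambda>s. max 0 (s - x) *\<^sub>R (Q s ** V1 s))"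
proof -
  have eq: "Q s ** (max 0 (s - x) *\<^sub>R mat 1 + (LINT c|lborel. max 0 (s - x) *\<^sub>R W s c)) = max 0 (s - x) *\<^sub>R (Q s ** V1 s)" for s
    unfolding V1_def W1_def Bochner_Integration.integral_scaleR_right scaleR_add_right[symmetric]
      bounded_bilinear.scaleR_right[OF bounded_bilinear_matrix_matrix_mult] ..
  show "duhamel (\<lambda>y c. max 0 (y - x)) = (LINT s|lborel. max 0 (s - x) *\<^sub>R (Q s ** V1 s))"
    using duhamel_eq(1)[OF bounded_kernel_ramp1[OF x]] unfolding eq .
  show "integrable lborel (\<lambda>s. max 0 (s - x) *\<^sub>R (Q s ** V1 s))"
    using duhamel_eq(2)[OF bounded_kernel_ramp1[OF x]] unfolding eq .
qed

text \<open>\<open>D1 + D2\<close> is the derivative of the kernel \<open>W s t\<close> with respect to \<open>t\<close> at \<open>t = T\<close>; only its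
  square integrability and the integrated identity \<open>W1_wave\<close> are needed.\<close>

definition D1 :: "real \<Rightarrow> complex^'n^'n" where
  "D1 s = - (1/4) *\<^sub>R (indicator {0..T} s *\<^sub>R Q (T/2 + (1/2) * s) - indicator {0..T} s *\<^sub>R Q (T/2 + (-1/2) * s))"

text \<open>Values of the kernel on the two backward characteristics through \<open>(s, T)\<close>
  and on the one through the mirror image \<open>(- s, T)\<close>: they arise when the integral over
  the cone difference is differentiated in time. The zero extension of \<open>W\<close> keeps of
  each line only the part below time \<open>T\<close>.\<close>

definition refl_W :: "real \<Rightarrow> real \<Rightarrow> complex^'n^'n" where
  "refl_W s y = W y (T - y + s) + W y (T + y - s) - W y (T - y - s)"

definition D2 :: "real \<Rightarrow> complex^'n^'n" where
  "D2 s = - (1/2) *\<^sub>R indicator {0..T} s *\<^sub>R (LINT y|lborel. Q y ** refl_W s y)"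

lemma L2_fun_D1: "L2_fun T D1"
  unfolding D1_def by (intro L2_fun_scaleR L2_fun_diff L2_fun_affine Q) auto

lemma refl_W_measurable [measurable (raw)]:
  assumes [measurable]: "f \<in> borel_measurable M" "g \<in> borel_measurable M"
  shows "(\<lambda>z. refl_W (f z) (g z)) \<in> borel_measurable M"
  unfolding refl_W_def by measurable

lemma Q_refl_W_bound:
  obtains C where "C \<ge> 0" "\<And>s y. norm (Q y ** refl_W s y) \<le> C * norm (Q y)"
proof -
  obtain C where C: "C \<ge> 0" "\<And>y x s. norm (Q y ** W x s) \<le> C * norm (Q y)" by (rule QW_bound) (rule that)
  show thesis
  proof (rule that[of "3 * C"])
    fix s y
    have "Q y ** refl_W s y = Q y ** W y (T - y + s) + Q y ** W y (T + y - s) - Q y ** W y (T - y - s)"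
      unfolding refl_W_def by (simp only: bounded_bilinear.add_right[OF bounded_bilinear_matrix_matrix_mult]
          bounded_bilinear.diff_right[OF bounded_bilinear_matrix_matrix_mult])
    also have "norm \<dots> \<le> C * norm (Q y) + C * norm (Q y) + C * norm (Q y)"
      by (intro order_trans[OF norm_triangle_ineq4] order_trans[OF norm_triangle_ineq] add_mono C)
    finally show "norm (Q y ** refl_W s y) \<le> 3 * C * norm (Q y)" by simp
  qed (use C in simp)
qed

lemma L2_fun_D2: "L2_fun T D2"
proof -
  obtain C where C: "C \<ge> 0" "\<And>s y. norm (Q y ** refl_W s y) \<le> C * norm (Q y)" by (rule Q_refl_W_bound) (rule that)
  define I where "I = (LINT y|lborel. C * norm (Q y))"
  have iQ: "integrable lborel (\<lambda>y. C * norm (Q y))" using Q_integrable by (intro integrable_mult_right integrable_norm)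
  have I0: "0 \<le> I" unfolding I_def by (intro Bochner_Integration.integral_nonneg) (use C in simp)
  have "norm (LINT y|lborel. Q y ** refl_W s y) \<le> I" for s
  proof -
    have "integrable lborel (\<lambda>y. Q y ** refl_W s y)" by (rule integrable_norm_le[OF iQ _ C(2)]) measurable
    then show ?thesis unfolding I_def by (rule Bochner_Integration.integral_norm_bound_integral[OF _ iQ C(2)])
  qed
  note le = this
  have "norm (D2 s) \<le> I" for s
  proof -
    have "norm (D2 s) \<le> 1 * norm (LINT y|lborel. Q y ** refl_W s y)"
      unfolding D2_def norm_scaleR mult.assoc[symmetric] by (rule mult_right_mono) (auto simp: indicator_def)
    then show ?thesis using le[of s] by simp
  qed
  note D2_le = this
  show ?thesis
  proof (rule L2_fun_bounded[OF _ D2_le])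
    show "D2 \<in> borel_measurable borel" unfolding D2_def[abs_def] by measurable
  qed (auto simp: D2_def)
qed

text \<open>The substitutions \<open>y = (T + s) / 2\<close> and \<open>y = (T - s) / 2\<close> turn
  the ramps of slope 2 in \<open>y\<close> into \<open>max 0 (s - x)\<close>.\<close>

lemma integral_ramp_D1:
  assumes x: "0 \<le> x"
  shows "(LINT s|lborel. max 0 (s - x) *\<^sub>R D1 s) = - (1/2) *\<^sub>R (LINT y|lborel. (max 0 (2 * y - T - x) - max 0 (T - 2 * y - x)) *\<^sub>R Q y)"
proof -
  have i1: "integrable lborel (\<lambda>y. max 0 (2 * y - T - x) *\<^sub>R Q y)"
    by (rule L2_fun_mult_integrable(1)[OF Q, of _ T]) (use x in auto)
  have i2: "integrable lborel (\<lambda>y. max 0 (T - 2 * y - x) *\<^sub>R Q y)"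
    by (rule L2_fun_mult_integrable(1)[OF Q, of _ T]) (use x T in auto)
  have e1: "max 0 (2 * (T/2 + (1/2) * s) - T - x) *\<^sub>R Q (T/2 + (1/2) * s) = max 0 (s - x) *\<^sub>R (indicator {0..T} s *\<^sub>R Q (T/2 + (1/2) * s))" for s
    using x Q_outside[of "T/2 + (1/2) * s"] by (cases "T/2 + (1/2) * s \<in> {0..T}") (auto simp: indicator_def max_def)
  have e2: "max 0 (T - 2 * (T/2 + (-1/2) * s) - x) *\<^sub>R Q (T/2 + (-1/2) * s) = max 0 (s - x) *\<^sub>R (indicator {0..T} s *\<^sub>R Q (T/2 + (-1/2) * s))" for s
    using x Q_outside[of "T/2 + (-1/2) * s"] by (cases "T/2 + (-1/2) * s \<in> {0..T}") (auto simp: indicator_def max_def)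
  have a1: "(LINT y|lborel. max 0 (2 * y - T - x) *\<^sub>R Q y) = (1/2) *\<^sub>R (LINT s|lborel. max 0 (s - x) *\<^sub>R (indicator {0..T} s *\<^sub>R Q (T/2 + (1/2) * s)))"
    by (subst lborel_integral_real_affine[where c="1/2" and t="T/2"]) (simp_all only: e1, simp_all)
  have a2: "(LINT y|lborel. max 0 (T - 2 * y - x) *\<^sub>R Q y) = (1/2) *\<^sub>R (LINT s|lborel. max 0 (s - x) *\<^sub>R (indicator {0..T} s *\<^sub>R Q (T/2 + (-1/2) * s)))"
    by (subst lborel_integral_real_affine[where c="-1/2" and t="T/2"]) (simp_all only: e2, simp_all)
  have j: "integrable lborel (\<lambda>s. max 0 (s - x) *\<^sub>R (indicator {0..T} s *\<^sub>R Q (T/2 + c * s)))" if "c \<noteq> 0" for c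
    by (rule L2_fun_mult_integrable(1)[OF L2_fun_affine[OF Q that], of _ T]) (use x in auto)
  have eD: "max 0 (s - x) *\<^sub>R D1 s = - (1/4) *\<^sub>R (max 0 (s - x) *\<^sub>R (indicator {0..T} s *\<^sub>R Q (T/2 + (1/2) * s)) - max 0 (s - x) *\<^sub>R (indicator {0..T} s *\<^sub>R Q (T/2 + (-1/2) * s)))" for s
    unfolding D1_def scaleR_diff_right[of "max 0 (s - x)", symmetric] by (rule scaleR_left_commute)
  have "(LINT s|lborel. max 0 (s - x) *\<^sub>R D1 s) = - (1/4) *\<^sub>R ((LINT s|lborel. max 0 (s - x) *\<^sub>R (indicator {0..T} s *\<^sub>R Q (T/2 + (1/2) * s)))
     - (LINT s|lborel. max 0 (s - x) *\<^sub>R (indicator {0..T} s *\<^sub>R Q (T/2 + (-1/2) * s))))"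
    unfolding eD Bochner_Integration.integral_scaleR_right
    by (subst Bochner_Integration.integral_diff[OF j j]) auto
  moreover have "(LINT y|lborel. (max 0 (2 * y - T - x) - max 0 (T - 2 * y - x)) *\<^sub>R Q y) = (LINT y|lborel. max 0 (2 * y - T - x) *\<^sub>R Q y) - (LINT y|lborel. max 0 (T - 2 * y - x) *\<^sub>R Q y)"
    unfolding scaleR_diff_left by (rule Bochner_Integration.integral_diff[OF i1 i2])
  ultimately show ?thesis unfolding a1 a2 by (simp add: scaleR_diff_right)
qed

text \<open>One affine substitution along each characteristic turns a ramp of
  \<open>ramp_rest\<close> into \<open>max 0 (s - x)\<close>. The cutoff to \<open>[0,T]\<close>
  changes nothing: for \<open>s < 0\<close> the ramp vanishes, for \<open>s > T\<close> the kernel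
  does.\<close>

lemma integral_ramp_refl:
  assumes x: "0 \<le> x" and y: "y \<in> {0..T}"
  shows "(LINT s|lborel. (max 0 (s - x) * indicator {0..T} s) *\<^sub>R refl_W s y) = (LINT c|lborel. ramp_rest x y c *\<^sub>R W y c)"
proof -
  let ?k = "\<lambda>s. max 0 (s - x) * indicator {0..T} s"
  have e1: "max 0 (y + (T - y + 1 * s) - T - x) *\<^sub>R W y (T - y + 1 * s) = ?k s *\<^sub>R W y (T - y + s)" for s
    using x y W_outside[of y "T - y + s"] by (cases "y \<le> T - y + s \<and> T - y + s \<le> T") (auto simp: indicator_def max_def)
  have e2: "max 0 (y + T - (T + y + (-1) * s) - x) *\<^sub>R W y (T + y + (-1) * s) = ?k s *\<^sub>R W y (T + y - s)" for s
    using x y W_outside[of y "T + y - s"] by (cases "y \<le> T + y - s \<and> T + y - s \<le> T") (auto simp: indicator_def max_def)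
  have e3: "max 0 (T - (T - y + (-1) * s) - x - y) *\<^sub>R W y (T - y + (-1) * s) = ?k s *\<^sub>R W y (T - y - s)" for s
    using x y W_outside[of y "T - y - s"] by (cases "y \<le> T - y - s \<and> T - y - s \<le> T") (auto simp: indicator_def max_def)
  have a1: "(LINT c|lborel. max 0 (y + c - T - x) *\<^sub>R W y c) = (LINT s|lborel. ?k s *\<^sub>R W y (T - y + s))"
    by (subst lborel_integral_real_affine[where c=1 and t="T - y"]) (simp_all only: e1, simp_all)
  have a2: "(LINT c|lborel. max 0 (y + T - c - x) *\<^sub>R W y c) = (LINT s|lborel. ?k s *\<^sub>R W y (T + y - s))"
    by (subst lborel_integral_real_affine[where c="-1" and t="T + y"]) (simp_all only: e2, simp_all)
  have a3: "(LINT c|lborel. max 0 (T - c - x - y) *\<^sub>R W y c) = (LINT s|lborel. ?k s *\<^sub>R W y (T - y - s))"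
    by (subst lborel_integral_real_affine[where c="-1" and t="T - y"]) (simp_all only: e3, simp_all)
  have i: "integrable lborel (\<lambda>s. ?k s *\<^sub>R W y (f s))" if [measurable]: "f \<in> borel_measurable borel" for f
  proof (rule integrable_norm_le)
    show "integrable lborel (\<lambda>s. T * B * indicator {0..T} s)" using integrable_indicator_Icc by (rule integrable_mult_right)
    fix s show "norm (?k s *\<^sub>R W y (f s)) \<le> T * B * indicator {0..T} s"
      using W_bound[of y "f s"] x T by (auto simp: indicator_def abs_mult intro!: mult_mono)
  qed measurable
  have k: "integrable lborel (\<lambda>s. ?k s *\<^sub>R W y (T - y + s))" "integrable lborel (\<lambda>s. ?k s *\<^sub>R W y (T + y - s))"
    "integrable lborel (\<lambda>s. ?k s *\<^sub>R W y (T - y - s))"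
    by (rule i; measurable)+
  have j: "integrable lborel (\<lambda>c. max 0 (y + T - c - x) *\<^sub>R W y c)" "integrable lborel (\<lambda>c. max 0 (y + c - T - x) *\<^sub>R W y c)"
    "integrable lborel (\<lambda>c. max 0 (T - c - x - y) *\<^sub>R W y c)"
    by (rule W_scaled_integrable(1)[of _ "2 * T"]; use x y in auto)+
  have "(LINT c|lborel. ramp_rest x y c *\<^sub>R W y c) = (LINT c|lborel. max 0 (y + T - c - x) *\<^sub>R W y c) + (LINT c|lborel. max 0 (y + c - T - x) *\<^sub>R W y c)
     - (LINT c|lborel. max 0 (T - c - x - y) *\<^sub>R W y c)"
    unfolding ramp_rest_def scaleR_diff_left scaleR_add_left
    by (simp only: Bochner_Integration.integral_diff[OF Bochner_Integration.integrable_add[OF j(1,2)] j(3)]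
        Bochner_Integration.integral_add[OF j(1,2)])
  moreover have "(LINT s|lborel. ?k s *\<^sub>R refl_W s y) = (LINT s|lborel. ?k s *\<^sub>R W y (T - y + s)) + (LINT s|lborel. ?k s *\<^sub>R W y (T + y - s))
     - (LINT s|lborel. ?k s *\<^sub>R W y (T - y - s))"
    unfolding refl_W_def scaleR_diff_right scaleR_add_right
    by (simp only: Bochner_Integration.integral_diff[OF Bochner_Integration.integrable_add[OF k(1,2)] k(3)]
        Bochner_Integration.integral_add[OF k(1,2)])
  ultimately show ?thesis unfolding a1 a2 a3 by (simp only: add.commute)
qed

lemma integral_ramp_D2:
  assumes x: "0 \<le> x"
  shows "(LINT s|lborel. max 0 (s - x) *\<^sub>R D2 s) = - (1/2) *\<^sub>R (LINT z|(lborel \<Otimes>\<^sub>M lborel). ramp_rest x (fst z) (snd z) *\<^sub>R QW z)"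
proof -
  let ?k = "\<lambda>s. max 0 (s - x) * indicator {0..T} s"
  let ?f = "\<lambda>s y. ?k s *\<^sub>R (Q y ** refl_W s y)"
  obtain C where C: "C \<ge> 0" "\<And>s y. norm (Q y ** refl_W s y) \<le> C * norm (Q y)" by (rule Q_refl_W_bound) (rule that)
  have k: "0 \<le> ?k s" "?k s \<le> T * indicator {0..T} s" for s using x T by (auto simp: indicator_def)
  have int: "integrable (lborel \<Otimes>\<^sub>M lborel) (\<lambda>(s, y). ?f s y)"
  proof (rule lborel_pair.integrable_pair_bound)
    show "(\<lambda>(s, y). ?f s y) \<in> borel_measurable (lborel \<Otimes>\<^sub>M lborel)" by measurable
    show "integrable lborel (\<lambda>s. T * indicator {0..T} s)" using integrable_indicator_Icc by (rule integrable_mult_right)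
    show "integrable lborel (\<lambda>y. C * norm (Q y))" using Q_integrable by (intro integrable_mult_right integrable_norm)
    fix s y
    have "norm (?f s y) = ?k s * norm (Q y ** refl_W s y)" using k(1)[of s] by simp
    also have "\<dots> \<le> (T * indicator {0..T} s) * (C * norm (Q y))"
      using T by (intro mult_mono[OF k(2) C(2)]) auto
    finally show "norm (case (s, y) of (s, y) \<Rightarrow> ?f s y) \<le> T * indicator {0..T} s * (C * norm (Q y))" by simp
  qed
  have iy: "integrable lborel (\<lambda>s. ?k s *\<^sub>R refl_W s y)" for y
  proof (rule integrable_norm_le)
    show "integrable lborel (\<lambda>s. (3 * B) * (T * indicator {0..T} s))"
      by (intro integrable_mult_right integrable_indicator_Icc)
    fix s
    have "norm (refl_W s y) \<le> B + B + B"
      unfolding refl_W_def by (intro order_trans[OF norm_triangle_ineq4] order_trans[OF norm_triangle_ineq] add_mono W_bound)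
    then have "norm (refl_W s y) \<le> 3 * B" by simp
    then have "?k s * norm (refl_W s y) \<le> (T * indicator {0..T} s) * (3 * B)"
      using T by (intro mult_mono[OF k(2)]) auto
    then show "norm (?k s *\<^sub>R refl_W s y) \<le> (3 * B) * (T * indicator {0..T} s)" using k(1)[of s] by (simp add: mult_ac)
  qed measurable
  have inner: "(LINT s|lborel. ?f s y) = Q y ** (LINT c|lborel. ramp_rest x y c *\<^sub>R W y c)" for y
  proof (cases "y \<in> {0..T}")
    case True
    have "bounded_linear (\<lambda>X. Q y ** X)"
      by (rule bounded_bilinear.bounded_linear_right[OF bounded_bilinear_matrix_matrix_mult])
    from integral_bounded_linear[OF this iy[of y]]
    show ?thesis unfolding integral_ramp_refl[OF x True]
      by (simp only: bounded_bilinear.scaleR_right[OF bounded_bilinear_matrix_matrix_mult])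
  qed (simp add: Q_outside matrix_zero_left)
  have e: "max 0 (s - x) *\<^sub>R D2 s = - (1/2) *\<^sub>R (LINT y|lborel. ?f s y)" for s
  proof -
    have "(LINT y|lborel. ?f s y) = ?k s *\<^sub>R (LINT y|lborel. Q y ** refl_W s y)" by (rule Bochner_Integration.integral_scaleR_right)
    then show ?thesis by (simp only: D2_def scaleR_scaleR mult.commute mult.left_commute)
  qed
  have "(LINT s|lborel. max 0 (s - x) *\<^sub>R D2 s) = - (1/2) *\<^sub>R (LINT s|lborel. LINT y|lborel. ?f s y)"
    unfolding e by (rule Bochner_Integration.integral_scaleR_right)
  moreover have "(LINT s|lborel. LINT y|lborel. ?f s y) = (LINT y|lborel. LINT s|lborel. ?f s y)"
    by (rule lborel_pair.Fubini_integral[OF int, symmetric])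
  moreover have "(LINT y|lborel. LINT s|lborel. ?f s y) = (LINT z|(lborel \<Otimes>\<^sub>M lborel). ramp_rest x (fst z) (snd z) *\<^sub>R QW z)"
    unfolding inner by (rule integral_QW(1)[OF bounded_kernel_ramp_rest[OF x], symmetric])
  ultimately show ?thesis by (simp only:)
qed

definition D :: "real \<Rightarrow> complex^'n^'n" where
  "D s = D1 s + D2 s"

lemma L2_fun_D: "L2_fun T D"
  unfolding D_def by (intro L2_fun_add L2_fun_D1 L2_fun_D2)

text \<open>This is \<open>W T T\<close>: at the corner the direct cone meets the triangle only in
  its diagonal, so the double integral drops out of Duhamel's formula.\<close>

definition c0 :: "complex^'n^'n" where
  "c0 = - (1/2) *\<^sub>R (LINT y|lborel. Q y)"

text \<open>The two parts of \<open>W1_eq_duhamel\<close> are evaluated separately: the ramp gives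
  the potential term \<open>Q s ** V1 s\<close>, and \<open>ramp_rest\<close> gives
  \<open>c0\<close> and \<open>D\<close>.\<close>

lemma W1_wave:
  assumes x: "0 \<le> x" "x \<le> T"
  shows "W1 x = (T - x) *\<^sub>R c0 + (LINT s|lborel. max 0 (s - x) *\<^sub>R (Q s ** V1 s + D s))"
    and "integrable lborel (\<lambda>s. max 0 (s - x) *\<^sub>R (Q s ** V1 s))"
    and "integrable lborel (\<lambda>s. max 0 (s - x) *\<^sub>R D s)"
proof -
  show i1: "integrable lborel (\<lambda>s. max 0 (s - x) *\<^sub>R (Q s ** V1 s))" by (rule duhamel_ramp1(2)[OF x(1)])
  have j: "integrable lborel (\<lambda>s. max 0 (s - x) *\<^sub>R F s)" if "L2_fun T F" for F :: "real \<Rightarrow> complex^'n^'n"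
    by (rule L2_fun_mult_integrable(1)[OF that, of _ T]) (use x in auto)
  show i2: "integrable lborel (\<lambda>s. max 0 (s - x) *\<^sub>R D s)" by (rule j[OF L2_fun_D])
  let ?m = "\<lambda>y. max 0 (2 * y - T - x) - max 0 (T - 2 * y - x)"
  have im: "integrable lborel (\<lambda>y. ?m y *\<^sub>R Q y)"
    by (rule L2_fun_mult_integrable(1)[OF Q, of _ "2 * T"]) (use x T in \<open>auto simp: max_def\<close>)
  \<comment> \<open>On the diagonal the first ramp of \<open>ramp_rest\<close> does not depend on
    \<open>y\<close> and equals \<open>T - x\<close>; this is where the affine term with
    \<open>c0\<close> comes from.\<close>
  have d: "(LINT y|lborel. ramp_rest x y y *\<^sub>R Q y) = (T - x) *\<^sub>R (LINT y|lborel. Q y) + (LINT y|lborel. ?m y *\<^sub>R Q y)"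
  proof -
    have "ramp_rest x y y *\<^sub>R Q y = (T - x) *\<^sub>R Q y + ?m y *\<^sub>R Q y" for y
    proof -
      have "y + T - y - x = T - x" "y + y - T - x = 2 * y - T - x" "T - y - x - y = T - 2 * y - x" by simp_all
      then have "ramp_rest x y y = (T - x) + ?m y" using x unfolding ramp_rest_def by simp
      then show ?thesis by (simp only: scaleR_add_left)
    qed
    then show ?thesis
      by (simp only: Bochner_Integration.integral_add[OF integrable_scaleR_right[OF Q_integrable] im] Bochner_Integration.integral_scaleR_right)
  qed
  have "- (1/2) *\<^sub>R duhamel (ramp_rest x) = (T - x) *\<^sub>R c0 + (LINT s|lborel. max 0 (s - x) *\<^sub>R D1 s) + (LINT s|lborel. max 0 (s - x) *\<^sub>R D2 s)"
    unfolding duhamel_def d integral_ramp_D1[OF x(1)] integral_ramp_D2[OF x(1)] c0_def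
    by (simp only: scaleR_add_right scaleR_left_commute[of "- (1/2)"] add.assoc)
  moreover have "(LINT s|lborel. max 0 (s - x) *\<^sub>R D s) = (LINT s|lborel. max 0 (s - x) *\<^sub>R D1 s) + (LINT s|lborel. max 0 (s - x) *\<^sub>R D2 s)"
    unfolding D_def scaleR_add_right by (rule Bochner_Integration.integral_add[OF j[OF L2_fun_D1] j[OF L2_fun_D2]])
  moreover have "(LINT s|lborel. max 0 (s - x) *\<^sub>R (Q s ** V1 s + D s)) = (LINT s|lborel. max 0 (s - x) *\<^sub>R (Q s ** V1 s)) + (LINT s|lborel. max 0 (s - x) *\<^sub>R D s)"
    unfolding scaleR_add_right by (rule Bochner_Integration.integral_add[OF i1 i2])
  ultimately show "W1 x = (T - x) *\<^sub>R c0 + (LINT s|lborel. max 0 (s - x) *\<^sub>R (Q s ** V1 s + D s))"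
    unfolding W1_eq_duhamel[OF x] duhamel_ramp1(1)[OF x(1)] by (simp add: algebra_simps)
qed

end

section \<open>The operator on twice integrated functions\<close>

lemma bounded_linear_mv_left: "bounded_linear (\<lambda>X :: complex^'n^'n. X *v a)"
  by (rule bounded_bilinear.bounded_linear_left[OF bounded_bilinear_matrix_vector_mult])

lemma bounded_linear_mv_right: "bounded_linear (\<lambda>x. (X :: complex^'n^'n) *v x)"
  by (rule bounded_bilinear.bounded_linear_right[OF bounded_bilinear_matrix_vector_mult])

lemmas mv_scaleR_left = bounded_bilinear.scaleR_left[OF bounded_bilinear_matrix_vector_mult]
lemmas mv_scaleR_right = bounded_bilinear.scaleR_right[OF bounded_bilinear_matrix_vector_mult]
lemmas mv_add_left = bounded_bilinear.add_left[OF bounded_bilinear_matrix_vector_mult]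
lemmas mv_add_right = bounded_bilinear.add_right[OF bounded_bilinear_matrix_vector_mult]
lemmas mv_diff_left = bounded_bilinear.diff_left[OF bounded_bilinear_matrix_vector_mult]
lemmas mv_diff_right = bounded_bilinear.diff_right[OF bounded_bilinear_matrix_vector_mult]
lemmas mv_zero_left = bounded_bilinear.zero_left[OF bounded_bilinear_matrix_vector_mult]
lemmas mv_zero_right = bounded_bilinear.zero_right[OF bounded_bilinear_matrix_vector_mult]

lemma back2_measurable:
  assumes "L2_fun T h"
  shows "back2 h \<in> borel_measurable borel"
proof -
  note [measurable] = L2_funD(1)[OF assms]
  show ?thesis unfolding back2_def[abs_def] by measurable
qed

lemma norm_back2_le:
  assumes h: "L2_fun T h" and "0 \<le> x" and "T \<ge> 0"
  shows "norm (back2 h x) \<le> T * (LINT s|lborel. norm (h s))"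
  unfolding back2_def by (rule L2_fun_mult_integrable(2)[OF h]) (use assms in auto)

context wave_kernel
begin

definition Wi :: "(real \<Rightarrow> complex^'n) \<Rightarrow> real \<Rightarrow> complex^'n" where
  "Wi u x = (LINT c|lborel. W x c *v u c)"

lemma W1_wave_vector:
  fixes a :: "complex^'n"
  defines "u \<equiv> \<lambda>c. indicator {0..T} c *\<^sub>R a"
  assumes x: "x \<in> {0..T}"
  shows "Wi u x = (T - x) *\<^sub>R (c0 *v a) + (LINT s|lborel. max 0 (s - x) *\<^sub>R (Q s *v (a + Wi u s) + D s *v a))"
    and "integrable lborel (\<lambda>s. max 0 (s - x) *\<^sub>R (Q s *v (a + Wi u s) + D s *v a))"
proof -
  have Wu: "Wi u s = W1 s *v a" for s
  proof -
    have i: "integrable lborel (W s)" using W_scaled_integrable(1)[of "\<lambda>_. 1" 1 s] by simp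
    have "W s c *v u c = W s c *v a" for c
      using W_outside[of s c] by (cases "c \<in> {0..T}") (auto simp: u_def mv_zero_left)
    then have "Wi u s = (LINT c|lborel. W s c *v a)" unfolding Wi_def by (simp only:)
    also have "\<dots> = W1 s *v a" unfolding W1_def by (rule integral_bounded_linear[OF bounded_linear_mv_left i])
    finally show ?thesis .
  qed
  have x': "0 \<le> x" "x \<le> T" using x by auto
  note i1 = W1_wave(2)[OF x'] and i2 = W1_wave(3)[OF x']
  have i: "integrable lborel (\<lambda>s. max 0 (s - x) *\<^sub>R (Q s ** V1 s + D s))"
    unfolding scaleR_add_right by (rule Bochner_Integration.integrable_add[OF i1 i2])
  have eq: "max 0 (s - x) *\<^sub>R (Q s *v (a + Wi u s) + D s *v a) = (max 0 (s - x) *\<^sub>R (Q s ** V1 s + D s)) *v a" for s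
    unfolding Wu mv_scaleR_left mv_add_left V1_def matrix_vector_mul_assoc[symmetric] by simp
  show "integrable lborel (\<lambda>s. max 0 (s - x) *\<^sub>R (Q s *v (a + Wi u s) + D s *v a))"
    unfolding eq by (rule integrable_bounded_linear[OF bounded_linear_mv_left i])
  show "Wi u x = (T - x) *\<^sub>R (c0 *v a) + (LINT s|lborel. max 0 (s - x) *\<^sub>R (Q s *v (a + Wi u s) + D s *v a))"
    unfolding eq integral_bounded_linear[OF bounded_linear_mv_left i] unfolding Wu
    by (subst W1_wave(1)[OF x']) (simp only: mv_add_left mv_scaleR_left)
qed

text \<open>The source \<open>T - c\<close> is the ramp with \<open>\<sigma> = T\<close>, so
  \<open>W2\<close> applies directly.\<close>

lemma W2_wave_vector:
  fixes b :: "complex^'n"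
  defines "u \<equiv> \<lambda>c. indicator {0..T} c *\<^sub>R (T - c) *\<^sub>R b"
  assumes x: "x \<in> {0..T}"
  shows "Wi u x = (LINT s|lborel. max 0 (s - x) *\<^sub>R (Q s *v ((T - s) *\<^sub>R b + Wi u s) + W s T *v b))"
    and "integrable lborel (\<lambda>s. max 0 (s - x) *\<^sub>R (Q s *v ((T - s) *\<^sub>R b + Wi u s) + W s T *v b))"
proof -
  have Wu: "Wi u s = W2 s T *v b" for s
  proof -
    have i: "integrable lborel (\<lambda>c. max 0 (T - c) *\<^sub>R W s c)"
      by (rule W_scaled_integrable(1)[of _ T]) auto
    have "W s c *v u c = (max 0 (T - c) *\<^sub>R W s c) *v b" for c
      using W_outside[of s c] by (cases "c \<in> {0..T}") (auto simp: u_def mv_zero_left mv_scaleR_left mv_scaleR_right)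
    then have "Wi u s = (LINT c|lborel. (max 0 (T - c) *\<^sub>R W s c) *v b)" unfolding Wi_def by (simp only:)
    also have "\<dots> = W2 s T *v b" unfolding W2_def by (rule integral_bounded_linear[OF bounded_linear_mv_left i])
    finally show ?thesis .
  qed
  have x': "0 \<le> x" "T \<le> T" using x by auto
  have i: "integrable lborel (\<lambda>s. max 0 (s - x) *\<^sub>R (Q s ** V2 s T + W s T))"
    unfolding scaleR_add_right by (rule Bochner_Integration.integrable_add[OF W2_wave(2,3)[OF x']])
  have eq: "max 0 (s - x) *\<^sub>R (Q s *v ((T - s) *\<^sub>R b + Wi u s) + W s T *v b) = (max 0 (s - x) *\<^sub>R (Q s ** V2 s T + W s T)) *v b" for s
  proof -
    have "Q s *v ((T - s) *\<^sub>R b + Wi u s) = (Q s ** V2 s T) *v b"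
    proof (cases "s \<in> {0..T}")
      case True
      then show ?thesis unfolding Wu V2_def matrix_vector_mul_assoc[symmetric] mv_add_left mv_scaleR_left by simp
    next
      case False
      then show ?thesis unfolding matrix_vector_mul_assoc[symmetric] by (simp add: Q_outside mv_zero_left)
    qed
    then show ?thesis by (simp only: mv_scaleR_left mv_add_left)
  qed
  show "integrable lborel (\<lambda>s. max 0 (s - x) *\<^sub>R (Q s *v ((T - s) *\<^sub>R b + Wi u s) + W s T *v b))"
    unfolding eq by (rule integrable_bounded_linear[OF bounded_linear_mv_left i])
  show "Wi u x = (LINT s|lborel. max 0 (s - x) *\<^sub>R (Q s *v ((T - s) *\<^sub>R b + Wi u s) + W s T *v b))"
    unfolding eq integral_bounded_linear[OF bounded_linear_mv_left i] unfolding Wu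
    by (subst W2_wave(1)[OF x']) (rule refl)
qed

lemma W2_measurable [measurable (raw)]:
  assumes [measurable]: "f \<in> borel_measurable M" "g \<in> borel_measurable M"
  shows "(\<lambda>z. W2 (f z) (g z)) \<in> borel_measurable M"
  unfolding W2_def by measurable

text \<open>Superposition: \<open>back2 g\<close> is an integral of ramps with weights
  \<open>g \<sigma>\<close>, hence its response is the integral of the ramp responses with the same
  weights.\<close>

lemma Wi_back2:
  assumes g: "L2_fun T g"
  shows "Wi (\<lambda>c. indicator {0..T} c *\<^sub>R back2 g c) x = (LINT \<sigma>|lborel. W2 x \<sigma> *v g \<sigma>)"
proof -
  note [measurable] = L2_funD(1)[OF g]
  obtain c where c: "c \<ge> 0" "\<And>x s (z :: complex^'n). norm (W x s *v z) \<le> c * norm z" by (rule W_mult_bound) (rule that)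
  let ?f = "\<lambda>t \<sigma>. max 0 (\<sigma> - t) *\<^sub>R (W x t *v g \<sigma>)"
  have int: "integrable (lborel \<Otimes>\<^sub>M lborel) (\<lambda>(t, \<sigma>). ?f t \<sigma>)"
  proof (rule lborel_pair.integrable_pair_bound)
    show "(\<lambda>(t, \<sigma>). ?f t \<sigma>) \<in> borel_measurable (lborel \<Otimes>\<^sub>M lborel)" by measurable
    show "integrable lborel (\<lambda>t. T * indicator {0..T} t)" using integrable_indicator_Icc by (rule integrable_mult_right)
    show "integrable lborel (\<lambda>\<sigma>. c * norm (g \<sigma>))" using L2_fun_integrable[OF g] by (intro integrable_mult_right integrable_norm)
    fix t \<sigma>
    show "norm (case (t, \<sigma>) of (t, \<sigma>) \<Rightarrow> ?f t \<sigma>) \<le> T * indicator {0..T} t * (c * norm (g \<sigma>))"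
    proof (cases "t \<in> {0..T} \<and> \<sigma> \<in> {0..T}")
      case True
      then have "\<bar>max 0 (\<sigma> - t)\<bar> * norm (W x t *v g \<sigma>) \<le> T * (c * norm (g \<sigma>))"
        using c(2)[of x t "g \<sigma>"] by (intro mult_mono) auto
      then show ?thesis using True by simp
    next
      case False
      then have "W x t = 0 \<or> g \<sigma> = 0" using W_outside[of x t] L2_funD(3)[OF g, of \<sigma>] by auto
      then show ?thesis using T c(1) by (auto simp: mv_zero_left mv_zero_right)
    qed
  qed
  have i1: "integrable lborel (\<lambda>\<sigma>. max 0 (\<sigma> - t) *\<^sub>R g \<sigma>)" for t
    by (rule L2_fun_mult_integrable(1)[OF g, of _ "T + \<bar>t\<bar>"]) auto
  have e1: "W x t *v (indicator {0..T} t *\<^sub>R back2 g t) = (LINT \<sigma>|lborel. ?f t \<sigma>)" for t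
  proof -
    have "W x t *v (indicator {0..T} t *\<^sub>R back2 g t) = W x t *v back2 g t"
      using W_outside[of x t] by (cases "t \<in> {0..T}") (auto simp: mv_zero_left)
    also have "\<dots> = (LINT \<sigma>|lborel. W x t *v (max 0 (\<sigma> - t) *\<^sub>R g \<sigma>))"
      unfolding back2_def by (rule integral_bounded_linear[OF bounded_linear_mv_right i1, symmetric])
    finally show ?thesis by (simp only: mv_scaleR_right)
  qed
  have e2: "(LINT t|lborel. ?f t \<sigma>) = W2 x \<sigma> *v g \<sigma>" for \<sigma>
  proof -
    have "integrable lborel (\<lambda>t. max 0 (\<sigma> - t) *\<^sub>R W x t)"
      by (rule W_scaled_integrable(1)[of _ "\<bar>\<sigma>\<bar>"]) auto
    from integral_bounded_linear[OF bounded_linear_mv_left this, of "g \<sigma>"]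
    show ?thesis unfolding W2_def mv_scaleR_left .
  qed
  have "Wi (\<lambda>c. indicator {0..T} c *\<^sub>R back2 g c) x = (LINT t|lborel. LINT \<sigma>|lborel. ?f t \<sigma>)"
    unfolding Wi_def e1 ..
  also have "\<dots> = (LINT \<sigma>|lborel. LINT t|lborel. ?f t \<sigma>)"
    by (rule lborel_pair.Fubini_integral[OF int, symmetric])
  also have "\<dots> = (LINT \<sigma>|lborel. W2 x \<sigma> *v g \<sigma>)" unfolding e2 ..
  finally show ?thesis .
qed

lemma V2_bound:
  obtains M where "M \<ge> 0" "\<And>s \<sigma>. s \<in> {0..T} \<Longrightarrow> \<sigma> \<in> {0..T} \<Longrightarrow> norm (V2 s \<sigma>) \<le> M" "\<And>s \<sigma>. \<sigma> \<in> {0..T} \<Longrightarrow> norm (W2 s \<sigma>) \<le> M"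
proof -
  have W2_le: "norm (W2 s \<sigma>) \<le> T * B * T" if "\<sigma> \<in> {0..T}" for s \<sigma>
  proof -
    have "norm (W2 s \<sigma>) \<le> (LINT c|lborel. T * B * indicator {0..T} c)"
      unfolding W2_def
    proof (rule Bochner_Integration.integral_norm_bound_integral)
      show "integrable lborel (\<lambda>c. max 0 (\<sigma> - c) *\<^sub>R W s c)"
        by (rule W_scaled_integrable(1)[of _ T]) (use that in auto)
      show "integrable lborel (\<lambda>c. T * B * indicator {0..T} c)" using integrable_indicator_Icc by (rule integrable_mult_right)
      fix c show "norm (max 0 (\<sigma> - c) *\<^sub>R W s c) \<le> T * B * indicator {0..T} c"
        using W_bound[of s c] W_outside[of s c] that T by (cases "c \<in> {0..T}") (auto intro: mult_mono)
    qed
    also have "\<dots> = T * B * T" using T by simp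
    finally show ?thesis .
  qed
  define m where "m = norm (mat 1 :: complex^'n^'n)"
  show thesis
  proof (rule that[of "T * m + T * B * T"])
    show "0 \<le> T * m + T * B * T" using T B_nonneg by (simp add: m_def)
    fix s \<sigma> assume *: "\<sigma> \<in> {0..T}"
    show "norm (W2 s \<sigma>) \<le> T * m + T * B * T" 
    proof -
      have "0 \<le> T * m" using T by (simp add: m_def)
      then show ?thesis using W2_le[OF *, of s] by linarith
    qed
    assume "s \<in> {0..T}"
    then have "norm (max 0 (\<sigma> - s) *\<^sub>R (mat 1 :: complex^'n^'n)) \<le> T * m"
      unfolding m_def norm_scaleR using * by (intro mult_right_mono) auto
    then show "norm (V2 s \<sigma>) \<le> T * m + T * B * T"
      unfolding V2_def by (rule order_trans[OF norm_triangle_ineq add_mono]) (rule W2_le[OF *])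
  qed
qed

text \<open>The wave equation of a single ramp is integrated against \<open>g \<sigma>\<close>.
  After Fubini the weight meets \<open>V2\<close>, which gives the full wave of this source, and
  \<open>W\<close>, which gives \<open>Wi g\<close>.\<close>

lemma back2_wave_vector:
  fixes g :: "real \<Rightarrow> complex^'n"
  assumes g: "L2_fun T g" and x: "x \<in> {0..T}"
  defines "u \<equiv> \<lambda>c. indicator {0..T} c *\<^sub>R back2 g c"
  shows "Wi u x = (LINT s|lborel. max 0 (s - x) *\<^sub>R (Q s *v (back2 g s + Wi u s) + Wi g s))"
    and "integrable lborel (\<lambda>s. max 0 (s - x) *\<^sub>R (Q s *v (back2 g s + Wi u s) + Wi g s))"
proof -
  note [measurable] = L2_funD(1)[OF g]
  have x0: "0 \<le> x" using x by simp
  obtain M where M: "M \<ge> 0" "\<And>s \<sigma>. s \<in> {0..T} \<Longrightarrow> \<sigma> \<in> {0..T} \<Longrightarrow> norm (V2 s \<sigma>) \<le> M"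
     "\<And>s \<sigma>. \<sigma> \<in> {0..T} \<Longrightarrow> norm (W2 s \<sigma>) \<le> M" by (rule V2_bound) (rule that)
  obtain cm where cm: "cm > 0" "\<And>(A :: complex^'n^'n) (B :: complex^'n^'n). norm (A ** B) \<le> norm A * norm B * cm"
    using norm_matrix_matrix_mult_bound by blast
  obtain cv where cv: "cv > 0" "\<And>(A :: complex^'n^'n) x. norm (A *v x) \<le> norm A * norm x * cv"
    using norm_matrix_vector_mult_bound by blast
  let ?k = "\<lambda>s. max 0 (s - x)"
  let ?X = "\<lambda>s \<sigma>. ?k s *\<^sub>R (Q s ** V2 s \<sigma> + W s \<sigma>)"
  let ?f = "\<lambda>s \<sigma>. ?X s \<sigma> *v g \<sigma>"
  have V2m [measurable (raw)]: "(\<lambda>z. V2 (f z) (h z)) \<in> borel_measurable N" if [measurable]: "f \<in> borel_measurable N" "h \<in> borel_measurable N" for f h N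
    unfolding V2_def by measurable
  have int: "integrable (lborel \<Otimes>\<^sub>M lborel) (\<lambda>(s, \<sigma>). ?f s \<sigma>)"
  proof (rule lborel_pair.integrable_pair_bound)
    show "(\<lambda>(s, \<sigma>). ?f s \<sigma>) \<in> borel_measurable (lborel \<Otimes>\<^sub>M lborel)" by measurable
    show "integrable lborel (\<lambda>s. T * (M * cm * norm (Q s) + B * indicator {0..T} s))"
      by (intro integrable_mult_right Bochner_Integration.integrable_add integrable_norm Q_integrable integrable_indicator_Icc)
    show "integrable lborel (\<lambda>\<sigma>. cv * norm (g \<sigma>))" using L2_fun_integrable[OF g] by (intro integrable_mult_right integrable_norm)
    fix s \<sigma>
    show "norm (case (s, \<sigma>) of (s, \<sigma>) \<Rightarrow> ?f s \<sigma>) \<le> T * (M * cm * norm (Q s) + B * indicator {0..T} s) * (cv * norm (g \<sigma>))"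
    proof (cases "s \<in> {0..T} \<and> \<sigma> \<in> {0..T}")
      case True
      have "norm (Q s ** V2 s \<sigma>) \<le> norm (Q s) * norm (V2 s \<sigma>) * cm" by (rule cm)
      also have "\<dots> \<le> norm (Q s) * M * cm" using True M(2) cm(1) by (intro mult_right_mono mult_left_mono) auto
      finally have "norm (Q s ** V2 s \<sigma> + W s \<sigma>) \<le> M * cm * norm (Q s) + B"
        using W_bound[of s \<sigma>] by (intro order_trans[OF norm_triangle_ineq] add_mono) (auto simp: mult_ac)
      then have X: "norm (?X s \<sigma>) \<le> T * (M * cm * norm (Q s) + B)"
        unfolding norm_scaleR using True x by (intro mult_mono) auto
      have "norm (?f s \<sigma>) \<le> norm (?X s \<sigma>) * norm (g \<sigma>) * cv" by (rule cv)
      also have "\<dots> \<le> T * (M * cm * norm (Q s) + B) * norm (g \<sigma>) * cv"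
        using cv(1) by (intro mult_right_mono X) auto
      finally show ?thesis using True by (simp add: mult_ac)
    next
      case False
      then have "?X s \<sigma> = 0 \<or> g \<sigma> = 0" using W_outside[of s \<sigma>] Q_outside[of s] L2_funD(3)[OF g, of \<sigma>] by (auto simp: matrix_zero_left)
      then have "?f s \<sigma> = 0" by (auto simp only: mv_zero_left mv_zero_right)
      moreover have "0 \<le> T * (M * cm * norm (Q s) + B * indicator {0..T} s) * (cv * norm (g \<sigma>))"
        using T M(1) cm(1) cv(1) B_nonneg by simp
      ultimately show ?thesis by simp
    qed
  qed
  have e1: "W2 x \<sigma> *v g \<sigma> = (LINT s|lborel. ?f s \<sigma>)" for \<sigma>
  proof (cases "\<sigma> \<in> {0..T}")
    case True
    then have s: "\<sigma> \<le> T" by simp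
    have i: "integrable lborel (\<lambda>s. ?X s \<sigma>)"
      unfolding scaleR_add_right by (rule Bochner_Integration.integrable_add[OF W2_wave(2,3)[OF x0 s]])
    show ?thesis
      unfolding integral_bounded_linear[OF bounded_linear_mv_left i] by (subst W2_wave(1)[OF x0 s]) (rule refl)
  next
    case False
    then have "g \<sigma> = 0" by (rule L2_funD(3)[OF g])
    then show ?thesis by (simp add: mv_zero_right)
  qed
  have iW: "integrable lborel (\<lambda>\<sigma>. W2 s \<sigma> *v g \<sigma>)" for s
  proof (rule integrable_norm_le)
    show "integrable lborel (\<lambda>\<sigma>. M * cv * norm (g \<sigma>))" using L2_fun_integrable[OF g] by (intro integrable_mult_right integrable_norm)
    fix \<sigma>
    have "norm (W2 s \<sigma> *v g \<sigma>) \<le> norm (W2 s \<sigma>) * norm (g \<sigma>) * cv" by (rule cv)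
    also have "\<dots> \<le> M * norm (g \<sigma>) * cv"
      using M(3)[of \<sigma> s] L2_funD(3)[OF g, of \<sigma>] cv(1) by (cases "\<sigma> \<in> {0..T}") (auto intro!: mult_right_mono)
    finally show "norm (W2 s \<sigma> *v g \<sigma>) \<le> M * cv * norm (g \<sigma>)" by (simp add: mult_ac)
  qed measurable
  have ib: "integrable lborel (\<lambda>\<sigma>. max 0 (\<sigma> - s) *\<^sub>R g \<sigma>)" for s
    by (rule L2_fun_mult_integrable(1)[OF g, of _ "T + \<bar>s\<bar>"]) auto
  have iV: "integrable lborel (\<lambda>\<sigma>. V2 s \<sigma> *v g \<sigma>)" and eV: "(LINT \<sigma>|lborel. V2 s \<sigma> *v g \<sigma>) = back2 g s + Wi u s" for s
  proof -
    have e: "V2 s \<sigma> *v g \<sigma> = max 0 (\<sigma> - s) *\<^sub>R g \<sigma> + W2 s \<sigma> *v g \<sigma>" for \<sigma>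
      unfolding V2_def mv_add_left mv_scaleR_left by simp
    show "integrable lborel (\<lambda>\<sigma>. V2 s \<sigma> *v g \<sigma>)" unfolding e by (rule Bochner_Integration.integrable_add[OF ib iW])
    show "(LINT \<sigma>|lborel. V2 s \<sigma> *v g \<sigma>) = back2 g s + Wi u s"
      unfolding e u_def Wi_back2[OF g] unfolding back2_def by (rule Bochner_Integration.integral_add[OF ib iW])
  qed
  have e2: "(LINT \<sigma>|lborel. ?f s \<sigma>) = ?k s *\<^sub>R (Q s *v (back2 g s + Wi u s) + Wi g s)" for s
  proof -
    have iWg: "integrable lborel (\<lambda>\<sigma>. W s \<sigma> *v g \<sigma>)" by (rule W_mult_integrable[OF L2_fun_integrable[OF g]])
    have f: "?f s \<sigma> = ?k s *\<^sub>R (Q s *v (V2 s \<sigma> *v g \<sigma>) + W s \<sigma> *v g \<sigma>)" for \<sigma>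
      by (simp only: mv_scaleR_left mv_add_left matrix_vector_mul_assoc)
    have "(LINT \<sigma>|lborel. ?f s \<sigma>) = ?k s *\<^sub>R (LINT \<sigma>|lborel. Q s *v (V2 s \<sigma> *v g \<sigma>) + W s \<sigma> *v g \<sigma>)"
      unfolding f by (rule Bochner_Integration.integral_scaleR_right)
    also have "(LINT \<sigma>|lborel. Q s *v (V2 s \<sigma> *v g \<sigma>) + W s \<sigma> *v g \<sigma>) = (LINT \<sigma>|lborel. Q s *v (V2 s \<sigma> *v g \<sigma>)) + (LINT \<sigma>|lborel. W s \<sigma> *v g \<sigma>)"
      by (rule Bochner_Integration.integral_add[OF integrable_bounded_linear[OF bounded_linear_mv_right iV] iWg])
    also have "(LINT \<sigma>|lborel. Q s *v (V2 s \<sigma> *v g \<sigma>)) = Q s *v (back2 g s + Wi u s)"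
      unfolding eV[symmetric] by (rule integral_bounded_linear[OF bounded_linear_mv_right iV])
    finally show ?thesis unfolding Wi_def[of g] .
  qed
  have "Wi u x = (LINT \<sigma>|lborel. LINT s|lborel. ?f s \<sigma>)"
    unfolding u_def Wi_back2[OF g] e1 ..
  also have "\<dots> = (LINT s|lborel. LINT \<sigma>|lborel. ?f s \<sigma>)"
    by (rule lborel_pair.Fubini_integral[OF int])
  also have "\<dots> = (LINT s|lborel. ?k s *\<^sub>R (Q s *v (back2 g s + Wi u s) + Wi g s))" unfolding e2 ..
  finally show "Wi u x = (LINT s|lborel. ?k s *\<^sub>R (Q s *v (back2 g s + Wi u s) + Wi g s))" .
  have "integrable lborel (\<lambda>s. LINT \<sigma>|lborel. ?f s \<sigma>)" by (rule lborel_pair.integrable_fst[OF int])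
  then show "integrable lborel (\<lambda>s. ?k s *\<^sub>R (Q s *v (back2 g s + Wi u s) + Wi g s))" unfolding e2 .
qed

end

section \<open>Quadratic estimates in terms of the data\<close>

definition l2sq :: "(real \<Rightarrow> 'a::euclidean_space) \<Rightarrow> real" where
  "l2sq h = (LINT s|lborel. (norm (h s))\<^sup>2)"

lemma l2sq_nonneg: "0 \<le> l2sq h"
  by (simp add: l2sq_def)

lemma l2sq_add:
  assumes "L2_fun T f" "L2_fun T g"
  shows "l2sq (\<lambda>s. f s + g s) \<le> 2 * l2sq f + 2 * l2sq g"
proof -
  note i = L2_funD(2)[OF assms(1)] L2_funD(2)[OF assms(2)]
  have "l2sq (\<lambda>s. f s + g s) \<le> (LINT s|lborel. 2 * (norm (f s))\<^sup>2 + 2 * (norm (g s))\<^sup>2)"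
    unfolding l2sq_def
    by (rule integral_mono[OF L2_funD(2)[OF L2_fun_add[OF assms]]])
       (use i norm_add_square_le in auto)
  also have "\<dots> = 2 * l2sq f + 2 * l2sq g"
    unfolding l2sq_def using i by simp
  finally show ?thesis .
qed

lemma l2sq_uminus: "l2sq (\<lambda>s. - f s) = l2sq f"
  by (simp add: l2sq_def)

lemma l2sq_diff:
  assumes "L2_fun T f" "L2_fun T g"
  shows "l2sq (\<lambda>s. f s - g s) \<le> 2 * l2sq f + 2 * l2sq g"
  using l2sq_add[OF assms(1) L2_fun_scaleR[OF assms(2), of "-1"]] by (simp add: l2sq_uminus)

lemma L2_fun_bounded_l2sq:
  fixes f :: "real \<Rightarrow> 'a::euclidean_space"
  assumes f: "f \<in> borel_measurable borel" "\<And>x. x \<in> {0..T} \<Longrightarrow> norm (f x) \<le> M" "\<And>x. x \<notin> {0..T} \<Longrightarrow> f x = 0" and T: "T > 0"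
  shows "L2_fun T f" "l2sq f \<le> M\<^sup>2 * T"
proof -
  have M: "0 \<le> M" using order_trans[OF norm_ge_zero f(2)[of 0]] T by simp
  show L: "L2_fun T f"
    by (rule L2_fun_bounded[OF f(1) _ f(3), of M]) (use f M in fastforce)
  have "l2sq f \<le> (LINT x|lborel. M\<^sup>2 * indicator {0..T} x)"
    unfolding l2sq_def
  proof (rule integral_mono[OF L2_funD(2)[OF L]])
    show "integrable lborel (\<lambda>x. M\<^sup>2 * indicator {0..T} x)" using integrable_indicator_Icc by (rule integrable_mult_right)
    fix x show "(norm (f x))\<^sup>2 \<le> M\<^sup>2 * indicator {0..T} x"
      using f(2,3)[of x] by (cases "x \<in> {0..T}") (auto intro: power_mono)
  qed
  also have "\<dots> = M\<^sup>2 * T" using T by simp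
  finally show "l2sq f \<le> M\<^sup>2 * T" .
qed

lemma L2_fun_matrix_vector:
  fixes A :: "real \<Rightarrow> complex^'n^'n" and u :: "real \<Rightarrow> complex^'n"
  assumes c: "c \<ge> 0" "\<And>(A :: complex^'n^'n) x. norm (A *v x) \<le> norm A * norm x * c"
    and A: "L2_fun T A" and u: "u \<in> borel_measurable borel" "\<And>s. s \<in> {0..T} \<Longrightarrow> norm (u s) \<le> M" and M: "M \<ge> 0"
  shows "L2_fun T (\<lambda>s. A s *v u s)" "l2sq (\<lambda>s. A s *v u s) \<le> (M * c)\<^sup>2 * l2sq A"
proof -
  note [measurable] = L2_funD(1)[OF A] u(1)
  have le: "norm (A s *v u s) \<le> M * c * norm (A s)" for s
  proof (cases "s \<in> {0..T}")
    case True
    have "norm (A s *v u s) \<le> norm (A s) * norm (u s) * c" by (rule c)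
    also have "\<dots> \<le> norm (A s) * M * c" using u(2)[OF True] c(1) by (intro mult_right_mono mult_left_mono) auto
    finally show ?thesis by (simp add: mult_ac)
  next
    case False
    then show ?thesis using L2_funD(3)[OF A False] by (simp add: mv_zero_left)
  qed
  have sq: "(norm (A s *v u s))\<^sup>2 \<le> (M * c)\<^sup>2 * (norm (A s))\<^sup>2" for s
    unfolding power_mult_distrib[symmetric] by (rule power_mono[OF le]) simp
  have i: "integrable lborel (\<lambda>s. (M * c)\<^sup>2 * (norm (A s))\<^sup>2)" by (rule integrable_mult_right[OF L2_funD(2)[OF A]])
  show L: "L2_fun T (\<lambda>s. A s *v u s)"
    by (rule L2_fun_bound[OF _ i sq]) (use L2_funD(3)[OF A] in \<open>auto simp: mv_zero_left\<close>)
  have "l2sq (\<lambda>s. A s *v u s) \<le> (LINT s|lborel. (M * c)\<^sup>2 * (norm (A s))\<^sup>2)"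
    unfolding l2sq_def by (rule integral_mono[OF L2_funD(2)[OF L] i sq])
  then show "l2sq (\<lambda>s. A s *v u s) \<le> (M * c)\<^sup>2 * l2sq A" by (simp add: l2sq_def)
qed

lemma L2_fun_norm_integral_le:
  assumes h: "L2_fun T h" and T: "T > 0"
  shows "(LINT s|lborel. norm (h s)) \<le> sqrt T * sqrt (l2sq h)"
proof -
  have "(LINT s|lborel. norm (h s)) \<le> sqrt (T * l2sq h)"
    by (rule real_le_rsqrt) (use L2_fun_Cauchy_Schwarz[OF h T] in \<open>simp add: l2sq_def\<close>)
  then show ?thesis by (simp add: real_sqrt_mult)
qed

lemma rep_size_sqrt_bounds:
  "norm a \<le> sqrt (rep_size a b h)" "norm b \<le> sqrt (rep_size a b h)" "l2sq h \<le> rep_size a b h"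
  by (auto intro!: real_le_rsqrt rep_size_bounds simp: l2sq_def)

lemma rep_back_sup_bound:
  assumes g: "L2_fun T g" and T: "T > 0" and s: "s \<in> {0..T}"
  shows "norm (a + (T - s) *\<^sub>R b + back2 g s) \<le> (1 + T + T * sqrt T) * sqrt (rep_size a b g)"
proof -
  let ?R = "sqrt (rep_size a b g)"
  note b = rep_size_sqrt_bounds[where a=a and b=b and h=g]
  have "norm (back2 g s) \<le> T * (LINT s|lborel. norm (g s))"
    by (rule norm_back2_le[OF g]) (use s T in auto)
  also have "\<dots> \<le> T * (sqrt T * ?R)"
  proof (rule mult_left_mono)
    have "sqrt T * sqrt (l2sq g) \<le> sqrt T * ?R" using b(3) T by (intro mult_left_mono) auto
    then show "(LINT s|lborel. norm (g s)) \<le> sqrt T * ?R" using L2_fun_norm_integral_le[OF g T] by linarith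
  qed (use T in simp)
  finally have 1: "norm (back2 g s) \<le> T * sqrt T * ?R" by simp
  have 2: "norm ((T - s) *\<^sub>R b) \<le> T * ?R" unfolding norm_scaleR using s b(2) by (intro mult_mono) auto
  have "norm (a + (T - s) *\<^sub>R b + back2 g s) \<le> norm a + norm ((T - s) *\<^sub>R b) + norm (back2 g s)"
    by (rule order_trans[OF norm_triangle_ineq add_right_mono[OF norm_triangle_ineq]])
  also have "\<dots> \<le> ?R + T * ?R + T * sqrt T * ?R" by (intro add_mono b 1 2)
  finally show ?thesis by (simp add: algebra_simps)
qed

lemma prim2_reflect: "prim2 (\<lambda>r. g (T - r)) (T - s) = back2 g s"
  unfolding prim2_def back2_def
  by (subst (2) lborel_integral_real_affine[where c="-1" and t=T]) (simp_all add: algebra_simps)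

lemma L2_fun_reflect:
  assumes g: "L2_fun T g"
  shows "L2_fun T (\<lambda>r. g (T - r))" "rep_size a b (\<lambda>r. g (T - r)) = rep_size a b g"
proof -
  note [measurable] = L2_funD(1)[OF g]
  have "integrable lborel (\<lambda>r. (norm (g (T + (-1) * r)))\<^sup>2)"
    using lborel_integrable_real_affine[OF L2_funD(2)[OF g], of "-1" T] by simp
  then show "L2_fun T (\<lambda>r. g (T - r))"
    using L2_funD(3)[OF g] by (auto simp: L2_fun_def)
  show "rep_size a b (\<lambda>r. g (T - r)) = rep_size a b g"
    unfolding rep_size_def
    by (subst (2) lborel_integral_real_affine[where c="-1" and t=T]) simp_all
qed

lemma bounded_linear_vector_scale: "bounded_linear (\<lambda>x :: complex^'n. a *s x)"
  unfolding linear_conv_bounded_linear[symmetric]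
  by (auto intro!: linearI simp: vec_eq_iff algebra_simps)

section \<open>Volterra estimates and the formula for the second derivative\<close>

context wave_kernel
begin

lemma Wi_cong: "(\<And>s. s \<in> {0..T} \<Longrightarrow> u s = u' s) \<Longrightarrow> Wi u x = Wi u' x"
  unfolding Wi_def
proof (rule Bochner_Integration.integral_cong[OF refl])
  fix s assume "\<And>s. s \<in> {0..T} \<Longrightarrow> u s = u' s"
  then show "W x s *v u s = W x s *v u' s" using W_outside[of x s] by (cases "s \<in> {0..T}") (auto simp: mv_zero_left)
qed

lemma Wi_add:
  assumes "integrable lborel u" "integrable lborel u'"
  shows "Wi (\<lambda>s. u s + u' s) x = Wi u x + Wi u' x"
  unfolding Wi_def mv_add_right by (rule Bochner_Integration.integral_add[OF W_mult_integrable[OF assms(1)] W_mult_integrable[OF assms(2)]])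

lemma Wi_measurable:
  assumes [measurable]: "u \<in> borel_measurable borel"
  shows "Wi u \<in> borel_measurable borel"
  unfolding Wi_def[abs_def] by measurable

lemma Wi_outside: "x \<notin> {0..T} \<Longrightarrow> Wi u x = 0"
proof -
  assume "x \<notin> {0..T}"
  then have "W x s *v u s = 0" for s using W_outside[of x s] by (auto simp: mv_zero_left)
  then show ?thesis by (simp add: Wi_def)
qed

text \<open>\<open>gronwall_backward\<close> with a constant multiple of the indicator of
  \<open>[0,T]\<close> as kernel. With \<open>A = 0\<close> it gives injectivity, with
  \<open>A\<close> a bound of the right-hand side it gives stability of the solution.\<close>

lemma volterra_estimate:
  "\<exists>C\<ge>0. \<forall>u A M. u \<in> borel_measurable borel \<longrightarrow> (\<forall>x. norm (u x) \<le> M) \<longrightarrow> A \<ge> 0 \<longrightarrow>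
     (\<forall>x\<in>{0..T}. norm (u x) \<le> A + norm (Wi u x)) \<longrightarrow> (\<forall>x\<in>{0..T}. norm (u x) \<le> C * A)"
proof -
  obtain c where c: "c \<ge> 0" "\<And>x s (z :: complex^'n). norm (W x s *v z) \<le> c * norm z" by (rule W_mult_bound) (rule that)
  define k where "k s = c * indicator {0..T} s" for s :: real
  have "L2_fun T k" unfolding k_def by (rule L2_fun_bounded[of _ c]) (use c in \<open>auto simp: indicator_def\<close>)
  then have k: "k \<in> borel_measurable borel" "integrable lborel (\<lambda>s. (k s)\<^sup>2)" "\<And>s. s \<notin> {0..T} \<Longrightarrow> k s = 0"
    by (auto simp: L2_fun_def)
  have k0: "0 \<le> k s" for s using c by (simp add: k_def)
  obtain C where C0: "C \<ge> 0"
    and C1: "\<forall>\<phi> M A. (\<forall>x\<in>{0..T}. 0 \<le> \<phi> x \<and> \<phi> x \<le> M) \<longrightarrow> A \<ge> 0 \<longrightarrow>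
      (\<forall>x\<in>{0..T}. \<phi> x \<le> A + (LINT s|lborel. indicator {x..} s * (k s * \<phi> s))) \<longrightarrow>
      (\<forall>x\<in>{0..T}. \<phi> x \<le> C * A)"
    by (rule exE[OF gronwall_backward[where T=T, OF k(1,2) k0]]) (rule k(3), assumption, elim conjE, rule that)
  have C2: "\<phi> x \<le> C * A" if "\<And>x. x \<in> {0..T} \<Longrightarrow> 0 \<le> \<phi> x \<and> \<phi> x \<le> M" "A \<ge> 0"
    "\<And>x. x \<in> {0..T} \<Longrightarrow> \<phi> x \<le> A + (LINT s|lborel. indicator {x..} s * (k s * \<phi> s))" "x \<in> {0..T}" for \<phi> M A x
    using C1[rule_format, of \<phi> M A x] that by simp
  note C = C0 C2
  show ?thesis
  proof (rule exI[of _ C], intro conjI C(1) allI impI ballI)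
    fix u :: "real \<Rightarrow> complex^'n" and A M x
    assume u[measurable]: "u \<in> borel_measurable borel" and M': "\<forall>x. norm (u x) \<le> M" and A: "A \<ge> 0"
      and le': "\<forall>x\<in>{0..T}. norm (u x) \<le> A + norm (Wi u x)" and x: "x \<in> {0..T}"
    note M = M'[rule_format] and le = le'[rule_format]
    have M0: "0 \<le> M" using M[of 0] norm_ge_zero order_trans by blast
    have i: "integrable lborel (\<lambda>s. indicator {x..} s * (k s * norm (u s)))" for x
    proof (rule integrable_norm_le)
      show "integrable lborel (\<lambda>s. c * M * indicator {0..T} s)" using integrable_indicator_Icc by (rule integrable_mult_right)
      fix s show "norm (indicator {x..} s * (k s * norm (u s))) \<le> c * M * indicator {0..T} s"
        using M[of s] M0 c(1) by (auto simp: k_def indicator_def intro: mult_left_mono)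
    qed (use k(1) in measurable)
    have iu: "integrable lborel (\<lambda>s. indicator {0..T} s *\<^sub>R u s)"
    proof (rule integrable_norm_le)
      show "integrable lborel (\<lambda>s. M * indicator {0..T} s)" using integrable_indicator_Icc by (rule integrable_mult_right)
      fix s show "norm (indicator {0..T} s *\<^sub>R u s) \<le> M * indicator {0..T} s" using M[of s] by (auto simp: indicator_def)
    qed measurable
    show "norm (u x) \<le> C * A"
    proof (rule C(2)[of "\<lambda>x. norm (u x)" M A x])
      fix x assume x: "x \<in> {0..T}"
      show "0 \<le> norm (u x) \<and> norm (u x) \<le> M" using M by simp
      have "norm (Wi (\<lambda>s. indicator {0..T} s *\<^sub>R u s) x) \<le> (LINT s|lborel. indicator {x..} s * (k s * norm (u s)))"
        unfolding Wi_def
      proof (rule Bochner_Integration.integral_norm_bound_integral[OF W_mult_integrable[OF iu] i])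
        fix s show "norm (W x s *v indicator {0..T} s *\<^sub>R u s) \<le> indicator {x..} s * (k s * norm (u s))"
          using c(2)[of x s "u s"] W_outside[of x s] by (cases "x \<le> s \<and> s \<in> {0..T}") (auto simp: k_def mv_zero_left mv_zero_right)
      qed
      moreover have "Wi (\<lambda>s. indicator {0..T} s *\<^sub>R u s) x = Wi u x" by (rule Wi_cong) simp
      ultimately show "norm (u x) \<le> A + (LINT s|lborel. indicator {x..} s * (k s * norm (u s)))"
        using le[OF x] by simp
    qed (use A x in auto)
  qed
qed

text \<open>The hypothesis is \<open>d'' = Q d\<close> with zero data at \<open>T\<close> in
  integrated form. Gronwall is applied with \<open>A = 0\<close> and a multiple of
  \<open>norm (Q s)\<close>, which is square integrable but possibly unbounded.\<close>

lemma Q_ode_unique: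
  assumes d: "d \<in> borel_measurable borel" and bd: "\<And>x. norm (d x) \<le> M"
    and eq: "\<And>x. x \<in> {0..T} \<Longrightarrow> d x = (LINT s|lborel. max 0 (s - x) *\<^sub>R (Q s *v d s))" and x: "x \<in> {0..T}"
  shows "d x = (0 :: complex^'n)"
proof -
  note [measurable] = d
  obtain c where c: "c > 0" "\<And>(A :: complex^'n^'n) x. norm (A *v x) \<le> norm A * norm x * c"
    using norm_matrix_vector_mult_bound by blast
  have M0: "0 \<le> M" using bd[of 0] norm_ge_zero order_trans by blast
  define k where "k s = T * c * norm (Q s)" for s
  have kL: "L2_fun T k" unfolding k_def using L2_fun_scaleR[OF L2_fun_norm[OF Q], of "T * c"] by simp
  then have k: "k \<in> borel_measurable borel" "integrable lborel (\<lambda>s. (k s)\<^sup>2)" "\<And>s. s \<notin> {0..T} \<Longrightarrow> k s = 0"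
    by (auto simp: L2_fun_def)
  have k0: "0 \<le> k s" for s using c T by (simp add: k_def)
  obtain C where C0: "C \<ge> 0"
    and C1: "\<forall>\<phi> M A. (\<forall>x\<in>{0..T}. 0 \<le> \<phi> x \<and> \<phi> x \<le> M) \<longrightarrow> A \<ge> 0 \<longrightarrow>
      (\<forall>x\<in>{0..T}. \<phi> x \<le> A + (LINT s|lborel. indicator {x..} s * (k s * \<phi> s))) \<longrightarrow>
      (\<forall>x\<in>{0..T}. \<phi> x \<le> C * A)"
    by (rule exE[OF gronwall_backward[where T=T, OF k(1,2) k0]]) (rule k(3), assumption, elim conjE, rule that)
  have C2: "\<phi> x \<le> C * A" if "\<And>x. x \<in> {0..T} \<Longrightarrow> 0 \<le> \<phi> x \<and> \<phi> x \<le> M" "A \<ge> 0"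
    "\<And>x. x \<in> {0..T} \<Longrightarrow> \<phi> x \<le> A + (LINT s|lborel. indicator {x..} s * (k s * \<phi> s))" "x \<in> {0..T}" for \<phi> M A x
    using C1[rule_format, of \<phi> M A x] that by simp
  note C = C0 C2
  have Qd: "L2_fun T (\<lambda>s. Q s *v d s)"
    by (rule L2_fun_matrix_vector(1)[OF _ c(2) Q d bd M0]) (use c in simp)
  have i: "integrable lborel (\<lambda>s. indicator {x..} s * (k s * norm (d s)))" for x
  proof (rule integrable_norm_le)
    show "integrable lborel (\<lambda>s. M * norm (k s))" using L2_fun_integrable[OF kL] by (intro integrable_mult_right integrable_norm)
    fix s show "norm (indicator {x..} s * (k s * norm (d s))) \<le> M * norm (k s)"
      using bd[of s] M0 k0[of s] by (auto simp: indicator_def mult.commute[of M] intro: mult_left_mono)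
  qed (use k(1) in measurable)
  have "norm (d x) \<le> C * 0"
  proof (rule C(2)[of "\<lambda>x. norm (d x)" M 0 x])
    fix x assume x: "x \<in> {0..T}"
    show "0 \<le> norm (d x) \<and> norm (d x) \<le> M" using bd by simp
    have "norm (LINT s|lborel. max 0 (s - x) *\<^sub>R (Q s *v d s)) \<le> (LINT s|lborel. indicator {x..} s * (k s * norm (d s)))"
    proof (rule Bochner_Integration.integral_norm_bound_integral[OF _ i])
      show "integrable lborel (\<lambda>s. max 0 (s - x) *\<^sub>R (Q s *v d s))"
        by (rule L2_fun_mult_integrable(1)[OF Qd, of _ T]) (use x in auto)
      fix s show "norm (max 0 (s - x) *\<^sub>R (Q s *v d s)) \<le> indicator {x..} s * (k s * norm (d s))"
      proof (cases "x \<le> s \<and> s \<in> {0..T}")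
        case True
        have "max 0 (s - x) * norm (Q s *v d s) \<le> T * (norm (Q s) * norm (d s) * c)"
          using c(2)[of "Q s" "d s"] x True by (intro mult_mono) auto
        then show ?thesis using True by (simp add: k_def mult_ac)
      next
        case False
        then show ?thesis by (cases "s \<in> {0..T}") (auto simp: Q_outside mv_zero_left k_def)
      qed
    qed
    then show "norm (d x) \<le> 0 + (LINT s|lborel. indicator {x..} s * (k s * norm (d s)))" using eq[OF x] by simp
  qed (use x in auto)
  then show ?thesis by simp
qed

text \<open>The operator of the theorem, with the kernel extended by zero and the gauge integral
  replaced by a Lebesgue integral over the line.\<close>

definition wave_op :: "(real \<Rightarrow> complex^'n) \<Rightarrow> real \<Rightarrow> complex^'n" where
  "wave_op f = (\<lambda>x. if x \<in> {0..T} then f (T - x) + Wi (\<lambda>s. indicator {0..T} s *\<^sub>R f (T - s)) x else 0)"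

text \<open>The second derivative of the image, with \<open>a = f(0)\<close>,
  \<open>b = f'(0)\<close>, \<open>g s = f''(T - s)\<close> and the image itself as
  \<open>y\<close>. The argument \<open>y\<close> is kept separate because the proof of surjectivity
  inserts a prescribed function there.\<close>

definition wave_op_data :: "(real \<Rightarrow> complex^'n) \<Rightarrow> complex^'n \<Rightarrow> complex^'n \<Rightarrow> (real \<Rightarrow> complex^'n) \<Rightarrow> real \<Rightarrow> complex^'n" where
  "wave_op_data y a b g s = Q s *v y s + (g s + Wi g s) + W s T *v b + D s *v a"

lemma source_integrable:
  fixes a b :: "complex^'n"
  assumes g: "L2_fun T g"
  shows "(\<lambda>c. indicator {0..T} c *\<^sub>R (a + (T - c) *\<^sub>R b + back2 g c)) \<in> borel_measurable borel"
    and "norm (indicator {0..T} c *\<^sub>R (a + (T - c) *\<^sub>R b + back2 g c)) \<le> (1 + T + T * sqrt T) * sqrt (rep_size a b g)"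
    and "L2_fun T (\<lambda>c. indicator {0..T} c *\<^sub>R (a + (T - c) *\<^sub>R b + back2 g c))"
proof -
  note [measurable] = back2_measurable[OF g]
  show m: "(\<lambda>c. indicator {0..T} c *\<^sub>R (a + (T - c) *\<^sub>R b + back2 g c)) \<in> borel_measurable borel" by measurable
  show n: "norm (indicator {0..T} c *\<^sub>R (a + (T - c) *\<^sub>R b + back2 g c)) \<le> (1 + T + T * sqrt T) * sqrt (rep_size a b g)" for c
    using rep_back_sup_bound[OF g T, of c a b] rep_size_nonneg[of a b g] T by (cases "c \<in> {0..T}") auto
  show "L2_fun T (\<lambda>c. indicator {0..T} c *\<^sub>R (a + (T - c) *\<^sub>R b + back2 g c))"
    by (rule L2_fun_bounded[OF m n]) auto
qed

text \<open>The source is the sum of a constant, a linear function and a superposition of ramps; the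
  three wave equations are added. Each potential term contains a summand of the incident wave
  together with its response, so together they give \<open>Q s *v y s\<close>.\<close>

lemma wave_op_formula:
  fixes a b :: "complex^'n"
  assumes g: "L2_fun T g" and f: "\<And>s. s \<in> {0..T} \<Longrightarrow> f (T - s) = a + (T - s) *\<^sub>R b + back2 g s" and x: "x \<in> {0..T}"
  shows "wave_op f x = a + (T - x) *\<^sub>R (b + c0 *v a) + back2 (wave_op_data (wave_op f) a b g) x"
proof -
  let ?u1 = "\<lambda>c. indicator {0..T} c *\<^sub>R a" and ?u2 = "\<lambda>c. indicator {0..T} c *\<^sub>R (T - c) *\<^sub>R b"
    and ?u3 = "\<lambda>c. indicator {0..T} c *\<^sub>R back2 g c"
  have z: "L2_fun T (\<lambda>_. 0 :: complex^'n)" by (simp add: L2_fun_def)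
  have b20: "back2 (\<lambda>_. 0 :: complex^'n) c = 0" for c by (simp add: back2_def)
  have i1: "integrable lborel ?u1" using L2_fun_integrable[OF source_integrable(3)[OF z, of a 0]] by (simp add: b20)
  have i2: "integrable lborel ?u2" using L2_fun_integrable[OF source_integrable(3)[OF z, of 0 b]] by (simp add: b20)
  have i3: "integrable lborel ?u3" using L2_fun_integrable[OF source_integrable(3)[OF g, of 0 0]] by simp
  have Wsum: "Wi (\<lambda>s. indicator {0..T} s *\<^sub>R f (T - s)) x = Wi ?u1 x + Wi ?u2 x + Wi ?u3 x" for x
  proof -
    have "Wi (\<lambda>s. indicator {0..T} s *\<^sub>R f (T - s)) x = Wi (\<lambda>s. ?u1 s + ?u2 s + ?u3 s) x"
      by (rule Wi_cong) (simp add: f)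
    also have "\<dots> = Wi (\<lambda>s. ?u1 s + ?u2 s) x + Wi ?u3 x"
      by (rule Wi_add[OF Bochner_Integration.integrable_add[OF i1 i2] i3])
    also have "Wi (\<lambda>s. ?u1 s + ?u2 s) x = Wi ?u1 x + Wi ?u2 x" by (rule Wi_add[OF i1 i2])
    finally show ?thesis .
  qed
  have y: "wave_op f s = (a + Wi ?u1 s) + ((T - s) *\<^sub>R b + Wi ?u2 s) + (back2 g s + Wi ?u3 s)" if "s \<in> {0..T}" for s
    using that f[OF that] by (simp add: wave_op_def Wsum algebra_simps)
  let ?k1 = "\<lambda>s. Q s *v (a + Wi ?u1 s) + D s *v a" and ?k2 = "\<lambda>s. Q s *v ((T - s) *\<^sub>R b + Wi ?u2 s) + W s T *v b"
    and ?k3 = "\<lambda>s. Q s *v (back2 g s + Wi ?u3 s) + Wi g s"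
  have pt: "wave_op_data (wave_op f) a b g s = ?k1 s + ?k2 s + ?k3 s + g s" for s
  proof (cases "s \<in> {0..T}")
    case True
    then show ?thesis unfolding wave_op_data_def y[OF True] by (simp only: mv_add_right) (simp add: algebra_simps)
  next
    case False
    then show ?thesis unfolding wave_op_data_def by (simp add: Q_outside mv_zero_left algebra_simps)
  qed
  note A = W1_wave_vector[OF x, of a] and Bb = W2_wave_vector[OF x, of b] and Cc = back2_wave_vector[OF g x]
  let ?m = "\<lambda>s. max 0 (s - x)"
  have ig: "integrable lborel (\<lambda>s. ?m s *\<^sub>R g s)"
    by (rule L2_fun_mult_integrable(1)[OF g, of _ T]) (use x in auto)
  note i12 = Bochner_Integration.integrable_add[OF A(2) Bb(2)]
  note i123 = Bochner_Integration.integrable_add[OF i12 Cc(2)]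
  have "back2 (wave_op_data (wave_op f) a b g) x = (LINT s|lborel. ?m s *\<^sub>R ?k1 s + ?m s *\<^sub>R ?k2 s + ?m s *\<^sub>R ?k3 s + ?m s *\<^sub>R g s)"
    unfolding back2_def pt scaleR_add_right ..
  also have "\<dots> = (LINT s|lborel. ?m s *\<^sub>R ?k1 s) + (LINT s|lborel. ?m s *\<^sub>R ?k2 s) + (LINT s|lborel. ?m s *\<^sub>R ?k3 s) + (LINT s|lborel. ?m s *\<^sub>R g s)"
    by (simp only: Bochner_Integration.integral_add[OF i123 ig] Bochner_Integration.integral_add[OF i12 Cc(2)]
        Bochner_Integration.integral_add[OF A(2) Bb(2)])
  also have "(LINT s|lborel. ?m s *\<^sub>R g s) = back2 g x" by (simp add: back2_def)
  finally have E: "back2 (wave_op_data (wave_op f) a b g) x = (LINT s|lborel. ?m s *\<^sub>R ?k1 s) + (LINT s|lborel. ?m s *\<^sub>R ?k2 s) + (LINT s|lborel. ?m s *\<^sub>R ?k3 s) + back2 g x" .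
  show ?thesis unfolding E y[OF x] A(1) Bb(1) Cc(1) by (simp add: algebra_simps)
qed

end

lemma rep_size_eq: "rep_size a b h = (norm a)\<^sup>2 + (norm b)\<^sup>2 + l2sq h"
  by (simp add: rep_size_def l2sq_def)

section \<open>Boundedness, surjectivity and injectivity in \<open>H\<^sup>2\<close>\<close>

context wave_kernel
begin

lemma Wi_bound:
  obtains c where "c \<ge> 0" "\<And>g x. L2_fun T g \<Longrightarrow> norm (Wi g x) \<le> c * (LINT s|lborel. norm (g s))"
proof -
  obtain c where c: "c \<ge> 0" "\<And>x (h :: real \<Rightarrow> complex^'n). integrable lborel h \<Longrightarrow> norm (LINT s|lborel. W x s *v h s) \<le> c * (LINT s|lborel. norm (h s))"
    by (rule W_int_bound) blast
  show thesis by (rule that[OF c(1)]) (simp add: Wi_def c(2)[OF L2_fun_integrable])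
qed

lemma Wi_l2sq:
  obtains C where "C \<ge> 0" "\<And>g. L2_fun T g \<Longrightarrow> L2_fun T (Wi g)" "\<And>g. L2_fun T g \<Longrightarrow> l2sq (Wi g) \<le> C * l2sq g"
proof -
  obtain c where c: "c \<ge> 0" "\<And>g x. L2_fun T g \<Longrightarrow> norm (Wi g x) \<le> c * (LINT s|lborel. norm (g s))"
    by (rule Wi_bound) blast
  show thesis
  proof (rule that[of "c\<^sup>2 * T\<^sup>2"])
    fix g :: "real \<Rightarrow> complex^'n" assume g: "L2_fun T g"
    define I where "I = (LINT s|lborel. norm (g s))"
    have le: "norm (Wi g x) \<le> c * I" for x unfolding I_def by (rule c(2)[OF g])
    note b = L2_fun_bounded_l2sq[OF Wi_measurable[OF L2_funD(1)[OF g]] le Wi_outside T]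
    show "L2_fun T (Wi g)" by (rule b)
    have "I\<^sup>2 \<le> T * l2sq g" unfolding I_def l2sq_def by (rule L2_fun_Cauchy_Schwarz[OF g T])
    then have "c\<^sup>2 * I\<^sup>2 * T \<le> c\<^sup>2 * (T * l2sq g) * T" using T by (intro mult_right_mono mult_left_mono) auto
    then show "l2sq (Wi g) \<le> c\<^sup>2 * T\<^sup>2 * l2sq g" using b(2) by (simp add: power_mult_distrib power2_eq_square mult_ac)
  qed simp
qed

text \<open>The fixed point argument requires a continuous right-hand side, but \<open>r\<close> is
  only square integrable. The ansatz \<open>g = r + u\<close> leaves
  \<open>u + Wi u = - Wi r\<close>, and \<open>Wi r\<close> is continuous.\<close>

lemma volterra_L2_solvable:
  obtains C where "C \<ge> 0" "\<And>r. L2_fun T r \<Longrightarrow> \<exists>g. L2_fun T g \<and> (\<forall>s. g s + Wi g s = r s) \<and> l2sq g \<le> C * l2sq r"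
proof -
  obtain c where c: "c \<ge> 0" "\<And>g x. L2_fun T g \<Longrightarrow> norm (Wi g x) \<le> c * (LINT s|lborel. norm (g s))"
    by (rule Wi_bound) blast
  obtain Cv where Cv: "Cv \<ge> 0" "\<forall>u A M. u \<in> borel_measurable borel \<longrightarrow> (\<forall>x. norm (u x) \<le> M) \<longrightarrow> A \<ge> 0 \<longrightarrow>
     (\<forall>x\<in>{0..T}. norm (u x) \<le> A + norm (Wi u x)) \<longrightarrow> (\<forall>x\<in>{0..T}. norm (u x) \<le> Cv * A)"
    using volterra_estimate by (elim exE conjE) (rule that)
  show thesis
  proof (rule that[of "2 + 2 * ((Cv * c)\<^sup>2 * T\<^sup>2)"])
    fix r :: "real \<Rightarrow> complex^'n" assume r: "L2_fun T r"
    define I where "I = (LINT s|lborel. norm (r s))"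
    have I0: "0 \<le> I" by (simp add: I_def)
    have "continuous_on {0..T} (\<lambda>x. - Wi r x)"
      unfolding Wi_def by (intro continuous_intros continuous_on_W_int L2_fun_integrable[OF r])
    then obtain u where u: "u \<in> borel_measurable borel" "continuous_on {0..T} u" "\<And>x. x \<notin> {0..T} \<Longrightarrow> u x = 0"
      "\<And>x. x \<in> {0..T} \<Longrightarrow> u x + Wi u x = - Wi r x"
      by (rule volterra_solvable[folded Wi_def]) (rule that)
    have "bounded (u ` {0..T})" by (intro compact_imp_bounded compact_continuous_image u(2)) auto
    then obtain M0 where M0: "\<And>x. x \<in> {0..T} \<Longrightarrow> norm (u x) \<le> M0" unfolding bounded_iff by blast
    have M: "norm (u x) \<le> \<bar>M0\<bar>" for x using M0[of x] u(3)[of x] by (cases "x \<in> {0..T}") auto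
    have "norm (u x) \<le> c * I + norm (Wi u x)" if "x \<in> {0..T}" for x
    proof -
      have "u x = - Wi r x - Wi u x" using u(4)[OF that] by (simp add: algebra_simps)
      then have "norm (u x) \<le> norm (Wi r x) + norm (Wi u x)" using norm_triangle_ineq4[of "- Wi r x" "Wi u x"] by simp
      then show ?thesis using c(2)[OF r, of x] by (simp add: I_def)
    qed
    then have ub: "norm (u x) \<le> Cv * (c * I)" if "x \<in> {0..T}" for x
      using Cv(2)[rule_format, of u "\<bar>M0\<bar>" "c * I" x] u(1) M c(1) I0 that by simp
    have uL: "L2_fun T u" "l2sq u \<le> (Cv * (c * I))\<^sup>2 * T" by (rule L2_fun_bounded_l2sq[OF u(1) ub u(3) T]; assumption)+
    have "I\<^sup>2 \<le> T * l2sq r" unfolding I_def l2sq_def by (rule L2_fun_Cauchy_Schwarz[OF r T])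
    then have "(Cv * c)\<^sup>2 * I\<^sup>2 * T \<le> (Cv * c)\<^sup>2 * (T * l2sq r) * T" using T by (intro mult_right_mono mult_left_mono) auto
    then have u2: "l2sq u \<le> (Cv * c)\<^sup>2 * T\<^sup>2 * l2sq r" using uL(2) by (simp add: power_mult_distrib power2_eq_square mult_ac)
    have "l2sq (\<lambda>s. r s + u s) \<le> 2 * l2sq r + 2 * l2sq u" by (rule l2sq_add[OF r uL(1)])
    also have "\<dots> \<le> (2 + 2 * ((Cv * c)\<^sup>2 * T\<^sup>2)) * l2sq r" using u2 by (simp add: algebra_simps)
    finally have s: "l2sq (\<lambda>s. r s + u s) \<le> (2 + 2 * ((Cv * c)\<^sup>2 * T\<^sup>2)) * l2sq r" .
    have "(r s + u s) + Wi (\<lambda>s. r s + u s) s = r s" for s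
    proof (cases "s \<in> {0..T}")
      case True
      have "Wi (\<lambda>s. r s + u s) s = Wi r s + Wi u s" by (rule Wi_add[OF L2_fun_integrable[OF r] L2_fun_integrable[OF uL(1)]])
      then have "(r s + u s) + Wi (\<lambda>s. r s + u s) s = r s + (u s + Wi u s) + Wi r s" by (simp add: algebra_simps)
      then show ?thesis unfolding u(4)[OF True] by simp
    next
      case False
      then show ?thesis using u(3) by (simp add: Wi_outside)
    qed
    then show "\<exists>g. L2_fun T g \<and> (\<forall>s. g s + Wi g s = r s) \<and> l2sq g \<le> (2 + 2 * ((Cv * c)\<^sup>2 * T\<^sup>2)) * l2sq r"
      using s L2_fun_add[OF r uL(1)] by (intro exI[of _ "\<lambda>s. r s + u s"]) auto
  qed simp
qed

text \<open>The potential term is measured by the supremum \<open>R\<close> of \<open>y\<close>, as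
  \<open>Q\<close> is square integrable; all other terms are measured by the data.\<close>

lemma wave_op_data_bound:
  obtains C where "C \<ge> 0" "\<And>y a b g R. L2_fun T g \<Longrightarrow> y \<in> borel_measurable borel \<Longrightarrow> (\<forall>s\<in>{0..T}. norm (y s) \<le> R) \<Longrightarrow> R \<ge> 0 \<Longrightarrow>
    L2_fun T (wave_op_data y a b g) \<and> l2sq (wave_op_data y a b g) \<le> C * (R\<^sup>2 + rep_size a b g)"
proof -
  obtain cv where cv: "cv > 0" "\<And>(A :: complex^'n^'n) x. norm (A *v x) \<le> norm A * norm x * cv"
    using norm_matrix_vector_mult_bound by blast
  have cv0: "cv \<ge> 0" using cv by simp
  obtain c where c: "c \<ge> 0" "\<And>x s (z :: complex^'n). norm (W x s *v z) \<le> c * norm z" by (rule W_mult_bound) (rule that)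
  obtain Cw where Cw: "Cw \<ge> 0" "\<And>g. L2_fun T g \<Longrightarrow> L2_fun T (Wi g)" "\<And>g. L2_fun T g \<Longrightarrow> l2sq (Wi g) \<le> Cw * l2sq g"
    by (rule Wi_l2sq) blast
  \<comment> \<open>Each of the three additions doubles the squared norms, whence the factors 8, 8,
    4 and 2; the summand \<open>g s + Wi g s\<close> is itself a sum, which makes its factor
    16.\<close>
  define C where "C = 8 * (cv\<^sup>2 * l2sq Q) + (16 + 16 * Cw) + 4 * (c\<^sup>2 * T) + 2 * (cv\<^sup>2 * l2sq D)"
  show thesis
  proof (rule that[of C])
    show "0 \<le> C" using Cw(1) T l2sq_nonneg[of Q] l2sq_nonneg[of D] by (simp add: C_def)
    fix y :: "real \<Rightarrow> complex^'n" and a b :: "complex^'n" and g :: "real \<Rightarrow> complex^'n" and R :: real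
    assume g: "L2_fun T g" and y: "y \<in> borel_measurable borel" "\<forall>s\<in>{0..T}. norm (y s) \<le> R" and R: "R \<ge> 0"
    define S where "S = rep_size a b g"
    have S: "(norm a)\<^sup>2 \<le> S" "(norm b)\<^sup>2 \<le> S" "l2sq g \<le> S" "0 \<le> S"
      by (simp_all add: S_def rep_size_eq l2sq_nonneg)
    have 1: "L2_fun T (\<lambda>s. Q s *v y s)" "l2sq (\<lambda>s. Q s *v y s) \<le> (R * cv)\<^sup>2 * l2sq Q"
      by (rule L2_fun_matrix_vector[OF cv0 cv(2) Q y(1) _ R]; use y(2) in simp)+
    have 2: "L2_fun T (\<lambda>s. g s + Wi g s)" by (rule L2_fun_add[OF g Cw(2)[OF g]])
    have 2: "L2_fun T (\<lambda>s. g s + Wi g s)" "l2sq (\<lambda>s. g s + Wi g s) \<le> 2 * S + 2 * (Cw * S)"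
    proof (rule L2_fun_add[OF g Cw(2)[OF g]])
      have "Cw * l2sq g \<le> Cw * S" using S(3) Cw(1) by (rule mult_left_mono)
      then show "l2sq (\<lambda>s. g s + Wi g s) \<le> 2 * S + 2 * (Cw * S)"
        using l2sq_add[OF g Cw(2)[OF g]] Cw(3)[OF g] S(3) by linarith
    qed
    have 3: "L2_fun T (\<lambda>s. W s T *v b)" "l2sq (\<lambda>s. W s T *v b) \<le> (c * norm b)\<^sup>2 * T"
    proof -
      have "(\<lambda>s. W s T *v b) \<in> borel_measurable borel" by measurable
      moreover have "W s T *v b = 0" if "s \<notin> {0..T}" for s using that W_outside[of s T] by (auto simp: mv_zero_left)
      ultimately show "L2_fun T (\<lambda>s. W s T *v b)" "l2sq (\<lambda>s. W s T *v b) \<le> (c * norm b)\<^sup>2 * T"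
        using L2_fun_bounded_l2sq[of "\<lambda>s. W s T *v b" T "c * norm b"] c(2) T by blast+
    qed
    have 4: "L2_fun T (\<lambda>s. D s *v a)" "l2sq (\<lambda>s. D s *v a) \<le> (norm a * cv)\<^sup>2 * l2sq D"
      by (rule L2_fun_matrix_vector[OF cv0 cv(2) L2_fun_D, of "\<lambda>_. a" "norm a"]; simp)+
    have L: "L2_fun T (wave_op_data y a b g)"
      unfolding wave_op_data_def[abs_def] by (rule L2_fun_add[OF L2_fun_add[OF L2_fun_add[OF 1(1) 2(1)] 3(1)] 4(1)])
    define qy qg qb qa where "qy = l2sq (\<lambda>s. Q s *v y s)" and "qg = l2sq (\<lambda>s. g s + Wi g s)"
      and "qb = l2sq (\<lambda>s. W s T *v b)" and "qa = l2sq (\<lambda>s. D s *v a)"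
    note q = qy_def[symmetric] qg_def[symmetric] qb_def[symmetric] qa_def[symmetric]
    note 1 = 1[unfolded q] and 2 = 2[unfolded q] and 3 = 3[unfolded q] and 4 = 4[unfolded q]
    have "l2sq (wave_op_data y a b g) \<le> 8 * qy + 8 * qg + 4 * qb + 2 * qa"
    proof -
      define p2 p3 where "p2 = l2sq (\<lambda>s. Q s *v y s + (g s + Wi g s))" and "p3 = l2sq (\<lambda>s. Q s *v y s + (g s + Wi g s) + W s T *v b)"
      have "l2sq (wave_op_data y a b g) \<le> 2 * p3 + 2 * qa" unfolding p3_def
        unfolding wave_op_data_def[abs_def] qa_def by (rule l2sq_add[OF L2_fun_add[OF L2_fun_add[OF 1(1) 2(1)] 3(1)] 4(1)])
      moreover have "p3 \<le> 2 * p2 + 2 * qb"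
        unfolding p3_def p2_def qb_def by (rule l2sq_add[OF L2_fun_add[OF 1(1) 2(1)] 3(1)])
      moreover have "p2 \<le> 2 * qy + 2 * qg"
        unfolding p2_def qy_def qg_def by (rule l2sq_add[OF 1(1) 2(1)])
      ultimately show ?thesis by linarith
    qed
    moreover have "qy \<le> R\<^sup>2 * (cv\<^sup>2 * l2sq Q)" using 1(2) by (simp add: power_mult_distrib mult_ac)
    moreover have "qb \<le> S * (c\<^sup>2 * T)"
    proof -
      have "(norm b)\<^sup>2 * (c\<^sup>2 * T) \<le> S * (c\<^sup>2 * T)" using S(2) T by (intro mult_right_mono) auto
      then show ?thesis using 3(2) by (simp add: power_mult_distrib mult_ac)
    qed
    moreover have "qa \<le> S * (cv\<^sup>2 * l2sq D)"
    proof -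
      have "(norm a)\<^sup>2 * (cv\<^sup>2 * l2sq D) \<le> S * (cv\<^sup>2 * l2sq D)" using S(1) l2sq_nonneg[of D] by (intro mult_right_mono) auto
      then show ?thesis using 4(2) by (simp add: power_mult_distrib mult_ac)
    qed
    ultimately have "l2sq (wave_op_data y a b g) \<le> 8 * (R\<^sup>2 * (cv\<^sup>2 * l2sq Q)) + 16 * S + 16 * (Cw * S) + 4 * (S * (c\<^sup>2 * T)) + 2 * (S * (cv\<^sup>2 * l2sq D))"
      using 2(2) by linarith
    also have "\<dots> \<le> C * (R\<^sup>2 + S)"
    proof -
      have "0 \<le> S * (8 * (cv\<^sup>2 * l2sq Q))" "0 \<le> R\<^sup>2 * ((16 + 16 * Cw) + 4 * (c\<^sup>2 * T) + 2 * (cv\<^sup>2 * l2sq D))"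
        using S(4) l2sq_nonneg[of Q] l2sq_nonneg[of D] Cw(1) T by (intro mult_nonneg_nonneg add_nonneg_nonneg; simp)+
      then show ?thesis unfolding C_def by (simp add: algebra_simps)
    qed
    finally show "L2_fun T (wave_op_data y a b g) \<and> l2sq (wave_op_data y a b g) \<le> C * (R\<^sup>2 + rep_size a b g)"
      using L by (simp add: S_def)
  qed
qed

lemma wave_op_eq_source:
  assumes f: "\<And>s. s \<in> {0..T} \<Longrightarrow> f (T - s) = a + (T - s) *\<^sub>R b + back2 g s"
  defines "p \<equiv> \<lambda>c. indicator {0..T} c *\<^sub>R (a + (T - c) *\<^sub>R b + back2 g c)"
  shows "wave_op f x = p x + Wi p x"
proof -
  have "Wi (\<lambda>s. indicator {0..T} s *\<^sub>R f (T - s)) x = Wi p x"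
    by (rule Wi_cong) (simp add: p_def f)
  then show ?thesis using f by (cases "x \<in> {0..T}") (auto simp: wave_op_def p_def Wi_outside)
qed

lemma H2_source:
  assumes "H2_rep T f a b h"
  shows "L2_fun T (\<lambda>r. h (T - r))" "\<And>s. s \<in> {0..T} \<Longrightarrow> f (T - s) = a + (T - s) *\<^sub>R b + back2 (\<lambda>r. h (T - r)) s"
    "rep_size a b (\<lambda>r. h (T - r)) = rep_size a b h"
proof -
  have h: "L2_fun T h" using assms by (simp add: H2_rep_def)
  show "L2_fun T (\<lambda>r. h (T - r))" "rep_size a b (\<lambda>r. h (T - r)) = rep_size a b h" by (rule L2_fun_reflect[OF h])+
  fix s assume "s \<in> {0..T}"
  then have "f (T - s) = a + (T - s) *\<^sub>R b + prim2 h (T - s)" using assms by (simp add: H2_rep_def)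
  then show "f (T - s) = a + (T - s) *\<^sub>R b + back2 (\<lambda>r. h (T - r)) s"
    using prim2_reflect[of "\<lambda>r. h (T - r)" T s] by simp
qed

text \<open>A bound straight from the definition of the operator. It breaks the circle in
  \<open>wave_op_formula\<close>, where the image occurs on both sides.\<close>

lemma wave_op_sup_bound:
  obtains K where "K \<ge> 0" "\<And>f a b g x. L2_fun T g \<Longrightarrow> (\<forall>s\<in>{0..T}. f (T - s) = a + (T - s) *\<^sub>R b + back2 g s) \<Longrightarrow>
    wave_op f \<in> borel_measurable borel \<and> norm (wave_op f x) \<le> K * sqrt (rep_size a b g)"
proof -
  obtain c where c: "c \<ge> 0" "\<And>g x. L2_fun T g \<Longrightarrow> norm (Wi g x) \<le> c * (LINT s|lborel. norm (g s))"
    by (rule Wi_bound) blast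
  define K0 where "K0 = 1 + T + T * sqrt T"
  have K0: "K0 \<ge> 0" using T by (simp add: K0_def)
  show thesis
  proof (rule that[of "K0 + c * (K0 * T)"])
    show "0 \<le> K0 + c * (K0 * T)" using K0 c T by simp
    fix f :: "real \<Rightarrow> complex^'n" and a b g x
    assume g: "L2_fun T g" and f: "\<forall>s\<in>{0..T}. f (T - s) = a + (T - s) *\<^sub>R b + back2 g s"
    define p where "p c = indicator {0..T} c *\<^sub>R (a + (T - c) *\<^sub>R b + back2 g c)" for c
    define R where "R = sqrt (rep_size a b g)"
    note p = source_integrable[where a=a and b=b, OF g, folded p_def K0_def, folded R_def]
    have wave_op: "wave_op f x = p x + Wi p x" for x unfolding p_def by (rule wave_op_eq_source) (use f in blast)
    have "(LINT s|lborel. norm (p s)) \<le> (LINT s|lborel. (K0 * R) * indicator {0..T} s)"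
    proof (rule integral_mono)
      show "integrable lborel (\<lambda>s. norm (p s))" using L2_fun_integrable[OF p(3)] by (rule integrable_norm)
      show "integrable lborel (\<lambda>s. (K0 * R) * indicator {0..T} s)" using integrable_indicator_Icc by (rule integrable_mult_right)
      fix s show "norm (p s) \<le> (K0 * R) * indicator {0..T} s"
        using p(2)[of s] by (cases "s \<in> {0..T}") (auto simp: p_def)
    qed
    also have "\<dots> = K0 * R * T" using T by simp
    finally have "norm (Wi p x) \<le> c * (K0 * R * T)" using c(2)[OF p(3), of x] c(1) by (meson mult_left_mono order_trans)
    then have "norm (wave_op f x) \<le> K0 * R + c * (K0 * R * T)"
      unfolding wave_op using p(2)[of x] by (intro order_trans[OF norm_triangle_ineq] add_mono)
    moreover have "wave_op f \<in> borel_measurable borel"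
    proof -
      have "(\<lambda>x. p x + Wi p x) \<in> borel_measurable borel"
        using p(1) Wi_measurable[OF p(1)] by (rule borel_measurable_add)
      moreover have "wave_op f = (\<lambda>x. p x + Wi p x)" using wave_op by blast
      ultimately show ?thesis by simp
    qed
    ultimately show "wave_op f \<in> borel_measurable borel \<and> norm (wave_op f x) \<le> (K0 + c * (K0 * T)) * sqrt (rep_size a b g)"
      by (simp add: R_def algebra_simps)
  qed
qed

lemma c0_bound:
  obtains k where "k \<ge> 0" "\<And>a :: complex^'n. (norm (c0 *v a))\<^sup>2 \<le> k * (norm a)\<^sup>2"
proof -
  obtain cv where cv: "cv > 0" "\<And>(A :: complex^'n^'n) x. norm (A *v x) \<le> norm A * norm x * cv"
    using norm_matrix_vector_mult_bound by blast
  show thesis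
  proof (rule that[of "(norm c0 * cv)\<^sup>2"])
    fix a :: "complex^'n"
    have "(norm (c0 *v a))\<^sup>2 \<le> (norm c0 * norm a * cv)\<^sup>2" by (rule power_mono[OF cv(2)]) simp
    then show "(norm (c0 *v a))\<^sup>2 \<le> (norm c0 * cv)\<^sup>2 * (norm a)\<^sup>2" by (simp add: power_mult_distrib mult_ac)
  qed simp
qed

lemma wave_op_H2_bound:
  obtains C where "C \<ge> 0" "\<And>f. f \<in> H2 T \<Longrightarrow> wave_op f \<in> H2 T \<and> (H2_norm T (wave_op f))\<^sup>2 \<le> C * (H2_norm T f)\<^sup>2"
proof -
  obtain C1 where C1: "C1 \<ge> 0" "\<And>(y :: real \<Rightarrow> complex^'n) a b h. H2_rep T y a b h \<Longrightarrow> rep_size a b h \<le> C1 * (H2_norm T y)\<^sup>2"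
    by (rule rep_size_le_H2_norm[OF T]) blast
  obtain C2 where C2: "C2 \<ge> 0" "\<And>(y :: real \<Rightarrow> complex^'n) a b h. H2_rep_back T y a b h \<Longrightarrow>
    y \<in> H2 T \<and> (H2_norm T y)\<^sup>2 \<le> C2 * rep_size a b h"
    by (rule H2_rep_back_bound[OF T]) blast
  obtain C3 where C3: "C3 \<ge> 0" "\<And>y a b g R. L2_fun T g \<Longrightarrow> y \<in> borel_measurable borel \<Longrightarrow> (\<forall>s\<in>{0..T}. norm (y s) \<le> R) \<Longrightarrow> R \<ge> 0 \<Longrightarrow>
    L2_fun T (wave_op_data y a b g) \<and> l2sq (wave_op_data y a b g) \<le> C3 * (R\<^sup>2 + rep_size a b g)"
    by (rule wave_op_data_bound) blast
  obtain K where K: "K \<ge> 0" "\<And>f a b g x. L2_fun T g \<Longrightarrow> (\<forall>s\<in>{0..T}. f (T - s) = a + (T - s) *\<^sub>R b + back2 g s) \<Longrightarrow>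
    wave_op f \<in> borel_measurable borel \<and> norm (wave_op f x) \<le> K * sqrt (rep_size a b g)"
    by (rule wave_op_sup_bound) blast
  obtain k where k: "k \<ge> 0" "\<And>a :: complex^'n. (norm (c0 *v a))\<^sup>2 \<le> k * (norm a)\<^sup>2" by (rule c0_bound) blast
  \<comment> \<open>The three summands belong to the value at \<open>T\<close>, to the derivative at
    \<open>T\<close> including the contribution of \<open>c0\<close>, and to the second
    derivative.\<close>
  define C4 where "C4 = 1 + (2 + 2 * k) + C3 * (K\<^sup>2 + 1)"
  have C4: "C4 \<ge> 0" using k C3 by (simp add: C4_def)
  show thesis
  proof (rule that[of "C2 * (C4 * C1)"])
    show "0 \<le> C2 * (C4 * C1)" using C1 C2 C4 by simp
    fix f :: "real \<Rightarrow> complex^'n" assume "f \<in> H2 T"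
    then obtain a b h where fr: "H2_rep T f a b h" by (rule H2_imp_rep[OF T])
    define g where "g r = h (T - r)" for r
    note src = H2_source[OF fr, folded g_def]
    define S where "S = rep_size a b g"
    have S: "(norm a)\<^sup>2 \<le> S" "(norm b)\<^sup>2 \<le> S" "0 \<le> S" by (simp_all add: S_def rep_size_eq l2sq_nonneg)
    have y: "wave_op f \<in> borel_measurable borel" "\<forall>s\<in>{0..T}. norm (wave_op f s) \<le> K * sqrt S"
      using K(2)[OF src(1), of f a b] src(2) unfolding S_def by blast+
    let ?d = "wave_op_data (wave_op f) a b g"
    have d: "L2_fun T ?d" "l2sq ?d \<le> C3 * ((K * sqrt S)\<^sup>2 + S)"
      using C3(2)[OF src(1) y, of a b] K(1) S(3) unfolding S_def by auto
    have rep: "H2_rep_back T (wave_op f) a (b + c0 *v a) ?d"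
      unfolding H2_rep_back_def using d(1) wave_op_formula[OF src(1,2)] by (auto simp: wave_op_def[of f])
    have "rep_size a (b + c0 *v a) ?d \<le> C4 * S"
    proof -
      have "k * (norm a)\<^sup>2 \<le> k * S" using S(1) k(1) by (rule mult_left_mono)
      then have "(norm (b + c0 *v a))\<^sup>2 \<le> 2 * S + 2 * (k * S)"
        using norm_add_square_le[of b "c0 *v a"] k(2)[of a] S(2) by linarith
      moreover have "l2sq ?d \<le> C3 * (K\<^sup>2 + 1) * S" using d(2) S(3) by (simp add: power_mult_distrib algebra_simps)
      ultimately have "rep_size a (b + c0 *v a) ?d \<le> S + (2 * S + 2 * (k * S)) + C3 * (K\<^sup>2 + 1) * S"
        unfolding rep_size_eq using S(1) by linarith
      also have "\<dots> = C4 * S" by (simp add: C4_def algebra_simps)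
      finally show ?thesis .
    qed
    also have "\<dots> \<le> C4 * (C1 * (H2_norm T f)\<^sup>2)"
      unfolding S_def src(3) by (rule mult_left_mono[OF C1(2)[OF fr] C4])
    finally have "C2 * rep_size a (b + c0 *v a) ?d \<le> C2 * (C4 * (C1 * (H2_norm T f)\<^sup>2))"
      using C2(1) by (rule mult_left_mono)
    then show "wave_op f \<in> H2 T \<and> (H2_norm T (wave_op f))\<^sup>2 \<le> C2 * (C4 * C1) * (H2_norm T f)\<^sup>2"
      using C2(2)[OF rep] by (simp add: mult.assoc)
  qed
qed

text \<open>With the prescribed \<open>y\<close> in the potential term, the unknown enters the
  relation for \<open>y''\<close> only through \<open>g + Wi g\<close>, so the relation becomes a
  Volterra equation for \<open>g\<close>. That the image of the resulting \<open>f\<close> is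
  \<open>y\<close> is not built in and is proved afterwards.\<close>

lemma wave_op_H2_surj:
  obtains C where "C \<ge> 0" "\<And>y. y \<in> H2 T \<Longrightarrow> \<exists>f\<in>H2 T. wave_op f = y \<and> (H2_norm T f)\<^sup>2 \<le> C * (H2_norm T y)\<^sup>2"
proof -
  obtain C1 where C1: "C1 \<ge> 0" "\<And>y :: real \<Rightarrow> complex^'n. y \<in> H2 T \<Longrightarrow>
    \<exists>a b h. H2_rep_back T y a b h \<and> rep_size a b h \<le> C1 * (H2_norm T y)\<^sup>2"
    by (rule H2_obtain_rep_back[OF T]) blast
  obtain C2 where C2: "C2 \<ge> 0" "\<And>(y :: real \<Rightarrow> complex^'n) a b h. H2_rep T y a b h \<Longrightarrow> (H2_norm T y)\<^sup>2 \<le> C2 * rep_size a b h"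
    by (rule H2_norm_le_rep_size[OF T]) blast
  obtain C3 where C3: "C3 \<ge> 0" "\<And>y a b g R. L2_fun T g \<Longrightarrow> y \<in> borel_measurable borel \<Longrightarrow> (\<forall>s\<in>{0..T}. norm (y s) \<le> R) \<Longrightarrow> R \<ge> 0 \<Longrightarrow>
    L2_fun T (wave_op_data y a b g) \<and> l2sq (wave_op_data y a b g) \<le> C3 * (R\<^sup>2 + rep_size a b g)"
    by (rule wave_op_data_bound) blast
  obtain C5 where C5: "C5 \<ge> 0" "\<And>r. L2_fun T r \<Longrightarrow> \<exists>g. L2_fun T g \<and> (\<forall>s. g s + Wi g s = r s) \<and> l2sq g \<le> C5 * l2sq r"
    by (rule volterra_L2_solvable) blast
  obtain K where K: "K \<ge> 0" "\<And>f a b g x. L2_fun T g \<Longrightarrow> (\<forall>s\<in>{0..T}. f (T - s) = a + (T - s) *\<^sub>R b + back2 g s) \<Longrightarrow>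
    wave_op f \<in> borel_measurable borel \<and> norm (wave_op f x) \<le> K * sqrt (rep_size a b g)"
    by (rule wave_op_sup_bound) blast
  obtain k where k: "k \<ge> 0" "\<And>a :: complex^'n. (norm (c0 *v a))\<^sup>2 \<le> k * (norm a)\<^sup>2" by (rule c0_bound) blast
  define K0 where "K0 = 1 + T + T * sqrt T"
  have K0: "K0 \<ge> 0" using T by (simp add: K0_def)
  define m where "m = 2 + 2 * k"
  have m: "m \<ge> 0" using k by (simp add: m_def)
  define C4 where "C4 = 1 + m + C5 * (2 + 2 * (C3 * (K0\<^sup>2 + (1 + m))))"
  have C4: "C4 \<ge> 0" using m C3 C5 by (simp add: C4_def)
  show thesis
  proof (rule that[of "C2 * (C4 * C1)"])
    show "0 \<le> C2 * (C4 * C1)" using C1 C2 C4 by simp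
    fix y :: "real \<Rightarrow> complex^'n" assume "y \<in> H2 T"
    then obtain a b' h where yr: "H2_rep_back T y a b' h" and ys: "rep_size a b' h \<le> C1 * (H2_norm T y)\<^sup>2"
      using C1(2) by blast
    have h: "L2_fun T h" and yx: "\<And>x. x \<in> {0..T} \<Longrightarrow> y x = a + (T - x) *\<^sub>R b' + back2 h x"
      and y0: "\<And>x. x \<notin> {0..T} \<Longrightarrow> y x = 0" using yr by (auto simp: H2_rep_back_def)
    define S where "S = rep_size a b' h"
    have S: "(norm a)\<^sup>2 \<le> S" "(norm b')\<^sup>2 \<le> S" "l2sq h \<le> S" "0 \<le> S"
      by (simp_all add: S_def rep_size_eq l2sq_nonneg)
    \<comment> \<open>Solves \<open>b' = b + c0 *v a\<close>, the relation between the slopes in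
      \<open>wave_op_formula\<close>.\<close>
    define b where "b = b' - c0 *v a"
    have b: "(norm b)\<^sup>2 \<le> m * S"
    proof -
      have "k * (norm a)\<^sup>2 \<le> k * S" using S(1) k(1) by (rule mult_left_mono)
      then have "(norm b)\<^sup>2 \<le> 2 * S + 2 * (k * S)"
        using norm_add_square_le[of b' "- (c0 *v a)"] k(2)[of a] S(2) unfolding b_def by simp
      then show ?thesis by (simp add: m_def algebra_simps)
    qed
    have yp: "y = (\<lambda>c. indicator {0..T} c *\<^sub>R (a + (T - c) *\<^sub>R b' + back2 h c))"
      using yx y0 by (auto simp: indicator_def fun_eq_iff)
    have ym: "y \<in> borel_measurable borel" unfolding yp by (rule source_integrable(1)[OF h])
    have yb: "norm (y s) \<le> K0 * sqrt S" for s
      unfolding yp S_def K0_def by (rule source_integrable(2)[OF h])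
    have z: "L2_fun T (\<lambda>_. 0 :: complex^'n)" by (simp add: L2_fun_def)
    \<comment> \<open>Setting \<open>g\<close> to zero collects the terms of the second derivative
      that are already known.\<close>
    let ?e = "wave_op_data y a b (\<lambda>_. 0)"
    have Wi0: "Wi (\<lambda>_. 0) s = 0" for s by (simp add: Wi_def mv_zero_right)
    have e: "L2_fun T ?e" "l2sq ?e \<le> C3 * ((K0 * sqrt S)\<^sup>2 + rep_size a b (\<lambda>_. 0))"
      using C3(2)[OF z ym, of "K0 * sqrt S" a b] yb K0 S(4) by auto
    have "rep_size a b (\<lambda>_. 0) \<le> S + m * S" using S(1) b by (simp add: rep_size_def)
    then have "C3 * ((K0 * sqrt S)\<^sup>2 + rep_size a b (\<lambda>_. 0)) \<le> C3 * (K0\<^sup>2 * S + (S + m * S))"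
      using C3(1) S(4) by (intro mult_left_mono) (auto simp: power_mult_distrib)
    then have e2: "l2sq ?e \<le> C3 * (K0\<^sup>2 + (1 + m)) * S" using e(2) by (simp add: algebra_simps)
    define r where "r s = h s - ?e s" for s
    have r: "L2_fun T r" unfolding r_def by (rule L2_fun_diff[OF h e(1)])
    have r2: "l2sq r \<le> (2 + 2 * (C3 * (K0\<^sup>2 + (1 + m)))) * S"
      using l2sq_diff[OF h e(1)] e2 S(3) unfolding r_def by (simp add: algebra_simps)
    obtain g where g: "L2_fun T g" "\<And>s. g s + Wi g s = r s" "l2sq g \<le> C5 * l2sq r"
      using C5(2)[OF r] by blast
    have g2: "l2sq g \<le> C5 * (2 + 2 * (C3 * (K0\<^sup>2 + (1 + m)))) * S"
      using g(3) mult_left_mono[OF r2 C5(1)] by (simp add: mult.assoc)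
    define f where "f t = (if t \<in> {0..T} then a + t *\<^sub>R b + prim2 (\<lambda>r. g (T - r)) t else 0)" for t
    have fr: "H2_rep T f a b (\<lambda>r. g (T - r))"
      unfolding H2_rep_def using L2_fun_reflect(1)[OF g(1)] by (simp add: f_def)
    have fs: "f (T - s) = a + (T - s) *\<^sub>R b + back2 g s" if "s \<in> {0..T}" for s
      using that by (simp add: f_def prim2_reflect)
    have zm: "wave_op f \<in> borel_measurable borel" and zb: "\<And>x. norm (wave_op f x) \<le> K * sqrt (rep_size a b g)"
      using K(2)[OF g(1), of f a b] fs by blast+
    define d where "d x = wave_op f x - y x" for x
    have dm: "d \<in> borel_measurable borel" unfolding d_def using zm ym by measurable
    have db: "norm (d x) \<le> K * sqrt (rep_size a b g) + K0 * sqrt S" for x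
      unfolding d_def by (rule order_trans[OF norm_triangle_ineq4 add_mono[OF zb yb]])
    \<comment> \<open>By the choice of \<open>g\<close> the second derivative of the image differs
      from the prescribed \<open>h\<close> only in the potential term, which holds the image instead
      of \<open>y\<close>.\<close>
    have data: "wave_op_data (wave_op f) a b g s = h s + Q s *v d s" for s
      unfolding wave_op_data_def g(2) r_def d_def mv_diff_right by (simp add: Wi0)
    have iQ: "integrable lborel (\<lambda>s. max 0 (s - x) *\<^sub>R (Q s *v d s))" if "x \<in> {0..T}" for x
    proof -
      obtain cv where cv: "cv > 0" "\<And>(A :: complex^'n^'n) x. norm (A *v x) \<le> norm A * norm x * cv"
        using norm_matrix_vector_mult_bound by blast
      have "L2_fun T (\<lambda>s. Q s *v d s)"
        by (rule L2_fun_matrix_vector(1)[OF _ cv(2) Q dm db]) (use cv K(1) K0 S(4) rep_size_nonneg[of a b g] in auto)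
      then show ?thesis by (rule L2_fun_mult_integrable(1)[of _ _ _ T]) (use that in auto)
    qed
    have "d x = (LINT s|lborel. max 0 (s - x) *\<^sub>R (Q s *v d s))" if x: "x \<in> {0..T}" for x
    proof -
      have ih: "integrable lborel (\<lambda>s. max 0 (s - x) *\<^sub>R h s)"
        by (rule L2_fun_mult_integrable(1)[OF h, of _ T]) (use x in auto)
      have "back2 (wave_op_data (wave_op f) a b g) x = back2 h x + (LINT s|lborel. max 0 (s - x) *\<^sub>R (Q s *v d s))"
        unfolding back2_def data scaleR_add_right by (rule Bochner_Integration.integral_add[OF ih iQ[OF x]])
      then have "wave_op f x = a + (T - x) *\<^sub>R (b + c0 *v a) + (back2 h x + (LINT s|lborel. max 0 (s - x) *\<^sub>R (Q s *v d s)))"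
        using wave_op_formula[OF g(1) fs x] by simp
      then show ?thesis unfolding d_def[of x] yx[OF x] by (simp add: b_def)
    qed
    then have d0: "d x = 0" if "x \<in> {0..T}" for x by (rule Q_ode_unique[OF dm db _ that])
    have "wave_op f = y"
    proof
      fix x show "wave_op f x = y x" using d0[of x] y0[of x] by (cases "x \<in> {0..T}") (auto simp: d_def wave_op_def)
    qed
    moreover have "(H2_norm T f)\<^sup>2 \<le> C2 * (C4 * C1) * (H2_norm T y)\<^sup>2"
    proof -
      have "rep_size a b g \<le> S + m * S + C5 * (2 + 2 * (C3 * (K0\<^sup>2 + (1 + m)))) * S"
        unfolding rep_size_eq[of a b g] using S(1) b g2 by linarith
      also have "\<dots> = C4 * S" by (simp add: C4_def algebra_simps)
      also have "\<dots> \<le> C4 * (C1 * (H2_norm T y)\<^sup>2)" unfolding S_def by (rule mult_left_mono[OF ys C4])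
      finally have "C2 * rep_size a b g \<le> C2 * (C4 * (C1 * (H2_norm T y)\<^sup>2))" using C2(1) by (rule mult_left_mono)
      then show ?thesis using C2(2)[OF fr] unfolding L2_fun_reflect(2)[OF g(1)] by (simp add: mult.assoc)
    qed
    ultimately show "\<exists>f\<in>H2 T. wave_op f = y \<and> (H2_norm T f)\<^sup>2 \<le> C2 * (C4 * C1) * (H2_norm T y)\<^sup>2"
      using H2_rep_imp(1)[OF T fr] by blast
  qed
qed

lemma wave_op_inj: "inj_on wave_op (H2 T)"
proof (rule inj_onI)
  fix f1 f2 :: "real \<Rightarrow> complex^'n"
  assume f: "f1 \<in> H2 T" "f2 \<in> H2 T" and eq: "wave_op f1 = wave_op f2"
  obtain a1 b1 h1 where r1: "H2_rep T f1 a1 b1 h1" by (rule H2_imp_rep[OF T f(1)])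
  obtain a2 b2 h2 where r2: "H2_rep T f2 a2 b2 h2" by (rule H2_imp_rep[OF T f(2)])
  define g1 where "g1 r = h1 (T - r)" for r
  define g2 where "g2 r = h2 (T - r)" for r
  note s1 = H2_source[OF r1, folded g1_def] and s2 = H2_source[OF r2, folded g2_def]
  define p1 where "p1 c = indicator {0..T} c *\<^sub>R (a1 + (T - c) *\<^sub>R b1 + back2 g1 c)" for c
  define p2 where "p2 c = indicator {0..T} c *\<^sub>R (a2 + (T - c) *\<^sub>R b2 + back2 g2 c)" for c
  note i1 = source_integrable[where a=a1 and b=b1, OF s1(1), folded p1_def] and i2 = source_integrable[where a=a2 and b=b2, OF s2(1), folded p2_def]
  define d where "d x = p1 x - p2 x" for x
  have o1: "wave_op f1 x = p1 x + Wi p1 x" for x unfolding p1_def by (rule wave_op_eq_source[OF s1(2)])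
  have o2: "wave_op f2 x = p2 x + Wi p2 x" for x unfolding p2_def by (rule wave_op_eq_source[OF s2(2)])
  have Wd: "Wi d x = Wi p1 x - Wi p2 x" for x
    unfolding d_def Wi_def mv_diff_right
    by (rule Bochner_Integration.integral_diff[OF W_mult_integrable[OF L2_fun_integrable[OF i1(3)]] W_mult_integrable[OF L2_fun_integrable[OF i2(3)]]])
  have dW: "d x = - Wi d x" for x
  proof -
    have "p1 x + Wi p1 x = p2 x + Wi p2 x" using o1[of x] o2[of x] eq by simp
    then show ?thesis unfolding Wd d_def by (simp add: algebra_simps)
  qed
  have dm: "d \<in> borel_measurable borel" unfolding d_def using i1(1) i2(1) by (rule borel_measurable_diff)
  let ?M = "(1 + T + T * sqrt T) * sqrt (rep_size a1 b1 g1) + (1 + T + T * sqrt T) * sqrt (rep_size a2 b2 g2)"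
  have db: "norm (d x) \<le> ?M" for x
    unfolding d_def by (rule order_trans[OF norm_triangle_ineq4 add_mono[OF i1(2) i2(2)]])
  obtain Cv where Cv: "Cv \<ge> 0" "\<forall>u A M. u \<in> borel_measurable borel \<longrightarrow> (\<forall>x. norm (u x) \<le> M) \<longrightarrow> A \<ge> 0 \<longrightarrow>
     (\<forall>x\<in>{0..T}. norm (u x) \<le> A + norm (Wi u x)) \<longrightarrow> (\<forall>x\<in>{0..T}. norm (u x) \<le> Cv * A)"
    using volterra_estimate by (elim exE conjE) (rule that)
  have "norm (d x) \<le> 0 + norm (Wi d x)" for x using dW[of x] by (metis add_0 norm_minus_cancel order_refl)
  then have "norm (d x) \<le> Cv * 0" if "x \<in> {0..T}" for x
    using Cv(2)[rule_format, of d ?M 0 x] dm db that by simp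
  then have d0: "p1 x = p2 x" if "x \<in> {0..T}" for x using that by (simp add: d_def)
  show "f1 = f2"
  proof
    fix t show "f1 t = f2 t"
    proof (cases "t \<in> {0..T}")
      case True
      then have T': "T - t \<in> {0..T}" by auto
      then have "f1 (T - (T - t)) = f2 (T - (T - t))"
        using s1(2)[OF T'] s2(2)[OF T'] d0[OF T'] by (simp add: p1_def p2_def)
      then show ?thesis by simp
    next
      case False
      then show ?thesis using r1 r2 by (simp add: H2_rep_def)
    qed
  qed
qed

lemma H2_reflected_integrable:
  fixes f :: "real \<Rightarrow> complex^'n"
  assumes f: "f \<in> H2 T"
  shows "integrable lborel (\<lambda>s. indicator {0..T} s *\<^sub>R f (T - s))"
proof -
  obtain a b h where r: "H2_rep T f a b h" by (rule H2_imp_rep[OF T f])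
  note s = H2_source[OF r]
  have "(\<lambda>s. indicator {0..T} s *\<^sub>R f (T - s)) = (\<lambda>c. indicator {0..T} c *\<^sub>R (a + (T - c) *\<^sub>R b + back2 (\<lambda>r. h (T - r)) c))"
    using s(2) by (auto simp: indicator_def fun_eq_iff)
  then show ?thesis using L2_fun_integrable[OF source_integrable(3)[OF s(1), of a b]] by simp
qed

lemma wave_op_linear:
  assumes f: "f \<in> H2 T" and g: "g \<in> H2 T"
  shows "wave_op (\<lambda>x. a *s f x + b *s g x) = (\<lambda>x. a *s wave_op f x + b *s wave_op g x)"
proof
  fix x
  note i = H2_reflected_integrable
  have sc: "Wi (\<lambda>s. c *s u s) x = c *s Wi u x" and isc: "integrable lborel (\<lambda>s. c *s u s)" if u: "integrable lborel u" for c u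
  proof -
    show "Wi (\<lambda>s. c *s u s) x = c *s Wi u x"
      unfolding Wi_def vector_scalar_commute
      by (rule integral_bounded_linear[OF bounded_linear_vector_scale W_mult_integrable[OF u]])
    show "integrable lborel (\<lambda>s. c *s u s)" by (rule integrable_bounded_linear[OF bounded_linear_vector_scale u])
  qed
  let ?F = "\<lambda>s. indicator {0..T} s *\<^sub>R f (T - s)" and ?G = "\<lambda>s. indicator {0..T} s *\<^sub>R g (T - s)"
  have "Wi (\<lambda>s. indicator {0..T} s *\<^sub>R (a *s f (T - s) + b *s g (T - s))) x = Wi (\<lambda>s. a *s ?F s + b *s ?G s) x"
    by (rule Wi_cong) simp
  also have "\<dots> = Wi (\<lambda>s. a *s ?F s) x + Wi (\<lambda>s. b *s ?G s) x"
    by (rule Wi_add[OF isc[OF i[OF f]] isc[OF i[OF g]]])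
  also have "\<dots> = a *s Wi ?F x + b *s Wi ?G x" unfolding sc[OF i[OF f]] sc[OF i[OF g]] ..
  finally show "wave_op (\<lambda>x. a *s f x + b *s g x) x = a *s wave_op f x + b *s wave_op g x"
    by (simp add: wave_op_def vector_add_ldistrib)
qed

lemma H2_norm_nonneg: "0 \<le> H2_norm T f"
  unfolding H2_norm_def by (intro real_sqrt_ge_zero Bochner_Integration.integral_nonneg) auto

lemma wave_op_isomorphism: "H2_isomorphism T wave_op"
proof -
  obtain C1 where C1: "C1 \<ge> 0" "\<And>f. f \<in> H2 T \<Longrightarrow> wave_op f \<in> H2 T \<and> (H2_norm T (wave_op f))\<^sup>2 \<le> C1 * (H2_norm T f)\<^sup>2"
    by (rule wave_op_H2_bound) blast
  obtain C2 where C2: "C2 \<ge> 0" "\<And>y. y \<in> H2 T \<Longrightarrow> \<exists>f\<in>H2 T. wave_op f = y \<and> (H2_norm T f)\<^sup>2 \<le> C2 * (H2_norm T y)\<^sup>2"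
    by (rule wave_op_H2_surj) blast
  have sq: "x \<le> sqrt C * y" if "x\<^sup>2 \<le> C * y\<^sup>2" "0 \<le> y" for x y C :: real
    using real_sqrt_le_mono[OF that(1)] that(2) by (simp add: real_sqrt_mult)
  show ?thesis
    unfolding H2_isomorphism_def
  proof (intro conjI)
    show "\<forall>f\<in>H2 T. \<forall>g\<in>H2 T. \<forall>a b. wave_op (\<lambda>x. a *s f x + b *s g x) = (\<lambda>x. a *s wave_op f x + b *s wave_op g x)"
      using wave_op_linear by blast
    show "bij_betw wave_op (H2 T) (H2 T)"
      unfolding bij_betw_def using wave_op_inj C1(2) C2(2) by blast
    show "\<exists>C. \<forall>f\<in>H2 T. H2_norm T (wave_op f) \<le> C * H2_norm T f"
      using C1(2) sq H2_norm_nonneg by (intro exI[of _ "sqrt C1"]) blast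
    show "\<exists>C. \<forall>g\<in>H2 T. H2_norm T (inv_into (H2 T) wave_op g) \<le> C * H2_norm T g"
    proof (intro exI[of _ "sqrt C2"] ballI)
      fix y :: "real \<Rightarrow> complex^'n" assume "y \<in> H2 T"
      then obtain f where f: "f \<in> H2 T" "wave_op f = y" "(H2_norm T f)\<^sup>2 \<le> C2 * (H2_norm T y)\<^sup>2" using C2(2) by blast
      have "inv_into (H2 T) wave_op y = f" using inv_into_f_f[OF wave_op_inj f(1)] f(2) by simp
      then show "H2_norm T (inv_into (H2 T) wave_op y) \<le> sqrt C2 * H2_norm T y"
        using sq[OF f(3) H2_norm_nonneg] by simp
    qed
  qed
qed

end

section \<open>From the integral equation to Duhamel's formula\<close>

text \<open>The integral equation evaluates \<open>q\<close> at
  \<open>(\<eta>\<^sub>1 - \<xi>\<^sub>1) / 2\<close>, so the almost everywhere equality of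
  \<open>q\<close> and \<open>Q\<close> has to be carried through an affine map.\<close>

lemma AE_lborel_affine:
  fixes P :: "real \<Rightarrow> bool"
  assumes "AE x in lborel. P x" "c \<noteq> 0"
  shows "AE x in lborel. P (t + c * x)"
proof -
  obtain N where N: "N \<in> null_sets lborel" "{x \<in> space lborel. \<not> P x} \<subseteq> N"
    using assms(1) by (auto simp: eventually_ae_filter)
  have "AE x in density (distr lborel borel (\<lambda>x. t + c * x)) (\<lambda>_. ennreal \<bar>c\<bar>). x \<notin> N"
    using AE_not_in[OF N(1)] by (subst (asm) lborel_real_affine[OF assms(2), of t])
  then have "AE x in distr lborel borel (\<lambda>x. t + c * x). x \<notin> N"
    using assms(2) by (subst (asm) AE_density) auto
  then have "AE x in lborel. t + c * x \<notin> N"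
    by (rule AE_distrD[rotated]) measurable
  then show ?thesis
  proof eventually_elim
    case (elim x)
    then show ?case using N(2) by auto
  qed
qed

lemma integral_eq_LINT:
  fixes f g :: "real \<Rightarrow> 'a::euclidean_space"
  assumes ae: "AE x in lborel. x \<in> {a..b} \<longrightarrow> f x = g x" and g: "integrable lborel (\<lambda>x. indicator {a..b} x *\<^sub>R g x)"
  shows "integral {a..b} f = (LINT x|lborel. indicator {a..b} x *\<^sub>R g x)"
proof -
  have s: "set_integrable lborel {a..b} g" using g by (simp add: set_integrable_def)
  obtain N where N: "negligible N" "\<And>x. x \<notin> N \<Longrightarrow> x \<in> {a..b} \<longrightarrow> f x = g x"
    using AE_lborel_imp_negligible[OF ae] by blast
  have "integral {a..b} f = integral {a..b} g"
    by (rule integral_spike[OF N(1)]) (use N(2) in auto)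
  then show ?thesis using set_borel_integral_eq_integral(2)[OF s] by (simp add: set_lebesgue_integral_def)
qed

text \<open>Change from characteristic to space-time coordinates,
  \<open>\<xi>\<^sub>1 = c - y\<close> and \<open>\<eta>\<^sub>1 = c + y\<close>. The Jacobian 2
  turns the factor 1/4 into 1/2, and the rectangle of integration becomes the difference of the two
  cones.\<close>

lemma wave_kernel_of_solution:
  fixes q :: "real \<Rightarrow> complex^'n^'n" and v :: "real \<Rightarrow> real \<Rightarrow> complex^'n^'n"
  assumes T: "T > 0" and q: "L2_on {0..T} q" and v: "kernel_solution T q v"
  defines "W \<equiv> \<lambda>x s. if 0 \<le> x \<and> x \<le> s \<and> s \<le> T then v (s - x) (s + x) else 0"
  obtains B Q where "wave_kernel T W B Q"
proof -
  obtain Q where Q: "L2_fun T Q" and Qae: "AE x in lborel. x \<in> {0..T} \<longrightarrow> q x = Q x"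
    by (rule L2_on_borel_representative[OF q])
  note [measurable] = L2_funD(1)[OF Q]
  have cont: "continuous_on (kernel_domain T) (\<lambda>(\<xi>, \<eta>). v \<xi> \<eta>)"
    and eq: "\<And>\<xi> \<eta>. (\<xi>, \<eta>) \<in> kernel_domain T \<Longrightarrow> v \<xi> \<eta> = - ((1/2) *\<^sub>R integral {\<xi>/2..\<eta>/2} q)
               - (1/4) *\<^sub>R integral {0..\<xi>} (\<lambda>\<xi>\<^sub>1. integral {\<xi>..\<eta>} (\<lambda>\<eta>\<^sub>1. q ((\<eta>\<^sub>1 - \<xi>\<^sub>1) / 2) ** v \<xi>\<^sub>1 \<eta>\<^sub>1))"
    using v unfolding kernel_solution_def by auto
  define A where "A = {z :: real \<times> real. 0 \<le> fst z \<and> fst z \<le> snd z \<and> snd z \<le> T}"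
  define w where "w z = v (snd z - fst z) (snd z + fst z)" for z :: "real \<times> real"
  have W: "W x s = indicator A (x, s) *\<^sub>R w (x, s)" for x s
    by (simp add: W_def A_def w_def indicator_def)
  have closedA: "closed A"
  proof -
    have "A = {z. 0 \<le> fst z} \<inter> {z. fst z \<le> snd z} \<inter> {z. snd z \<le> T}" by (auto simp: A_def)
    then show ?thesis by (simp only:) (intro closed_Int closed_Collect_le continuous_intros)
  qed
  have "A \<subseteq> {0..T} \<times> {0..T}" by (auto simp: A_def)
  then have "bounded A" using bounded_subset bounded_Times[of "{0..T}" "{0..T}"] by auto
  with closedA have compA: "compact A" by (simp add: compact_eq_bounded_closed)
  have contw: "continuous_on A w"
  proof -
    have "continuous_on A (\<lambda>z. (\<lambda>(\<xi>, \<eta>). v \<xi> \<eta>) (snd z - fst z, snd z + fst z))"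
      by (rule continuous_on_compose2[OF cont]) (auto intro!: continuous_intros simp: A_def kernel_domain_def)
    then show ?thesis by (simp add: w_def[abs_def])
  qed
  obtain B where B: "\<And>z. z \<in> A \<Longrightarrow> norm (w z) \<le> B"
    using compact_imp_bounded[OF compact_continuous_image[OF contw compA]] unfolding bounded_iff by blast
  have B0: "0 \<le> B" using B[of "(0,0)"] T order_trans[OF norm_ge_zero] by (auto simp: A_def)
  have volt: "volterra_kernel T W B"
  proof
    show "T > 0" by (rule T)
    have "(\<lambda>z. indicator A z *\<^sub>R w z) \<in> borel_measurable borel"
      by (rule borel_measurable_continuous_on_indicator[OF borel_closed[OF closedA] contw])
    then show "(\<lambda>z. W (fst z) (snd z)) \<in> borel_measurable (borel \<Otimes>\<^sub>M borel)"
      by (simp add: W borel_prod)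
    show "norm (W x s) \<le> B" for x s using B[of "(x, s)"] B0 by (simp add: W indicator_def)
    show "W x s = 0" if "\<not> (0 \<le> x \<and> x \<le> s \<and> s \<le> T)" for x s using that unfolding W_def by (rule if_not_P)
    fix x s :: real assume x: "x \<in> {0..T}" and ne: "s \<noteq> x"
    show "((\<lambda>x. W x s) \<longlongrightarrow> W x s) (at x within {0..T})"
    proof (cases "x < s \<and> s \<le> T")
      case True
      have "continuous_on {0..s} (\<lambda>x. w (x, s))"
        by (rule continuous_on_compose2[OF contw]) (auto intro!: continuous_intros simp: A_def True)
      then have "((\<lambda>x. w (x, s)) \<longlongrightarrow> w (x, s)) (at x within {0..s})"
        using x True by (auto simp: continuous_on)
      moreover have "at x within {0..s} = at x within {0..T}"
      proof (rule at_within_nhd[of _ "{..<s}"])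
        show "{0..s} \<inter> {..<s} - {x} = {0..T} \<inter> {..<s} - {x}" using True by auto
      qed (use True in auto)
      ultimately have lim: "((\<lambda>x. w (x, s)) \<longlongrightarrow> w (x, s)) (at x within {0..T})" by simp
      have "eventually (\<lambda>y. y < s) (at x within {0..T})"
        using True by (intro order_tendstoD(2)[OF tendsto_ident_at]) auto
      moreover have "eventually (\<lambda>y. y \<in> {0..T}) (at x within {0..T})" by (simp add: eventually_at_filter)
      ultimately have "eventually (\<lambda>y. w (y, s) = W y s) (at x within {0..T})"
        by eventually_elim (use True in \<open>simp add: W A_def\<close>)
      moreover have "W x s = w (x, s)" using True x by (simp add: W A_def)
      ultimately show ?thesis using Lim_transform_eventually[OF lim] by simp
    next
      case False
      have "eventually (\<lambda>y. W y s = 0) (at x within {0..T})"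
      proof (cases "s \<le> T")
        case True
        then have "s < x" using False ne by auto
        then have "eventually (\<lambda>y. s < y) (at x within {0..T})"
          by (intro order_tendstoD(1)[OF tendsto_ident_at]) auto
        then show ?thesis by eventually_elim (simp add: W_def)
      next
        case F: False
        then have "W y s = 0" for y by (simp add: W_def)
        then show ?thesis by simp
      qed
      moreover have "W x s = 0" using False ne by (auto simp: W_def)
      ultimately show ?thesis by (simp add: tendsto_eventually)
    qed
  qed
  interpret volterra_kernel T W B by (rule volt)
  obtain cm where cm: "cm > 0" "\<And>(A :: complex^'n^'n) (B :: complex^'n^'n). norm (A ** B) \<le> norm A * norm B * cm"
    using norm_matrix_matrix_mult_bound by blast
  have QW: "norm (Q y ** W x s) \<le> B * cm * norm (Q y)" for x y s
  proof -
    have "norm (Q y ** W x s) \<le> norm (Q y) * norm (W x s) * cm" by (rule cm)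
    also have "\<dots> \<le> norm (Q y) * B * cm" using cm(1) W_bound by (intro mult_right_mono mult_left_mono) auto
    finally show ?thesis by (simp add: mult_ac)
  qed
  have iQ: "integrable lborel Q" by (rule L2_fun_integrable[OF Q])
  have iQn: "integrable lborel (\<lambda>y. B * cm * norm (Q y))" using iQ by (intro integrable_mult_right integrable_norm)
  have K: "W x t = - (1/2) *\<^sub>R ((LINT y|lborel. cone_diff x t y y *\<^sub>R Q y) +
        (LINT z|(lborel \<Otimes>\<^sub>M lborel). cone_diff x t (fst z) (snd z) *\<^sub>R (Q (fst z) ** W (fst z) (snd z))))"
    if xt: "0 \<le> x" "x \<le> t" "t \<le> T" for x t
  proof -
    define \<xi> where "\<xi> = t - x"
    define \<eta> where "\<eta> = t + x"
    have dom: "(\<xi>, \<eta>) \<in> kernel_domain T" "0 \<le> \<xi>" "\<xi> \<le> \<eta>" "\<eta> \<le> 2 * T" using xt by (auto simp: kernel_domain_def \<xi>_def \<eta>_def)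
    have Wv: "W x t = v \<xi> \<eta>" using xt by (simp add: W_def \<xi>_def \<eta>_def)
    have first: "integral {\<xi>/2..\<eta>/2} q = (LINT y|lborel. cone_diff x t y y *\<^sub>R Q y)"
    proof -
      have "integral {\<xi>/2..\<eta>/2} q = (LINT y|lborel. indicator {\<xi>/2..\<eta>/2} y *\<^sub>R Q y)"
      proof (rule integral_eq_LINT)
        show "AE y in lborel. y \<in> {\<xi>/2..\<eta>/2} \<longrightarrow> q y = Q y"
          using Qae by eventually_elim (use xt in \<open>auto simp: \<xi>_def \<eta>_def\<close>)
        show "integrable lborel (\<lambda>y. indicator {\<xi>/2..\<eta>/2} y *\<^sub>R Q y)"
          by (rule L2_fun_mult_integrable(1)[OF Q, of _ 1]) (auto simp: indicator_def)
      qed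
      \<comment> \<open>On the diagonal the cone difference is exactly this closed interval: the
        strict inequality for the mirror cone keeps the end point \<open>\<xi> / 2\<close>.\<close>
      moreover have "indicator {\<xi>/2..\<eta>/2} y = cone_diff x t y y" for y
        using xt by (auto simp: cone_diff_def \<xi>_def \<eta>_def indicator_def abs_if)
      ultimately show ?thesis by (simp only:)
    qed
    \<comment> \<open>The integrand after the substitution
      \<open>\<eta>\<^sub>1 = \<xi>\<^sub>1 + 2 * y\<close> at fixed \<open>\<xi>\<^sub>1\<close>;
      the time \<open>c\<close> is then \<open>\<xi>\<^sub>1 + y\<close>. A shift from
      \<open>\<xi>\<^sub>1\<close> to \<open>c\<close> follows after the order of integration is
      exchanged.\<close>
    define F where "F \<xi>\<^sub>1 y = (indicator {0..\<xi>} \<xi>\<^sub>1 * indicator {\<xi>..\<eta>} (\<xi>\<^sub>1 + 2 * y)) *\<^sub>R (Q y ** W y (\<xi>\<^sub>1 + y))" for \<xi>\<^sub>1 y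
    have Fint: "integrable (lborel \<Otimes>\<^sub>M lborel) (\<lambda>(\<xi>\<^sub>1, y). F \<xi>\<^sub>1 y)"
    proof (rule lborel_pair.integrable_pair_bound)
      show "(\<lambda>(\<xi>\<^sub>1, y). F \<xi>\<^sub>1 y) \<in> borel_measurable (lborel \<Otimes>\<^sub>M lborel)" unfolding F_def by measurable
      show "integrable lborel (\<lambda>x. indicator {0..\<xi>} x :: real)" by (rule integrable_indicator_Icc)
      show "integrable lborel (\<lambda>y. B * cm * norm (Q y))" by (rule iQn)
      fix \<xi>\<^sub>1 y show "norm (case (\<xi>\<^sub>1, y) of (\<xi>\<^sub>1, y) \<Rightarrow> F \<xi>\<^sub>1 y) \<le> indicator {0..\<xi>} \<xi>\<^sub>1 * (B * cm * norm (Q y))"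
        using QW[of y y "\<xi>\<^sub>1 + y"] B0 cm(1) by (auto simp: F_def indicator_def)
    qed
    have inner: "integral {\<xi>..\<eta>} (\<lambda>\<eta>\<^sub>1. q ((\<eta>\<^sub>1 - \<xi>\<^sub>1) / 2) ** v \<xi>\<^sub>1 \<eta>\<^sub>1) = 2 *\<^sub>R (LINT y|lborel. F \<xi>\<^sub>1 y)" if \<xi>1: "\<xi>\<^sub>1 \<in> {0..\<xi>}" for \<xi>\<^sub>1
    proof -
      define H where "H \<eta>\<^sub>1 = Q ((\<eta>\<^sub>1 - \<xi>\<^sub>1) / 2) ** W ((\<eta>\<^sub>1 - \<xi>\<^sub>1) / 2) ((\<eta>\<^sub>1 + \<xi>\<^sub>1) / 2)" for \<eta>\<^sub>1
      have "AE \<eta>\<^sub>1 in lborel. - \<xi>\<^sub>1 / 2 + 1/2 * \<eta>\<^sub>1 \<in> {0..T} \<longrightarrow> q (- \<xi>\<^sub>1 / 2 + 1/2 * \<eta>\<^sub>1) = Q (- \<xi>\<^sub>1 / 2 + 1/2 * \<eta>\<^sub>1)"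
        by (rule AE_lborel_affine[OF Qae]) simp
      then have ae: "AE \<eta>\<^sub>1 in lborel. \<eta>\<^sub>1 \<in> {\<xi>..\<eta>} \<longrightarrow> q ((\<eta>\<^sub>1 - \<xi>\<^sub>1) / 2) ** v \<xi>\<^sub>1 \<eta>\<^sub>1 = H \<eta>\<^sub>1"
      proof eventually_elim
        case (elim \<eta>\<^sub>1)
        show ?case
        proof
          assume e: "\<eta>\<^sub>1 \<in> {\<xi>..\<eta>}"
          have a: "- \<xi>\<^sub>1 / 2 + 1/2 * \<eta>\<^sub>1 = (\<eta>\<^sub>1 - \<xi>\<^sub>1) / 2" by (simp add: field_simps)
          have d: "(\<eta>\<^sub>1 + \<xi>\<^sub>1) / 2 - (\<eta>\<^sub>1 - \<xi>\<^sub>1) / 2 = \<xi>\<^sub>1" "(\<eta>\<^sub>1 + \<xi>\<^sub>1) / 2 + (\<eta>\<^sub>1 - \<xi>\<^sub>1) / 2 = \<eta>\<^sub>1" by (simp_all add: field_simps)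
          have r: "0 \<le> (\<eta>\<^sub>1 - \<xi>\<^sub>1) / 2" "(\<eta>\<^sub>1 - \<xi>\<^sub>1) / 2 \<le> (\<eta>\<^sub>1 + \<xi>\<^sub>1) / 2" "(\<eta>\<^sub>1 + \<xi>\<^sub>1) / 2 \<le> T"
            using e \<xi>1 xt by (auto simp: \<xi>_def \<eta>_def field_simps)
          then have "W ((\<eta>\<^sub>1 - \<xi>\<^sub>1) / 2) ((\<eta>\<^sub>1 + \<xi>\<^sub>1) / 2) = v \<xi>\<^sub>1 \<eta>\<^sub>1" unfolding W_def d by (simp only: simp_thms if_True)
          moreover have "q ((\<eta>\<^sub>1 - \<xi>\<^sub>1) / 2) = Q ((\<eta>\<^sub>1 - \<xi>\<^sub>1) / 2)" using elim r unfolding a by auto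
          ultimately show "q ((\<eta>\<^sub>1 - \<xi>\<^sub>1) / 2) ** v \<xi>\<^sub>1 \<eta>\<^sub>1 = H \<eta>\<^sub>1" by (simp only: H_def)
        qed
      qed
      have Hm: "(\<lambda>\<eta>\<^sub>1. indicator {\<xi>..\<eta>} \<eta>\<^sub>1 *\<^sub>R H \<eta>\<^sub>1) \<in> borel_measurable borel" unfolding H_def by measurable
      have Hi: "integrable lborel (\<lambda>\<eta>\<^sub>1. indicator {\<xi>..\<eta>} \<eta>\<^sub>1 *\<^sub>R H \<eta>\<^sub>1)"
      proof (rule integrable_norm_le)
        show "integrable lborel (\<lambda>\<eta>\<^sub>1. B * cm * norm (Q (- \<xi>\<^sub>1 / 2 + 1/2 * \<eta>\<^sub>1)))"
          by (rule lborel_integrable_real_affine[OF iQn]) simp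
        fix \<eta>\<^sub>1
        have a: "- \<xi>\<^sub>1 / 2 + 1/2 * \<eta>\<^sub>1 = (\<eta>\<^sub>1 - \<xi>\<^sub>1) / 2" by (simp add: field_simps)
        show "norm (indicator {\<xi>..\<eta>} \<eta>\<^sub>1 *\<^sub>R H \<eta>\<^sub>1) \<le> B * cm * norm (Q (- \<xi>\<^sub>1 / 2 + 1/2 * \<eta>\<^sub>1))"
          unfolding a H_def using QW[of "(\<eta>\<^sub>1 - \<xi>\<^sub>1) / 2" "(\<eta>\<^sub>1 - \<xi>\<^sub>1) / 2" "(\<eta>\<^sub>1 + \<xi>\<^sub>1) / 2"] B0 cm(1) by (auto simp: indicator_def)
      qed (use Hm in simp)
      have sub: "indicator {\<xi>..\<eta>} (\<xi>\<^sub>1 + 2 * y) *\<^sub>R H (\<xi>\<^sub>1 + 2 * y) = F \<xi>\<^sub>1 y" for y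
      proof -
        have "(\<xi>\<^sub>1 + 2 * y - \<xi>\<^sub>1) / 2 = y" "(\<xi>\<^sub>1 + 2 * y + \<xi>\<^sub>1) / 2 = \<xi>\<^sub>1 + y" by (simp_all add: field_simps)
        then show ?thesis unfolding H_def F_def using \<xi>1 by (simp only: indicator_simps mult_1_left)
      qed
      have "integral {\<xi>..\<eta>} (\<lambda>\<eta>\<^sub>1. q ((\<eta>\<^sub>1 - \<xi>\<^sub>1) / 2) ** v \<xi>\<^sub>1 \<eta>\<^sub>1) = (LINT \<eta>\<^sub>1|lborel. indicator {\<xi>..\<eta>} \<eta>\<^sub>1 *\<^sub>R H \<eta>\<^sub>1)"
        by (rule integral_eq_LINT[OF ae Hi])
      also have "\<dots> = \<bar>2\<bar> *\<^sub>R (LINT y|lborel. indicator {\<xi>..\<eta>} (\<xi>\<^sub>1 + 2 * y) *\<^sub>R H (\<xi>\<^sub>1 + 2 * y))"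
        by (rule lborel_integral_real_affine) simp
      also have "\<dots> = 2 *\<^sub>R (LINT y|lborel. F \<xi>\<^sub>1 y)" unfolding sub by simp
      finally show ?thesis .
    qed
    have F0: "F \<xi>\<^sub>1 y = 0" if "\<xi>\<^sub>1 \<notin> {0..\<xi>}" for \<xi>\<^sub>1 y using that by (simp add: F_def)
    have LF0: "indicator {0..\<xi>} \<xi>\<^sub>1 *\<^sub>R (2 *\<^sub>R (LINT y|lborel. F \<xi>\<^sub>1 y)) = 2 *\<^sub>R (LINT y|lborel. F \<xi>\<^sub>1 y)" for \<xi>\<^sub>1
      using F0[of \<xi>\<^sub>1] by (cases "\<xi>\<^sub>1 \<in> {0..\<xi>}") auto
    have iF: "integrable lborel (\<lambda>\<xi>\<^sub>1. 2 *\<^sub>R (LINT y|lborel. F \<xi>\<^sub>1 y))"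
      by (rule integrable_scaleR_right[OF lborel_pair.integrable_fst[OF Fint]])
    have outer: "integral {0..\<xi>} (\<lambda>\<xi>\<^sub>1. integral {\<xi>..\<eta>} (\<lambda>\<eta>\<^sub>1. q ((\<eta>\<^sub>1 - \<xi>\<^sub>1) / 2) ** v \<xi>\<^sub>1 \<eta>\<^sub>1)) = 2 *\<^sub>R (LINT \<xi>\<^sub>1|lborel. LINT y|lborel. F \<xi>\<^sub>1 y)"
    proof -
      have "integral {0..\<xi>} (\<lambda>\<xi>\<^sub>1. integral {\<xi>..\<eta>} (\<lambda>\<eta>\<^sub>1. q ((\<eta>\<^sub>1 - \<xi>\<^sub>1) / 2) ** v \<xi>\<^sub>1 \<eta>\<^sub>1))
         = (LINT \<xi>\<^sub>1|lborel. indicator {0..\<xi>} \<xi>\<^sub>1 *\<^sub>R (2 *\<^sub>R (LINT y|lborel. F \<xi>\<^sub>1 y)))"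
        by (rule integral_eq_LINT) (auto simp only: inner LF0 iF intro!: AE_I2)
      then show ?thesis unfolding LF0 by (simp only: Bochner_Integration.integral_scaleR_right)
    qed
    have swap: "(LINT \<xi>\<^sub>1|lborel. LINT y|lborel. F \<xi>\<^sub>1 y) = (LINT y|lborel. LINT \<xi>\<^sub>1|lborel. F \<xi>\<^sub>1 y)"
      by (rule lborel_pair.Fubini_integral[OF Fint, symmetric])
    have shift: "(LINT \<xi>\<^sub>1|lborel. F \<xi>\<^sub>1 y) = (LINT c|lborel. cone_diff x t y c *\<^sub>R (Q y ** W y c))" for y
    proof -
      have "(LINT \<xi>\<^sub>1|lborel. F \<xi>\<^sub>1 y) = \<bar>1\<bar> *\<^sub>R (LINT c|lborel. F (- y + 1 * c) y)"
        by (rule lborel_integral_real_affine) simp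
      moreover have "F (- y + 1 * c) y = cone_diff x t y c *\<^sub>R (Q y ** W y c)" for c
      proof (cases "0 \<le> y \<and> y \<le> c \<and> c \<le> T")
        case True
        \<comment> \<open>The direct cone is \<open>c - y \<le> \<xi>\<close> and
          \<open>c + y \<le> \<eta>\<close>, the mirror cone is \<open>c + y < \<xi>\<close>; so the
          bound \<open>\<xi> \<le> c + y\<close> of the rectangle is the complement of the mirror
          cone.\<close>
        have "indicator {0..\<xi>} (- y + 1 * c) * indicator {\<xi>..\<eta>} (- y + 1 * c + 2 * y) = cone_diff x t y c"
          using True xt by (auto simp: cone_diff_def \<xi>_def \<eta>_def indicator_def abs_if)
        moreover have "- y + 1 * c + y = c" by simp
        ultimately show ?thesis unfolding F_def by (simp only:)
      next
        case False
        then have "W y c = 0" by (rule W_outside)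
        then show ?thesis by (simp add: F_def bounded_bilinear.zero_right[OF bounded_bilinear_matrix_matrix_mult])
      qed
      ultimately show ?thesis by simp
    qed
    have iG: "integrable (lborel \<Otimes>\<^sub>M lborel) (\<lambda>z. cone_diff x t (fst z) (snd z) *\<^sub>R (Q (fst z) ** W (fst z) (snd z)))"
    proof (rule lborel_pair.integrable_pair_bound)
      show "(\<lambda>z. cone_diff x t (fst z) (snd z) *\<^sub>R (Q (fst z) ** W (fst z) (snd z))) \<in> borel_measurable (lborel \<Otimes>\<^sub>M lborel)" by measurable
      show "integrable lborel (\<lambda>y. B * cm * norm (Q y))" by (rule iQn)
      show "integrable lborel (\<lambda>c. indicator {0..T} c :: real)" by (rule integrable_indicator_Icc)
      fix y c
      show "norm (cone_diff x t (fst (y, c)) (snd (y, c)) *\<^sub>R (Q (fst (y, c)) ** W (fst (y, c)) (snd (y, c)))) \<le> B * cm * norm (Q y) * indicator {0..T} c"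
      proof (cases "c \<in> {0..T}")
        case True
        have "\<bar>cone_diff x t y c\<bar> * norm (Q y ** W y c) \<le> 1 * (B * cm * norm (Q y))"
          by (rule mult_mono[OF cone_bound QW]) auto
        then show ?thesis using True by simp
      next
        case False
        then have "W y c = 0" by (intro W_outside) auto
        then show ?thesis using False by (simp add: bounded_bilinear.zero_right[OF bounded_bilinear_matrix_matrix_mult])
      qed
    qed
    have pair: "(LINT z|(lborel \<Otimes>\<^sub>M lborel). cone_diff x t (fst z) (snd z) *\<^sub>R (Q (fst z) ** W (fst z) (snd z)))
        = (LINT y|lborel. LINT c|lborel. cone_diff x t y c *\<^sub>R (Q y ** W y c))"
      using lborel_pair.integral_fst'[OF iG] by simp
    show ?thesis
      unfolding Wv pair eq[OF dom(1)] first outer swap shift by (simp add: scaleR_add_right)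
  qed
  have "wave_kernel T W B Q"
    by (unfold_locales) (rule Q, rule K)
  then show thesis by (rule that)
qed

theorem theorem3:
  fixes T :: real
    and q :: "real \<Rightarrow> complex^'n^'n"
    and v w :: "real \<Rightarrow> real \<Rightarrow> complex^'n^'n"
  assumes "T > 0"
    and "L2_on {0..T} q"
    and "kernel_solution T q v"
    and "\<And>x t. 0 \<le> x \<Longrightarrow> x \<le> t \<Longrightarrow> t \<le> T \<Longrightarrow> w x t = v (t - x) (t + x)"
  shows "H2_isomorphism T (W_op T w)"
proof -
  define W where "W x s = (if 0 \<le> x \<and> x \<le> s \<and> s \<le> T then v (s - x) (s + x) else 0)" for x s
  obtain B Q where "wave_kernel T W B Q"
    using wave_kernel_of_solution[OF assms(1-3)] unfolding W_def[abs_def] by blast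
  then interpret wave_kernel T W B Q .
  \<comment> \<open>Stated for integrable sources instead of elements of \<open>H2\<close>, so that
    it also covers linear combinations in the proof of linearity.\<close>
  have eq': "W_op T w f = wave_op f" if i: "integrable lborel (\<lambda>s. indicator {0..T} s *\<^sub>R f (T - s))" for f
  proof
    fix x
    show "W_op T w f x = wave_op f x"
    proof (cases "x \<in> {0..T}")
      case True
      have e: "indicator {x..T} s *\<^sub>R (W x s *v (indicator {0..T} s *\<^sub>R f (T - s))) = W x s *v (indicator {0..T} s *\<^sub>R f (T - s))" for s
        using W_outside[of x s] by (cases "s \<in> {x..T}") (auto simp: mv_zero_left)
      have "integral {x..T} (\<lambda>s. w x s *v f (T - s)) = (LINT s|lborel. indicator {x..T} s *\<^sub>R (W x s *v (indicator {0..T} s *\<^sub>R f (T - s))))"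
      proof (rule integral_eq_LINT)
        show "AE s in lborel. s \<in> {x..T} \<longrightarrow> w x s *v f (T - s) = W x s *v (indicator {0..T} s *\<^sub>R f (T - s))"
          using True assms(4) by (intro AE_I2) (auto simp: W_def)
        show "integrable lborel (\<lambda>s. indicator {x..T} s *\<^sub>R (W x s *v (indicator {0..T} s *\<^sub>R f (T - s))))"
          unfolding e by (rule W_mult_integrable[OF i])
      qed
      then show ?thesis using True unfolding e by (simp add: W_op_def wave_op_def Wi_def)
    next
      case False
      then show ?thesis unfolding W_op_def wave_op_def by (simp only: if_False)
    qed
  qed
  have eq: "W_op T w f = wave_op f" if "f \<in> H2 T" for f
    by (rule eq'[OF H2_reflected_integrable[OF that]])
  note iso = wave_op_isomorphism[unfolded H2_isomorphism_def]
  have lin: "W_op T w (\<lambda>x. a *s f x + b *s g x) = (\<lambda>x. a *s W_op T w f x + b *s W_op T w g x)"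
    if fg: "f \<in> H2 T" "g \<in> H2 T" for f g a b
  proof -
    note i = integrable_bounded_linear[OF bounded_linear_vector_scale H2_reflected_integrable]
    have "indicator {0..T} s *\<^sub>R (a *s f (T - s) + b *s g (T - s)) =
        a *s (indicator {0..T} s *\<^sub>R f (T - s)) + b *s (indicator {0..T} s *\<^sub>R g (T - s))" for s
      by (simp add: indicator_def)
    then have "integrable lborel (\<lambda>s. indicator {0..T} s *\<^sub>R (a *s f (T - s) + b *s g (T - s)))"
      using Bochner_Integration.integrable_add[OF i[OF fg(1), of a] i[OF fg(2), of b]] by (simp only:)
    then have "W_op T w (\<lambda>x. a *s f x + b *s g x) = wave_op (\<lambda>x. a *s f x + b *s g x)" by (rule eq')
    then show ?thesis using eq[OF fg(1)] eq[OF fg(2)] wave_op_linear[OF fg, of a b] by (simp only:)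
  qed
  have bij: "bij_betw (W_op T w) (H2 T) (H2 T)"
    using iso bij_betw_cong[of "H2 T" "W_op T w" wave_op "H2 T"] eq by blast
  \<comment> \<open>Both inverses choose a preimage by the same predicate, as the two operators
    agree on \<open>H2 T\<close>.\<close>
  have inv: "inv_into (H2 T) (W_op T w) g = inv_into (H2 T) wave_op g" if "g \<in> H2 T" for g
    unfolding inv_into_def using eq by (intro arg_cong[where f=Eps]) (auto simp: fun_eq_iff)
  show ?thesis
    unfolding H2_isomorphism_def
    using lin bij iso eq inv by simp
qed

end
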